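(* Let $r\ge 2$ be an integer and let $G$ be a (simple) graph on $n$ vertices. If $G$ contains no copy of $K_{r+1}$ as a subgraph and $G$ is not $r$-partite, then \[ \lambda(G)\le \lambda(Y_r(n)), \] and equality holds if and only if $G$ is isomorphic to $Y_r(n)$.
   Context: For a graph $G$, $\lambda(G)$ denotes the spectral radius of $G$, i.e. the largest eigenvalue of its adjacency matrix. A graph is $r$-partite if its vertex set can be partitioned into $r$ independent sets (equivalently, its chromatic number is at most $r$). $T_r(n)$ is the Turán graph: the complete $r$-partite graph on $n$ vertices with parts $T_1,\dots,T_r$ of sizes $t_1\le t_2\le\cdots\le t_r$, where $t_1=\lfloor n/r\rfloor$ and $t_r=\lceil n/r\rceil$ (all part sizes differ by at most one). The graph $Y_r(n)$ is obtained from $T_r(n)$ as follows: choose two vertices $u,w\in T_r$ and add the edge $uw$; delete all edges between $T_1$ and $\{u,w\}$; then join $u$ to one vertex $v\in T_1$ and join $w$ to all the remaining vertices of $T_1\setminus\{v\}$. (Equivalently, $Y_r(n)$ is obtained from $T_r(n-1)$, with parts $S_1,\dots,S_r$ of sizes $\lfloor (n-1)/r\rfloor=s_1\le\cdots\le s_r=\lceil (n-1)/r\rceil$, by adding a new vertex $u$, choosing $v\in S_1$ and $w\in S_2$, deleting the edge $vw$, and joining $u$ to $v$, to $w$, and to every vertex of $S_3\cup\cdots\cup S_r$.) *)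

theory Defs
  imports "Graph_Theory.Graph_Theory" "Jordan_Normal_Form.Spectral_Radius"
begin

text \<open>
  A simple graph is a \<open>pair_graph\<close> of \<open>Graph_Theory\<close>: a finite vertex set \<open>pverts G\<close>
  with a symmetric, irreflexive set \<open>parcs G\<close> of ordered pairs of vertices, so that an edge
  \<open>xy\<close> is represented by the two arcs \<open>(x, y)\<close> and \<open>(y, x)\<close>.
\<close>

definition adjacency_matrix_wrt :: "(nat \<Rightarrow> 'a) \<Rightarrow> 'a pair_pre_digraph \<Rightarrow> real mat" where
  "adjacency_matrix_wrt f G =
     mat (card (pverts G)) (card (pverts G)) (\<lambda>(i, j). if (f i, f j) \<in> parcs G then 1 else 0)"

text \<open>
  The vertices are numbered in an arbitrary fixed way; by \<open>spectrum_adjacency_matrix_wrt\<close> below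
  the spectrum does not depend on the numbering.
\<close>

definition vertex_numbering :: "'a pair_pre_digraph \<Rightarrow> nat \<Rightarrow> 'a" where
  "vertex_numbering G = (SOME f. bij_betw f {0..<card (pverts G)} (pverts G))"

definition adjacency_matrix :: "'a pair_pre_digraph \<Rightarrow> real mat" where
  "adjacency_matrix G = adjacency_matrix_wrt (vertex_numbering G) G"

text \<open>
  The largest eigenvalue of the adjacency matrix. Only meaningful for nonempty graphs; the
  matrix is real symmetric, so nothing is lost by considering its real eigenvalues only.
\<close>

definition graph_spectral_radius :: "'a pair_pre_digraph \<Rightarrow> real" where
  "graph_spectral_radius G = Max (spectrum (adjacency_matrix G))"

definition contains_complete :: "nat \<Rightarrow> 'a pair_pre_digraph \<Rightarrow> bool" where
  "contains_complete k G \<longleftrightarrow>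
     (\<exists>H :: ('a, 'a \<times> 'a) pre_digraph. subgraph H (with_proj G) \<and> complete_digraph k H)"

definition independent_set :: "'a pair_pre_digraph \<Rightarrow> 'a set \<Rightarrow> bool" where
  "independent_set G S \<longleftrightarrow> S \<subseteq> pverts G \<and> (\<forall>x\<in>S. \<forall>y\<in>S. (x, y) \<notin> parcs G)"

text \<open>Some of the \<open>r\<close> independent sets may be empty: \<open>r\<close>-partite means chromatic number at most \<open>r\<close>.\<close>

definition r_partite :: "nat \<Rightarrow> 'a pair_pre_digraph \<Rightarrow> bool" where
  "r_partite r G \<longleftrightarrow>
     (\<exists>P :: nat \<Rightarrow> 'a set. (\<Union>i<r. P i) = pverts G \<and> disjoint_family_on P {..<r} \<and>
        (\<forall>i<r. independent_set G (P i)))"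

text \<open>
  For \<open>1 \<le> i \<le> r\<close> the part \<open>T\<^sub>i\<close> has \<open>\<lfloor>(n + i - 1) / r\<rfloor>\<close> elements. These sizes increase from
  \<open>\<lfloor>n / r\<rfloor>\<close> for \<open>i = 1\<close> to \<open>\<lceil>n / r\<rceil>\<close> for \<open>i = r\<close>, and they add up to \<open>n\<close>.
\<close>

definition turan_part :: "nat \<Rightarrow> nat \<Rightarrow> nat \<Rightarrow> (nat \<times> nat) set" where
  "turan_part r n i = {i} \<times> {1..(n + i - 1) div r}"

definition turan_graph :: "nat \<Rightarrow> nat \<Rightarrow> (nat \<times> nat) pair_pre_digraph" where
  "turan_graph r n =
     \<lparr> pverts = (\<Union>i\<in>{1..r}. turan_part r n i),
       parcs = (\<Union>i\<in>{1..r}. \<Union>j\<in>{1..r} - {i}. turan_part r n i \<times> turan_part r n j) \<rparr>"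

text \<open>All arcs, in both directions, between two vertex sets.\<close>

definition edges_between :: "'a set \<Rightarrow> 'a set \<Rightarrow> 'a rel" where
  "edges_between A B = A \<times> B \<union> B \<times> A"

text \<open>
  The construction of \<open>Y\<^sub>r(n)\<close> with \<open>u, w \<in> T\<^sub>r\<close> and \<open>v \<in> T\<^sub>1\<close>; up to isomorphism it does not
  depend on the choice of \<open>u, w, v\<close>. These vertices exist iff \<open>r + 1 \<le> n\<close> (for \<open>2 \<le> r\<close>), which
  holds for every graph on \<open>n\<close> vertices without a complete subgraph on \<open>r + 1\<close> vertices that is not
  \<open>r\<close>-partite; for smaller \<open>n\<close> the value is irrelevant.
\<close>

definition Y_graph :: "nat \<Rightarrow> nat \<Rightarrow> (nat \<times> nat) pair_pre_digraph" where
  "Y_graph r n =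
     (let T1 = turan_part r n 1; u = (r, 1); w = (r, 2); v = (1, 1)
      in \<lparr> pverts = pverts (turan_graph r n),
           parcs = (parcs (turan_graph r n) - edges_between T1 {u, w})
             \<union> edges_between {u} {w} \<union> edges_between {u} {v} \<union> edges_between {w} (T1 - {v}) \<rparr>)"

lemma sum_turan_sizes:
  assumes "0 < r"
  shows "(\<Sum>i\<in>{1..r}. (n + i - 1) div r) = (n :: nat)"
proof -
  have "(\<Sum>i<r. (n + i) div r) = n"
  proof (induction n)
    case 0
    then show ?case by simp
  next
    case (Suc n)
    have "(\<Sum>i<r. (Suc n + i) div r) + n div r = (\<Sum>i<Suc r. (n + i) div r)"
      by (subst sum.lessThan_Suc_shift) simp
    also have "\<dots> = n + (n + r) div r"
      using Suc by simp
    also have "\<dots> = Suc n + n div r"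
      using assms by simp
    finally show ?case by simp
  qed
  moreover have "(\<Sum>i\<in>{1..r}. (n + i - 1) div r) = (\<Sum>i<r. (n + i) div r)"
    by (rule sum.reindex_bij_witness[of _ Suc "\<lambda>i. i - 1"]) auto
  ultimately show ?thesis by simp
qed

lemma card_turan_graph:
  assumes "0 < r"
  shows "card (pverts (turan_graph r n)) = n"
proof -
  have "card (\<Union>i\<in>{1..r}. turan_part r n i) = (\<Sum>i\<in>{1..r}. card (turan_part r n i))"
    by (rule card_UN_disjoint) (auto simp: turan_part_def)
  also have "\<dots> = (\<Sum>i\<in>{1..r}. (n + i - 1) div r)"
    by (simp add: turan_part_def)
  finally show ?thesis
    using sum_turan_sizes[OF assms] by (simp add: turan_graph_def)
qed

lemma pair_graphI:
  assumes "finite (pverts G)" "parcs G \<subseteq> pverts G \<times> pverts G" "sym (parcs G)" "irrefl (parcs G)"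
  shows "pair_graph G"
proof -
  have "finite (parcs G)"
    using assms(1,2) finite_subset by blast
  with assms show ?thesis
    by unfold_locales (auto simp: symmetric_def irrefl_def)
qed

lemma pair_graph_turan_graph: "pair_graph (turan_graph r n)"
  by (rule pair_graphI) (auto simp: turan_graph_def turan_part_def sym_def irrefl_def)

lemma Y_graph_vertices_exist:
  assumes "2 \<le> r" "r + 1 \<le> n"
  shows "(r, 1) \<in> turan_part r n r" "(r, 2) \<in> turan_part r n r" "(1, 1) \<in> turan_part r n 1"
proof -
  have "2 * r div r \<le> (n + r - 1) div r" "r div r \<le> n div r"
    using assms by (intro div_le_mono; simp)+
  then have "2 \<le> (n + r - 1) div r" "1 \<le> n div r"
    using assms by simp_all
  then show "(r, 1) \<in> turan_part r n r" "(r, 2) \<in> turan_part r n r" "(1, 1) \<in> turan_part r n 1"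
    by (auto simp: turan_part_def)
qed

lemma pair_graph_Y_graph:
  assumes "2 \<le> r" "r + 1 \<le> n"
  shows "pair_graph (Y_graph r n)" "card (pverts (Y_graph r n)) = n"
proof -
  interpret T: pair_graph "turan_graph r n" by (rule pair_graph_turan_graph)
  define V where "V = pverts (turan_graph r n)"
  define E where "E = parcs (turan_graph r n)"
  have T1: "turan_part r n 1 \<subseteq> V"
    using assms UN_upper[of 1 "{1..r}" "turan_part r n"] by (simp add: V_def turan_graph_def)
  have Tr: "turan_part r n r \<subseteq> V"
    using assms UN_upper[of r "{1..r}" "turan_part r n"] by (simp add: V_def turan_graph_def)
  have E: "E \<subseteq> V \<times> V" "sym E" "irrefl E"
    using T.arc_fst_in_verts T.arc_snd_in_verts T.arcs_symmetric T.no_loops'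
    by (fastforce simp: E_def V_def sym_def irrefl_def)+
  have fst1: "fst x = 1" if "x \<in> turan_part r n 1" for x
    using that by (auto simp: turan_part_def)
  show "pair_graph (Y_graph r n)"
  proof (rule pair_graphI)
    show "finite (pverts (Y_graph r n))"
      by (simp add: Y_graph_def Let_def T.pair_finite_verts)
    show "parcs (Y_graph r n) \<subseteq> pverts (Y_graph r n) \<times> pverts (Y_graph r n)"
    proof -
      have "(r, 1) \<in> V" "(r, 2) \<in> V" "(1, 1) \<in> V"
        using T1 Tr Y_graph_vertices_exist[OF assms] by blast+
      then show ?thesis
        using E(1) T1
        unfolding Y_graph_def Let_def edges_between_def
        by (simp add: E_def[symmetric] V_def[symmetric] del: One_nat_def) blast
    qed
    show "sym (parcs (Y_graph r n))"
      using E(2)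
      unfolding Y_graph_def Let_def edges_between_def E_def[symmetric] sym_def by auto
    show "irrefl (parcs (Y_graph r n))"
      using E(3) assms(1) fst1
      unfolding Y_graph_def Let_def edges_between_def E_def[symmetric] irrefl_def by fastforce
  qed
  show "card (pverts (Y_graph r n)) = n"
    using card_turan_graph[of r n] assms by (simp add: Y_graph_def Let_def)
qed

lemma bij_betw_vertex_numbering:
  assumes "finite (pverts G)"
  shows "bij_betw (vertex_numbering G) {0..<card (pverts G)} (pverts G)"
  unfolding vertex_numbering_def using ex_bij_betw_nat_finite[OF assms] by (rule someI_ex)

lemma eigenvalue_adjacency_matrix_wrt:
  assumes f: "bij_betw f {0..<card (pverts G)} (pverts G)"
  shows "eigenvalue (adjacency_matrix_wrt f G) k \<longleftrightarrow>
    (\<exists>x :: 'a \<Rightarrow> real. (\<exists>a\<in>pverts G. x a \<noteq> 0) \<and>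
       (\<forall>a\<in>pverts G. (\<Sum>b\<in>pverts G. (if (a, b) \<in> parcs G then 1 else 0) * x b) = k * x a))"
    (is "?L \<longleftrightarrow> ?R")
proof -
  define n where "n = card (pverts G)"
  define A where "A = adjacency_matrix_wrt f G"
  note f = f[folded n_def]
  have A: "A \<in> carrier_mat n n"
    by (simp add: A_def adjacency_matrix_wrt_def n_def)
  have fi: "f i \<in> pverts G" if "i < n" for i
    using f that by (auto simp: bij_betw_def)
  have row: "(A *\<^sub>v vec n (\<lambda>i. x (f i))) $ i =
      (\<Sum>b\<in>pverts G. (if (f i, b) \<in> parcs G then 1 else 0) * x b)" if "i < n" for i and x :: "'a \<Rightarrow> real"
  proof -
    have "(A *\<^sub>v vec n (\<lambda>i. x (f i))) $ i =
        (\<Sum>j\<in>{0..<n}. (if (f i, f j) \<in> parcs G then 1 else 0) * x (f j))"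
      using that A by (simp add: A_def adjacency_matrix_wrt_def n_def scalar_prod_def)
    also have "\<dots> = (\<Sum>b\<in>pverts G. (if (f i, b) \<in> parcs G then 1 else 0) * x b)"
      by (rule sum.reindex_bij_betw[OF f])
    finally show ?thesis .
  qed
  show ?thesis
  proof
    assume ?L
    then obtain y where y: "y \<in> carrier_vec n" "y \<noteq> 0\<^sub>v n" "A *\<^sub>v y = k \<cdot>\<^sub>v y"
      using A by (auto simp: eigenvalue_def eigenvector_def A_def[symmetric])
    define x where "x a = y $ (the_inv_into {0..<n} f a)" for a
    have xf: "x (f i) = y $ i" if "i < n" for i
      using f that by (simp add: x_def bij_betw_def the_inv_into_f_f)
    have yx: "y = vec n (\<lambda>i. x (f i))"
      using y(1) xf by auto
    obtain i where i: "i < n" "y $ i \<noteq> 0"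
      using y(1,2) eq_vecI[of y "0\<^sub>v n"] by auto
    have nz: "\<exists>a\<in>pverts G. x a \<noteq> 0"
      using xf[OF i(1)] i(2) by (intro bexI[OF _ fi[OF i(1)]]) simp
    have "(\<Sum>b\<in>pverts G. (if (a, b) \<in> parcs G then 1 else 0) * x b) = k * x a"
      if a: "a \<in> pverts G" for a
    proof -
      obtain i where i: "i < n" "a = f i"
        using bij_betw_imp_surj_on[OF f] a by fastforce
      show ?thesis
        using row[OF i(1), of x] y(1,3) i xf by (simp flip: yx)
    qed
    with nz show ?R by blast
  next
    assume ?R
    then obtain x :: "'a \<Rightarrow> real" and a where a: "a \<in> pverts G" "x a \<noteq> 0"
      and x: "\<And>a. a \<in> pverts G \<Longrightarrow>
        (\<Sum>b\<in>pverts G. (if (a, b) \<in> parcs G then 1 else 0) * x b) = k * x a"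
      by blast
    define y where "y = vec n (\<lambda>i. x (f i))"
    obtain i where i: "i < n" "a = f i"
      using bij_betw_imp_surj_on[OF f] a(1) by fastforce
    have "y \<noteq> 0\<^sub>v n"
    proof
      assume "y = 0\<^sub>v n"
      then have "y $ i = 0" using i by simp
      then show False using i a by (simp add: y_def)
    qed
    moreover have "A *\<^sub>v y = k \<cdot>\<^sub>v y"
    proof (rule eq_vecI)
      fix j assume "j < dim_vec (k \<cdot>\<^sub>v y)"
      then have j: "j < n" by (simp add: y_def)
      show "(A *\<^sub>v y) $ j = (k \<cdot>\<^sub>v y) $ j"
        using row[OF j, of x] x[OF fi[OF j]] j by (simp add: y_def)
    qed (use A in \<open>simp add: y_def\<close>)
    moreover have "y \<in> carrier_vec n"
      by (simp add: y_def)
    ultimately have "eigenvector A y k"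
      using A by (simp add: eigenvector_def)
    then show ?L
      unfolding eigenvalue_def A_def[symmetric] by blast
  qed
qed

lemma spectrum_adjacency_matrix_wrt:
  assumes "bij_betw f {0..<card (pverts G)} (pverts G)"
    and "bij_betw g {0..<card (pverts G)} (pverts G)"
  shows "spectrum (adjacency_matrix_wrt f G) = spectrum (adjacency_matrix_wrt g G)"
proof -
  have "eigenvalue (adjacency_matrix_wrt f G) k = eigenvalue (adjacency_matrix_wrt g G) k" for k
    unfolding eigenvalue_adjacency_matrix_wrt[OF assms(1)] eigenvalue_adjacency_matrix_wrt[OF assms(2)] ..
  then show ?thesis
    unfolding spectrum_def by presburger
qed

end

theory Submission
  imports Defs "HOL-Analysis.Analysis"
begin

text \<open>
  Among the \<open>K\<^sub>r\<^sub>+\<^sub>1\<close>-free graphs on \<open>V\<close> that are not \<open>r\<close>-partite, let \<open>E\<close> have maximal spectral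
  radius. Its Perron vector \<open>x\<close> is positive, and a change of \<open>E\<close> within the class that does not decrease
  the quadratic form at \<open>x\<close> leaves \<open>x\<close> an eigenvector. Hence nonadjacent vertices are twins unless
  deleting one of them makes the graph \<open>r\<close>-partite, and \<open>E\<close> is the join of a complete
  \<open>(r - 2)\<close>-partite graph with a blow-up of the pentagon having two adjacent classes of size one. Moving
  single vertices between classes shows that the class sizes are those of \<open>Y\<^sub>r(n)\<close>; where the form at
  \<open>x\<close> does not separate the two graphs, a strict supersolution of the eigenvalue equations for the new
  graph does. For \<open>n \<le> 2 * r\<close> the optimal sizes are not attained, because \<open>Y\<^sub>r(n)\<close> is then itself
  \<open>r\<close>-partite; there moving one vertex turns \<open>E\<close> into a subgraph of \<open>Y\<^sub>r(n)\<close> with a larger form at \<open>x\<close>.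
\<close>

subsection \<open>Quadratic forms and spectral radius\<close>

text \<open>Symmetrization alone would end in a complete multipartite graph. What blocks it is the
  demand that the graph stay non-\<open>r\<close>-partite, and it is blocked only at vertices whose
  deletion leaves an \<open>r\<close>-colourable graph. Edge maximality makes these critical
  vertices rigid: a vertex not adjacent to one of them is adjacent to everything outside its own
  colour class. At a heaviest vertex v among those having a nonadjacent non-twin, this leaves, apart
  from twins of v, just two adjacent nonneighbours y and z. Nonadjacent p and q in N(v), with p
  missing y and q missing z, then close the five-cycle v p z y q, the source of the pentagon. Many
  exchanges gain only weakly. A tie is still informative: x is then an eigenvector of the changed
  graph too, and one row of the eigenvalue equations refutes this. The classes of the pentagon fit
  the construction of \<open>Y_graph\<close> as follows: labels 3 and 4 are u and w, label 2 is v,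
  labels 1 and 2 form the smallest part, labels 0, 3 and 4 the largest.\<close>

definition quad :: "('a \<times> 'a) set \<Rightarrow> ('a \<Rightarrow> real) \<Rightarrow> real" where
  "quad E x = (\<Sum>(u, v)\<in>E. x u * x v)"

definition simple_graph :: "'a set \<Rightarrow> ('a \<times> 'a) set \<Rightarrow> bool" where
  "simple_graph V E \<longleftrightarrow> finite V \<and> E \<subseteq> V \<times> V \<and> sym E \<and> irrefl E"

definition clique :: "('a \<times> 'a) set \<Rightarrow> 'a set \<Rightarrow> bool" where
  "clique E C \<longleftrightarrow> (\<forall>u\<in>C. \<forall>v\<in>C. u \<noteq> v \<longrightarrow> (u, v) \<in> E)"

definition clique_free :: "nat \<Rightarrow> 'a set \<Rightarrow> ('a \<times> 'a) set \<Rightarrow> bool" where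
  "clique_free k V E \<longleftrightarrow> \<not> (\<exists>C\<subseteq>V. card C = k \<and> clique E C)"

definition colorable :: "nat \<Rightarrow> 'a set \<Rightarrow> ('a \<times> 'a) set \<Rightarrow> bool" where
  "colorable r V E \<longleftrightarrow>
     (\<exists>f :: 'a \<Rightarrow> nat. (\<forall>v\<in>V. f v < r) \<and> (\<forall>u\<in>V. \<forall>v\<in>V. (u, v) \<in> E \<longrightarrow> f u \<noteq> f v))"

definition nonpartite_class :: "nat \<Rightarrow> 'a set \<Rightarrow> ('a \<times> 'a) set \<Rightarrow> bool" where
  "nonpartite_class r V E \<longleftrightarrow> simple_graph V E \<and> clique_free (r + 1) V E \<and> \<not> colorable r V E"

lemma simple_graphD:
  assumes "simple_graph V E"
  shows "finite V" "E \<subseteq> V \<times> V" "sym E" "irrefl E" "finite E"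
  using assms finite_subset[of E "V \<times> V"] unfolding simple_graph_def by simp_all

lemma simple_graph_edgeD:
  assumes "simple_graph V E" "(u, v) \<in> E"
  shows "u \<in> V" "v \<in> V" "(v, u) \<in> E" "u \<noteq> v"
proof -
  show "u \<in> V" "v \<in> V"
    using assms unfolding simple_graph_def by blast+
  show "(v, u) \<in> E"
    using assms unfolding simple_graph_def sym_def by blast
  show "u \<noteq> v"
    using assms unfolding simple_graph_def irrefl_def by blast
qed

lemma colorable_mono: "colorable r V E \<Longrightarrow> W \<subseteq> V \<Longrightarrow> F \<subseteq> E \<Longrightarrow> colorable r W F"
  unfolding colorable_def by (meson subsetD)

lemma colorable_cong:
  assumes "\<And>u v. u \<in> V \<Longrightarrow> v \<in> V \<Longrightarrow> (u, v) \<in> E \<longleftrightarrow> (u, v) \<in> F"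
  shows "colorable r V E \<longleftrightarrow> colorable r V F"
  using assms unfolding colorable_def by blast

lemma clique_card_le_colors:
  fixes f :: "'a \<Rightarrow> nat"
  assumes "clique E C" "\<forall>v\<in>C. f v < r" "\<forall>u\<in>C. \<forall>v\<in>C. (u, v) \<in> E \<longrightarrow> f u \<noteq> f v"
  shows "card C \<le> r"
proof -
  have "inj_on f C"
    using assms unfolding inj_on_def clique_def by blast
  moreover have "f ` C \<subseteq> {..<r}"
    using assms by auto
  ultimately show ?thesis
    using card_inj_on_le[of f C "{..<r}"] by simp
qed

lemma quad_conv_sum:
  assumes "finite V" "E \<subseteq> V \<times> V"
  shows "quad E x = (\<Sum>u\<in>V. x u * (\<Sum>v\<in>E `` {u}. x v))"
proof -
  have "E = (SIGMA u:V. E `` {u})"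
    using assms by auto
  then have "quad E x = (\<Sum>(u, v)\<in>(SIGMA u:V. E `` {u}). x u * x v)"
    by (simp add: quad_def)
  also have "\<dots> = (\<Sum>u\<in>V. \<Sum>v\<in>E `` {u}. x u * x v)"
    using assms by (subst sum.Sigma) (auto intro: finite_subset[of _ V])
  finally show ?thesis
    by (simp add: sum_distrib_left)
qed

lemma quad_Times:
  assumes "finite A" "finite B"
  shows "quad (A \<times> B) x = sum x A * sum x B"
  by (simp add: quad_def sum.cartesian_product[symmetric] sum_product)

lemma quad_Un: "finite E \<Longrightarrow> finite F \<Longrightarrow> E \<inter> F = {} \<Longrightarrow> quad (E \<union> F) x = quad E x + quad F x"
  unfolding quad_def by (rule sum.union_disjoint)

lemma quad_mono:
  assumes "finite F" "E \<subseteq> F" "\<And>u v. (u, v) \<in> F \<Longrightarrow> 0 \<le> x u \<and> 0 \<le> x v"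
  shows "quad E x \<le> quad F x"
  unfolding quad_def using assms by (intro sum_mono2) auto

lemma quad_strict_mono:
  assumes "finite F" "E \<subset> F" "\<And>u v. (u, v) \<in> F \<Longrightarrow> 0 < x u \<and> 0 < x v"
  shows "quad E x < quad F x"
proof -
  obtain u v where uv: "(u, v) \<in> F" "(u, v) \<notin> E"
    using assms(2) by auto
  show ?thesis
    unfolding quad_def using assms uv
    by (intro sum_strict_mono2[of F E "(u, v)"]) (auto intro: less_imp_le)
qed

lemma quad_bij:
  assumes "inj_on g V" "E \<subseteq> V \<times> V"
  shows "quad (map_prod g g ` E) x = quad E (x \<circ> g)"
proof -
  have "inj_on (map_prod g g) E"
    using assms by (intro inj_on_subset[OF map_prod_inj_on]) auto
  then show ?thesis
    unfolding quad_def by (subst sum.reindex) (auto intro!: sum.cong)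
qed

text \<open>First-order condition at a maximum of the Rayleigh quotient: along
  \<open>x + t * e\<close>, with \<open>e\<close> the indicator of \<open>w\<close>, the bound reads
  \<open>2 * t * c + t^2 * d \<le> 0\<close> for every real \<open>t\<close>, which forces the
  residual \<open>c\<close> of row \<open>w\<close> to vanish.\<close>

lemma quad_max_imp_eigenvector:
  assumes V: "finite V" "E \<subseteq> V \<times> V" "sym E"
    and le: "\<And>y. quad E y \<le> m * (\<Sum>u\<in>V. (y u)\<^sup>2)"
    and eq: "quad E x = m * (\<Sum>u\<in>V. (x u)\<^sup>2)"
    and w: "w \<in> V"
  shows "(\<Sum>v\<in>E `` {w}. x v) = m * x w"
proof -
  have finE: "finite E" and fin: "finite (E `` {u})" for u
    using V finite_subset[of E "V \<times> V"] by (auto intro: finite_subset[of _ V])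
  define c where "c = (\<Sum>v\<in>E `` {w}. x v) - m * x w"
  define d where "d = quad E (\<lambda>u. if u = w then 1 else 0) - m"
  have "2 * t * c + t\<^sup>2 * d \<le> 0" for t
  proof -
    define e where "e = (\<lambda>u. if u = w then 1 else (0::real))"
    define y where "y = (\<lambda>u. x u + t * e u)"
    have sq: "(\<Sum>u\<in>V. (y u)\<^sup>2) = (\<Sum>u\<in>V. (x u)\<^sup>2) + 2 * t * x w + t\<^sup>2"
    proof -
      have "(\<Sum>u\<in>V. (y u)\<^sup>2) = (\<Sum>u\<in>V. (x u)\<^sup>2 + (if u = w then 2 * t * x w + t\<^sup>2 else 0))"
        by (intro sum.cong) (auto simp: y_def e_def power2_eq_square algebra_simps)
      then show ?thesis
        using V(1) w by (simp add: sum.distrib)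
    qed
    have E1: "(\<Sum>(u, v)\<in>E. e u * x v) = (\<Sum>v\<in>E `` {w}. x v)"
    proof -
      have "(\<Sum>(u, v)\<in>E. e u * x v) = (\<Sum>(u, v)\<in>Pair w ` (E `` {w}). e u * x v)"
        using finE by (intro sum.mono_neutral_right) (auto simp: e_def)
      also have "\<dots> = (\<Sum>v\<in>E `` {w}. x v)"
        by (subst sum.reindex) (auto simp: inj_on_def e_def)
      finally show ?thesis .
    qed
    have E2: "(\<Sum>(u, v)\<in>E. x u * e v) = (\<Sum>v\<in>E `` {w}. x v)"
    proof -
      have "(\<Sum>(u, v)\<in>E. x u * e v) = (\<Sum>(u, v)\<in>E. e u * x v)"
        using V(3) by (intro sum.reindex_bij_witness[of _ prod.swap prod.swap]) (auto simp: sym_def)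
      then show ?thesis using E1 by simp
    qed
    have "quad E y = (\<Sum>(u, v)\<in>E. x u * x v + t * (e u * x v) + t * (x u * e v) + t\<^sup>2 * (e u * e v))"
      unfolding quad_def by (intro sum.cong) (auto simp: y_def power2_eq_square algebra_simps)
    also have "\<dots> = quad E x + 2 * t * (\<Sum>v\<in>E `` {w}. x v) + t\<^sup>2 * quad E e"
      unfolding quad_def E1[symmetric]
      using E1 E2 by (simp add: sum.distrib case_prod_unfold sum_distrib_left[symmetric])
    finally show ?thesis
      using le[of y] unfolding eq sq c_def d_def e_def by (simp add: algebra_simps)
  qed
  note * = this
  have "c = 0"
  proof (rule ccontr)
    assume c: "c \<noteq> 0"
    \<comment> \<open>At \<open>t = c / s\<close> the inequality becomes
      \<open>(c / s)^2 * (2 * s + d) \<le> 0\<close>; this \<open>s\<close> makes the second factor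
      positive.\<close>
    define s where "s = 1 + \<bar>d\<bar>"
    have s: "s > 0" "d \<ge> - s"
      by (auto simp: s_def)
    have "(c / s)\<^sup>2 * (2 * s + d) = 2 * (c / s) * c + (c / s)\<^sup>2 * d"
      using s(1) by (simp add: field_simps power2_eq_square)
    also have "\<dots> \<le> 0"
      by (rule *)
    finally have "(c / s)\<^sup>2 * (2 * s + d) \<le> 0" .
    moreover have "(c / s)\<^sup>2 * (2 * s + d) > 0"
      using s c by (intro mult_pos_pos) auto
    ultimately show False by simp
  qed
  then show ?thesis
    by (simp add: c_def)
qed

text \<open>Vectors are functions on the whole type, so the unit sphere is cut down to functions
  vanishing off \<open>V\<close>; it is then a closed subset of a cube that is compact in the
  product topology. Replacing a maximizer by its absolute values cannot lower the form, which gives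
  a nonnegative one.\<close>

lemma quad_max_exists:
  fixes E :: "('a \<times> 'a) set"
  assumes V: "finite V" "V \<noteq> {}" "E \<subseteq> V \<times> V"
  obtains x m where "\<And>u. 0 \<le> x u" "(\<Sum>u\<in>V. (x u)\<^sup>2) = 1" "quad E x = m"
    "\<And>y. quad E y \<le> m * (\<Sum>u\<in>V. (y u)\<^sup>2)"
proof -
  define K where "K = {x :: 'a \<Rightarrow> real. (\<forall>u. u \<notin> V \<longrightarrow> x u = 0) \<and> (\<Sum>u\<in>V. (x u)\<^sup>2) = 1}"
  define B where "B = PiE UNIV (\<lambda>u :: 'a. {-1..1 :: real})"
  have "compact B"
  proof -
    have "compactin (product_topology (\<lambda>u :: 'a. euclidean :: real topology) UNIV) B"
      unfolding B_def by (subst compactin_PiE) auto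
    then show ?thesis
      by (simp add: euclidean_product_topology)
  qed
  have cont: "continuous_on UNIV (\<lambda>x :: 'a \<Rightarrow> real. x u)" for u
    by (rule continuous_on_product_coordinates)
  have "K \<subseteq> B"
  proof
    fix x assume x: "x \<in> K"
    have "\<bar>x u\<bar> \<le> 1" for u
    proof (cases "u \<in> V")
      case True
      then have "(x u)\<^sup>2 \<le> (\<Sum>u\<in>V. (x u)\<^sup>2)"
        using V by (intro member_le_sum) auto
      then show ?thesis
        using x by (simp add: K_def abs_square_le_1)
    qed (use x in \<open>auto simp: K_def\<close>)
    then have "- 1 \<le> x u \<and> x u \<le> 1" for u
      by (smt (verit))
    then show "x \<in> B"
      by (simp add: B_def PiE_iff)
  qed
  moreover have "closed K"
  proof -
    have "K = (\<Inter>u\<in>-V. {x. x u = 0}) \<inter> {x. (\<Sum>u\<in>V. (x u)\<^sup>2) = 1}"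
      by (auto simp: K_def)
    also have "closed \<dots>"
      by (intro closed_Int closed_INT ballI closed_Collect_eq continuous_intros cont)
    finally show ?thesis .
  qed
  ultimately have "compact K"
    using \<open>compact B\<close> compact_Int_closed[of B K] by (simp add: inf.absorb2)
  moreover obtain v where "v \<in> V"
    using V by auto
  then have "(\<lambda>u. if u = v then 1 else 0) \<in> K"
    using V(1) by (auto simp: K_def if_distrib[of "\<lambda>x. x\<^sup>2"] cong: if_cong)
  then have "K \<noteq> {}"
    by auto
  moreover have "continuous_on K (quad E)"
  proof -
    have "continuous_on UNIV (\<lambda>x. \<Sum>p\<in>E. x (fst p) * x (snd p) :: real)"
      by (intro continuous_intros cont)
    then show ?thesis
      unfolding quad_def case_prod_unfold using continuous_on_subset by blast
  qed
  ultimately obtain x where x: "x \<in> K" "\<And>y. y \<in> K \<Longrightarrow> quad E y \<le> quad E x"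
    using continuous_attains_sup[of K "quad E"] by auto
  have le: "quad E y \<le> quad E x * (\<Sum>u\<in>V. (y u)\<^sup>2)" for y
  proof (cases "(\<Sum>u\<in>V. (y u)\<^sup>2) = 0")
    case True
    then have "y u = 0" if "u \<in> V" for u
      using V(1) that by (simp add: sum_nonneg_eq_0_iff)
    then have "quad E y = 0"
      unfolding quad_def using V by (intro sum.neutral) auto
    then show ?thesis using True by simp
  next
    case False
    define s where "s = (\<Sum>u\<in>V. (y u)\<^sup>2)"
    have s: "s > 0"
      using False sum_nonneg[of V "\<lambda>u. (y u)\<^sup>2"] by (simp add: s_def order.strict_iff_order)
    define z where "z = (\<lambda>u. if u \<in> V then y u / sqrt s else 0)"
    have "(\<Sum>u\<in>V. (z u)\<^sup>2) = (\<Sum>u\<in>V. (y u)\<^sup>2) / s"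
      using s by (simp add: z_def power_divide sum_divide_distrib)
    then have "z \<in> K"
      using s by (auto simp: K_def z_def s_def)
    moreover have "quad E z = quad E y / s"
    proof -
      have "quad E z = (\<Sum>(u, v)\<in>E. (y u * y v) / s)"
        unfolding quad_def using V(3) s by (intro sum.cong) (auto simp: z_def)
      then show ?thesis
        by (simp add: quad_def sum_divide_distrib case_prod_unfold)
    qed
    ultimately show ?thesis
      using x(2)[of z] s by (simp add: s_def[symmetric] divide_le_eq)
  qed
  define w where "w = (\<lambda>u. \<bar>x u\<bar>)"
  have w1: "(\<Sum>u\<in>V. (w u)\<^sup>2) = 1"
    using x(1) by (simp add: w_def K_def)
  have "quad E x \<le> quad E w"
    unfolding quad_def w_def by (intro sum_mono) (auto simp: abs_mult[symmetric])
  then have "quad E w = quad E x"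
    using le[of w] w1 by simp
  then show ?thesis
    using that[of w "quad E x"] w1 le by (auto simp: w_def)
qed

lemma graph_spectral_radius_eqI:
  assumes G: "pair_graph G" and x: "\<exists>u\<in>pverts G. x u \<noteq> 0"
    and eq: "quad (parcs G) x = m * (\<Sum>u\<in>pverts G. (x u)\<^sup>2)"
    and le: "\<And>y. quad (parcs G) y \<le> m * (\<Sum>u\<in>pverts G. (y u)\<^sup>2)"
  shows "graph_spectral_radius G = m"
proof -
  interpret pair_graph G by fact
  define V where "V = pverts G"
  define E where "E = parcs G"
  have V: "finite V" "E \<subseteq> V \<times> V" "sym E"
    using pair_finite_verts arc_fst_in_verts arc_snd_in_verts arcs_symmetric
    by (fastforce simp: V_def E_def sym_def)+
  define f where "f = vertex_numbering G"
  have f: "bij_betw f {0..<card (pverts G)} (pverts G)"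
    unfolding f_def using bij_betw_vertex_numbering pair_finite_verts by blast
  have row: "(\<Sum>b\<in>V. (if (a, b) \<in> E then 1 else 0) * y b) = (\<Sum>b\<in>E `` {a}. y b)" for a and y :: "'a \<Rightarrow> real"
  proof -
    have "E `` {a} \<subseteq> V" using V by auto
    then have "(\<Sum>b\<in>E `` {a}. y b) = (\<Sum>b\<in>V. if b \<in> E `` {a} then y b else 0)"
      using sum.inter_restrict[OF V(1), of y "E `` {a}"] by (simp add: Int_absorb1)
    also have "\<dots> = (\<Sum>b\<in>V. (if (a, b) \<in> E then 1 else 0) * y b)"
      by (intro sum.cong) auto
    finally show ?thesis by simp
  qed
  have ev: "eigenvalue (adjacency_matrix G) k \<longleftrightarrow>
      (\<exists>y. (\<exists>a\<in>V. y a \<noteq> 0) \<and> (\<forall>a\<in>V. (\<Sum>b\<in>E `` {a}. y b) = k * y a))" for k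
    unfolding adjacency_matrix_def f_def[symmetric] eigenvalue_adjacency_matrix_wrt[OF f]
    unfolding V_def[symmetric] E_def[symmetric] row ..
  have "eigenvalue (adjacency_matrix G) m"
    unfolding ev
  proof (intro exI[of _ x] conjI ballI)
    show "\<exists>a\<in>V. x a \<noteq> 0"
      using x by (simp add: V_def)
    fix a assume "a \<in> V"
    then show "(\<Sum>b\<in>E `` {a}. x b) = m * x a"
      using quad_max_imp_eigenvector[OF V le[folded E_def V_def] eq[folded E_def V_def]] by blast
  qed
  moreover have "k \<le> m" if k: "eigenvalue (adjacency_matrix G) k" for k
  proof -
    obtain y where y: "\<exists>a\<in>V. y a \<noteq> 0" "\<And>a. a \<in> V \<Longrightarrow> (\<Sum>b\<in>E `` {a}. y b) = k * y a"
      using k unfolding ev by auto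
    have "quad E y = (\<Sum>u\<in>V. y u * (k * y u))"
      unfolding quad_conv_sum[OF V(1,2)] using y by (intro sum.cong) auto
    also have "\<dots> = k * (\<Sum>u\<in>V. (y u)\<^sup>2)"
      by (simp add: sum_distrib_left power2_eq_square algebra_simps)
    finally have "k * (\<Sum>u\<in>V. (y u)\<^sup>2) \<le> m * (\<Sum>u\<in>V. (y u)\<^sup>2)"
      using le[of y] by (simp add: V_def E_def)
    moreover have "(\<Sum>u\<in>V. (y u)\<^sup>2) > 0"
      using y(1) V(1) by (auto intro: sum_pos2)
    ultimately show ?thesis by simp
  qed
  moreover have "finite (spectrum (adjacency_matrix G))"
    by (rule card_finite_spectrum(1)[of _ "card (pverts G)"])
      (simp add: adjacency_matrix_def adjacency_matrix_wrt_def)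
  ultimately show ?thesis
    unfolding graph_spectral_radius_def by (intro Max_eqI) (auto simp: spectrum_def)
qed

text \<open>The bridge from the matrix to the form: all later arguments use only the Rayleigh bound
  and a nonnegative vector attaining it.\<close>

lemma graph_spectral_radius_rayleigh:
  assumes G: "pair_graph G" "pverts G \<noteq> {}"
  obtains x where "\<And>u. 0 \<le> x u" "(\<Sum>u\<in>pverts G. (x u)\<^sup>2) = 1"
    "quad (parcs G) x = graph_spectral_radius G"
    "\<And>y. quad (parcs G) y \<le> graph_spectral_radius G * (\<Sum>u\<in>pverts G. (y u)\<^sup>2)"
proof -
  interpret pair_graph G by fact
  have "parcs G \<subseteq> pverts G \<times> pverts G"
    using arc_fst_in_verts arc_snd_in_verts by fastforce
  then obtain x m where x: "\<And>u. 0 \<le> x u" "(\<Sum>u\<in>pverts G. (x u)\<^sup>2) = 1" "quad (parcs G) x = m"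
    "\<And>y. quad (parcs G) y \<le> m * (\<Sum>u\<in>pverts G. (y u)\<^sup>2)"
    using quad_max_exists[OF pair_finite_verts assms(2)] by blast
  have "\<exists>u\<in>pverts G. x u \<noteq> 0"
    using x(2) by (metis sum.neutral zero_eq_power2 zero_neq_one)
  then have "graph_spectral_radius G = m"
    using graph_spectral_radius_eqI[OF G(1), of x m] x by auto
  then show ?thesis
    using that[of x] x by auto
qed

subsection \<open>Labelled graphs\<close>

text \<open>
  The labels \<open>0, 1, 4, 3, 2\<close> are the classes of a blown-up pentagon, in this cyclic order; every label
  from \<open>5\<close> on is an independent set joined to everything else. With the labels below \<open>r + 3\<close> the
  clique number is \<open>r\<close>.
\<close>

definition lab_adj :: "nat \<Rightarrow> nat \<Rightarrow> bool" where
  "lab_adj i j \<longleftrightarrow> i \<noteq> j \<and>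
     (i, j) \<notin> {(0, 3), (3, 0), (0, 4), (4, 0), (1, 2), (2, 1), (1, 3), (3, 1), (2, 4), (4, 2)}"

definition lab_graph :: "'a set \<Rightarrow> ('a \<Rightarrow> nat) \<Rightarrow> ('a \<times> 'a) set" where
  "lab_graph V \<kappa> = {(u, v). u \<in> V \<and> v \<in> V \<and> lab_adj (\<kappa> u) (\<kappa> v)}"

lemma lab_adj_sym: "lab_adj i j \<longleftrightarrow> lab_adj j i"
  by (auto simp: lab_adj_def)

lemma lab_adj_irrefl [simp]: "\<not> lab_adj i i"
  by (simp add: lab_adj_def)

lemma simple_graph_lab_graph: "finite V \<Longrightarrow> simple_graph V (lab_graph V \<kappa>)"
  unfolding simple_graph_def lab_graph_def sym_def irrefl_def using lab_adj_sym by auto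

lemma lab_adj_no_triangle:
  assumes "a < 5" "b < 5" "c < 5" "lab_adj a b" "lab_adj b c"
  shows "\<not> lab_adj a c"
proof -
  have "a \<in> {0, 1, 2, 3, 4}" "b \<in> {0, 1, 2, 3, 4}" "c \<in> {0, 1, 2, 3, 4}"
    using assms by auto
  moreover have "\<forall>a\<in>{0, 1, 2, 3, 4}. \<forall>b\<in>{0, 1, 2, 3, 4}. \<forall>c\<in>{0, 1, 2, 3, 4}.
      lab_adj a b \<longrightarrow> lab_adj b c \<longrightarrow> \<not> lab_adj a c"
    by (simp add: lab_adj_def)
  ultimately show ?thesis
    using assms(4,5) by blast
qed

text \<open>A clique has at most one vertex per label, at most two labels from the triangle-free
  pentagon, and \<open>r - 2\<close> others. Conversely, in an \<open>r\<close>-colouring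
  representatives of the labels from 5 on use up \<open>r - 2\<close> colours, and the two left in
  \<open>D\<close> cannot colour a five-cycle. Hence vertices may be relabelled freely within the
  class as long as no label becomes empty.\<close>

lemma nonpartite_class_lab_graph:
  fixes \<kappa> :: "'a \<Rightarrow> nat"
  assumes r: "2 \<le> r" and V: "finite V" and \<kappa>: "\<kappa> ` V = {..<r + 3}"
  shows "nonpartite_class r V (lab_graph V \<kappa>)"
  unfolding nonpartite_class_def
proof (intro conjI)
  show "simple_graph V (lab_graph V \<kappa>)"
    using V by (rule simple_graph_lab_graph)
  show "clique_free (r + 1) V (lab_graph V \<kappa>)"
    unfolding clique_free_def
  proof
    assume "\<exists>C\<subseteq>V. card C = r + 1 \<and> clique (lab_graph V \<kappa>) C"
    then obtain C where C: "C \<subseteq> V" "card C = r + 1" "clique (lab_graph V \<kappa>) C" by blast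
    have adj: "lab_adj (\<kappa> u) (\<kappa> v)" if "u \<in> C" "v \<in> C" "u \<noteq> v" for u v
      using C(3) that by (auto simp: clique_def lab_graph_def)
    define L where "L = \<kappa> ` C"
    have inj: "inj_on \<kappa> C"
      unfolding inj_on_def using adj lab_adj_irrefl by metis
    have L: "L \<subseteq> {..<r + 3}" "finite L"
      using C(1) \<kappa> finite_subset[OF _ finite_lessThan[of "r + 3"], of L] by (auto simp: L_def)
    have adjL: "lab_adj i j" if "i \<in> L" "j \<in> L" "i \<noteq> j" for i j
      using that adj by (auto simp: L_def)
    have "card (L \<inter> {..<5}) \<le> 2"
    proof (rule ccontr)
      assume "\<not> card (L \<inter> {..<5}) \<le> 2"
      then have "3 \<le> card (L \<inter> {..<5})"
        by simp
      then obtain T where T: "T \<subseteq> L \<inter> {..<5}" "card T = 3"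
        by (meson obtain_subset_with_card_n)
      then obtain a b c where abc: "T = {a, b, c}" "a \<noteq> b" "b \<noteq> c" "a \<noteq> c"
        by (auto simp: card_3_iff)
      show False
        using lab_adj_no_triangle[of a b c] adjL T(1) abc by auto
    qed
    moreover have "card (L - {..<5}) \<le> card {5..<r + 3}"
      using L by (intro card_mono) auto
    moreover have "card L = card (L \<inter> {..<5}) + card (L - {..<5})"
      using L(2) by (metis card_Int_Diff)
    moreover have "card L = r + 1"
      using inj C(2) by (simp add: L_def card_image)
    ultimately show False
      using r by simp
  qed
  show "\<not> colorable r V (lab_graph V \<kappa>)"
  proof
    assume "colorable r V (lab_graph V \<kappa>)"
    then obtain f :: "'a \<Rightarrow> nat" where f: "\<forall>v\<in>V. f v < r"
      "\<forall>u\<in>V. \<forall>v\<in>V. (u, v) \<in> lab_graph V \<kappa> \<longrightarrow> f u \<noteq> f v"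
      unfolding colorable_def by blast
    have "\<forall>i<r + 3. \<exists>v\<in>V. \<kappa> v = i"
      using \<kappa> by (metis imageE lessThan_iff)
    then obtain h where h: "\<And>i. i < r + 3 \<Longrightarrow> h i \<in> V \<and> \<kappa> (h i) = i"
      by metis
    define g where "g i = f (h i)" for i
    have gr: "g i < r" if "i < r + 3" for i
      using h[OF that] f(1) by (simp add: g_def)
    have g: "g i \<noteq> g j" if "i < r + 3" "j < r + 3" "lab_adj i j" for i j
      using f(2) h[OF that(1)] h[OF that(2)] that(3) by (auto simp: g_def lab_graph_def)
    define D where "D = {..<r} - g ` {5..<r + 3}"
    have "inj_on g {5..<r + 3}"
    proof (rule inj_onI, rule ccontr)
      fix i j assume "i \<in> {5..<r + 3}" "j \<in> {5..<r + 3}" "g i = g j" "i \<noteq> j"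
      then show False
        using g[of i j] by (auto simp: lab_adj_def)
    qed
    moreover have "g ` {5..<r + 3} \<subseteq> {..<r}"
      using gr by auto
    ultimately have "card D = 2"
      using r unfolding D_def by (subst card_Diff_subset) (auto simp: card_image)
    then obtain s t where st: "D = {s, t}"
      by (auto simp: card_2_iff)
    have D: "g i \<in> {s, t}" if "i < 5" for i
    proof -
      have "g i \<noteq> g j" if "j \<in> {5..<r + 3}" for j
        using that \<open>i < 5\<close> r by (intro g) (auto simp: lab_adj_def)
      then have "g i \<notin> g ` {5..<r + 3}"
        by blast
      then show ?thesis
        using gr[of i] r that unfolding st[symmetric] D_def by simp
    qed
    have "g 0 \<noteq> g 2" "g 2 \<noteq> g 3" "g 3 \<noteq> g 4" "g 4 \<noteq> g 1" "g 1 \<noteq> g 0"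
      using r by (intro g; simp add: lab_adj_def)+
    with D[of 0] D[of 1] D[of 2] D[of 3] D[of 4] show False
      by auto
  qed
qed

subsection \<open>Reattaching a vertex\<close>

definition reattach :: "('a \<times> 'a) set \<Rightarrow> 'a \<Rightarrow> 'a set \<Rightarrow> ('a \<times> 'a) set" where
  "reattach E u S = {(a, b). (a \<noteq> u \<and> b \<noteq> u \<and> (a, b) \<in> E) \<or> (a = u \<and> b \<in> S) \<or> (b = u \<and> a \<in> S)}"

lemma simple_graph_reattach:
  assumes "simple_graph V E" "u \<in> V" "S \<subseteq> V" "u \<notin> S"
  shows "simple_graph V (reattach E u S)"
  using assms unfolding simple_graph_def reattach_def sym_def irrefl_def by auto

lemma quad_reattach:
  assumes E: "simple_graph V E" and u: "u \<in> V" "S \<subseteq> V" "u \<notin> S"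
  shows "quad (reattach E u S) x = quad E x + 2 * x u * (sum x S - sum x (E `` {u}))"
proof -
  note V = simple_graphD[OF E]
  define E0 where "E0 = {(a, b) \<in> E. a \<noteq> u \<and> b \<noteq> u}"
  have *: "quad (E0 \<union> ({u} \<times> T \<union> T \<times> {u})) x = quad E0 x + 2 * x u * sum x T"
    if T: "T \<subseteq> V" "u \<notin> T" for T
  proof -
    have fin: "finite T" "finite E0"
      using V T by (auto intro: finite_subset simp: E0_def)
    have "quad (E0 \<union> ({u} \<times> T \<union> T \<times> {u})) x = quad E0 x + (quad ({u} \<times> T) x + quad (T \<times> {u}) x)"
      using fin T by (subst quad_Un, simp, simp, force simp: E0_def)
        (subst quad_Un, simp, simp, auto)
    then show ?thesis
      using fin by (simp add: quad_Times)
  qed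
  have "E = E0 \<union> ({u} \<times> E `` {u} \<union> E `` {u} \<times> {u})"
    using V(3) by (auto simp: E0_def sym_def)
  then have "quad E x = quad E0 x + 2 * x u * sum x (E `` {u})"
    using *[of "E `` {u}"] V by (auto simp: irrefl_def)
  moreover have "reattach E u S = E0 \<union> ({u} \<times> S \<union> S \<times> {u})"
    by (auto simp: reattach_def E0_def)
  then have "quad (reattach E u S) x = quad E0 x + 2 * x u * sum x S"
    using *[of S] u by simp
  ultimately show ?thesis
    by (simp add: algebra_simps)
qed

lemma lab_graph_fun_upd:
  assumes "t \<in> V"
  shows "lab_graph V (\<kappa>(t := i)) = reattach (lab_graph V \<kappa>) t {w \<in> V. w \<noteq> t \<and> lab_adj i (\<kappa> w)}"
proof -
  have "(a, b) \<in> lab_graph V (\<kappa>(t := i)) \<longleftrightarrow>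
      (a, b) \<in> reattach (lab_graph V \<kappa>) t {w \<in> V. w \<noteq> t \<and> lab_adj i (\<kappa> w)}" for a b
    using assms lab_adj_sym[of i "\<kappa> a"] by (auto simp: lab_graph_def reattach_def)
  then show ?thesis
    by auto
qed

lemma clique_free_card_le:
  assumes "clique_free (r + 1) V E" "finite V" "C \<subseteq> V" "clique E C"
  shows "card C \<le> r"
proof (rule ccontr)
  assume "\<not> card C \<le> r"
  then obtain T where "T \<subseteq> C" "card T = r + 1"
    using obtain_subset_with_card_n[of "r + 1" C] by auto
  moreover from this have "clique E T"
    using assms(4) by (auto simp: clique_def)
  ultimately show False
    using assms(1,3) by (auto simp: clique_free_def)
qed

lemma clique_freeI:
  assumes "\<And>C. C \<subseteq> V \<Longrightarrow> clique E C \<Longrightarrow> card C = r + 1 \<Longrightarrow> False"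
  shows "clique_free (r + 1) V E"
  using assms unfolding clique_free_def by blast

subsection \<open>Extremal graphs\<close>

text \<open>A maximizer together with its Perron vector. The bound is stated for every vector
  \<open>y\<close>, not just for \<open>x\<close>: this is what turns ties into eigenvectors and
  what allows test vectors adapted to a changed graph.\<close>

locale extremal =
  fixes V :: "'a set" and E :: "('a \<times> 'a) set" and x :: "'a \<Rightarrow> real" and lam :: real and r :: nat
  assumes r2: "2 \<le> r"
    and E_class: "nonpartite_class r V E"
    and x_pos: "u \<in> V \<Longrightarrow> 0 < x u"
    and eigen: "u \<in> V \<Longrightarrow> sum x (E `` {u}) = lam * x u"
    and quad_bound: "nonpartite_class r V F \<Longrightarrow> quad F y \<le> lam * (\<Sum>u\<in>V. (y u)\<^sup>2)"
begin

lemma E_simple: "simple_graph V E" and E_clique_free: "clique_free (r + 1) V E"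
  and E_not_colorable: "\<not> colorable r V E"
  using E_class by (auto simp: nonpartite_class_def)

lemmas finV = simple_graphD(1)[OF E_simple]

lemmas edgeD = simple_graph_edgeD[OF E_simple]

lemma edge_sym: "(u, v) \<in> E \<longleftrightarrow> (v, u) \<in> E"
  using edgeD(3) by blast

lemma no_loop: "(u, u) \<notin> E"
  using edgeD(4) by blast

lemma nbrs_subset: "E `` {u} \<subseteq> V"
  using edgeD by blast

lemma fin_nbrs: "finite (E `` {u})"
  using nbrs_subset finV finite_subset by blast

lemma quad_E: "quad E x = lam * (\<Sum>u\<in>V. (x u)\<^sup>2)"
proof -
  have "quad E x = (\<Sum>u\<in>V. x u * (lam * x u))"
    using quad_conv_sum[OF simple_graphD(1,2)[OF E_simple]] eigen by simp
  then show ?thesis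
    by (simp add: sum_distrib_left power2_eq_square algebra_simps)
qed

lemma quad_le: "nonpartite_class r V F \<Longrightarrow> quad F x \<le> quad E x"
  using quad_bound[of F x] quad_E by simp

text \<open>If a change does not lower the form at \<open>x\<close>, then \<open>x\<close> attains
  the maximum for the changed graph as well, so every row of the new eigenvalue equations must hold.
  Ties are refuted by exhibiting a single row that fails.\<close>

lemma eigen_of_quad_ge:
  assumes F: "nonpartite_class r V F" "quad E x \<le> quad F x" and u: "u \<in> V"
  shows "sum x (F `` {u}) = lam * x u"
proof -
  have "simple_graph V F"
    using F by (simp add: nonpartite_class_def)
  note F' = simple_graphD[OF this]
  have "quad F x = lam * (\<Sum>u\<in>V. (x u)\<^sup>2)"
    using quad_le[OF F(1)] F(2) quad_E by simp
  then show ?thesis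
    using quad_max_imp_eigenvector[OF F'(1-3) quad_bound[OF F(1)]] u by blast
qed

text \<open>As \<open>x\<close> is positive, a new edge raises the form strictly, and it cannot make
  the graph colourable; so every missing edge would complete a clique on \<open>r + 1\<close>
  vertices.\<close>

lemma edge_maximal:
  assumes "simple_graph V F" "clique_free (r + 1) V F" "E \<subseteq> F"
  shows "F = E"
proof (rule ccontr)
  assume "F \<noteq> E"
  then have "E \<subset> F" using assms by blast
  then have "quad E x < quad F x"
    using simple_graphD(5)[OF assms(1)] simple_graph_edgeD[OF assms(1)] x_pos
    by (intro quad_strict_mono) auto
  moreover have "nonpartite_class r V F"
    using assms E_not_colorable colorable_mono[of r V F V E] by (auto simp: nonpartite_class_def)
  ultimately show False
    using quad_le by fastforce
qed

lemma lam_pos: "0 < lam"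
proof -
  have "\<exists>u v. (u, v) \<in> E"
  proof (rule ccontr)
    assume "\<nexists>u v. (u, v) \<in> E"
    then have "colorable r V E"
      using r2 unfolding colorable_def by (intro exI[of _ "\<lambda>_. 0"]) auto
    then show False using E_not_colorable by simp
  qed
  then obtain u v where uv: "(u, v) \<in> E" by blast
  then have "0 < sum x (E `` {u})"
    using fin_nbrs nbrs_subset x_pos by (intro sum_pos) auto
  then show ?thesis
    using eigen[of u] x_pos[of u] edgeD[OF uv] by (simp add: zero_less_mult_iff)
qed

text \<open>
  Zykov symmetrization: making \<open>u\<close> a copy of \<open>v\<close> does not decrease the quadratic form, so \<open>x\<close> stays
  an eigenvector. Comparing the eigenvalue equations at the neighbours of \<open>u\<close> and \<open>v\<close> shows that
  nothing has changed.
\<close>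

lemma twins:
  assumes uv: "u \<in> V" "v \<in> V" "(u, v) \<notin> E" and le: "x u \<le> x v" and nc: "\<not> colorable r (V - {u}) E"
  shows "E `` {u} = E `` {v}"
proof (cases "u = v")
  case False
  define F where "F = reattach E u (E `` {v})"
  have u_nbr: "u \<notin> E `` {v}"
    using uv(3) edge_sym by blast
  have Fs: "simple_graph V F"
    unfolding F_def using E_simple uv nbrs_subset u_nbr by (intro simple_graph_reattach) auto
  have FE: "(a, b) \<in> F \<longleftrightarrow> (a, b) \<in> E" if "a \<noteq> u" "b \<noteq> u" for a b
    using that by (simp add: F_def reattach_def)
  have Fu: "(u, b) \<in> F \<longleftrightarrow> (v, b) \<in> E" for b
    using u_nbr by (auto simp: F_def reattach_def)
  have "clique_free (r + 1) V F"
  proof (rule clique_freeI)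
    fix C assume C: "C \<subseteq> V" "clique F C" "card C = r + 1"
    have finC: "finite C"
      using C finV finite_subset by blast
    show False
    proof (cases "u \<in> C")
      case False
      then have "clique E C"
        using C(2) FE unfolding clique_def by metis
      then show False
        using clique_free_card_le[OF E_clique_free finV C(1)] C(3) by simp
    next
      case True
      have "v \<notin> C"
        using C(2) True False Fu no_loop unfolding clique_def by metis
      \<comment> \<open>In \<open>F\<close> the vertex \<open>u\<close> is a nonadjacent copy of
        \<open>v\<close>, so trading \<open>u\<close> for \<open>v\<close> turns an
        \<open>F\<close>-clique into an \<open>E\<close>-clique of the same size.\<close>
      define D where "D = insert v (C - {u})"
      have "clique E D"
        unfolding clique_def
      proof (intro ballI impI)
        fix a b assume ab: "a \<in> D" "b \<in> D" "a \<noteq> b"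
        consider "a = v" "b \<in> C - {u}" | "b = v" "a \<in> C - {u}" | "a \<in> C - {u}" "b \<in> C - {u}"
          using ab by (auto simp: D_def)
        then show "(a, b) \<in> E"
        proof cases
          case 1
          then show ?thesis
            using C(2) True Fu[of b] unfolding clique_def by auto
        next
          case 2
          then show ?thesis
            using C(2) True Fu[of a] edge_sym unfolding clique_def by auto
        next
          case 3
          then show ?thesis
            using C(2) FE[of a b] ab unfolding clique_def by auto
        qed
      qed
      moreover have "card D = r + 1"
        using True \<open>v \<notin> C\<close> finC C(3) by (simp add: D_def card_Diff_singleton)
      ultimately show False
        using clique_free_card_le[OF E_clique_free finV, of D] C(1) uv by (auto simp: D_def)
    qed
  qed
  moreover have "\<not> colorable r V F"
  proof
    assume "colorable r V F"
    then have "colorable r (V - {u}) F"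
      by (rule colorable_mono) auto
    then show False
      using nc colorable_cong[of "V - {u}" F E] FE by auto
  qed
  ultimately have cls: "nonpartite_class r V F"
    using Fs by (simp add: nonpartite_class_def)
  have "quad F x = quad E x + 2 * x u * (lam * x v - lam * x u)"
    unfolding F_def using quad_reattach[OF E_simple uv(1) nbrs_subset u_nbr] eigen uv by simp
  then have ge: "quad E x \<le> quad F x"
    using le lam_pos x_pos[OF uv(1)] by simp
  show ?thesis
  proof (rule Set.set_eqI)
    fix w
    show "w \<in> E `` {u} \<longleftrightarrow> w \<in> E `` {v}"
    proof (cases "w \<in> V \<and> w \<noteq> u")
      case True
      define A where "A = E `` {w} - {u}"
      have A: "finite A" "u \<notin> A"
        using fin_nbrs by (auto simp: A_def)
      have "E `` {w} = (if w \<in> E `` {u} then insert u A else A)"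
        using edge_sym by (auto simp: A_def)
      then have 1: "sum x (E `` {w}) = sum x A + (if w \<in> E `` {u} then x u else 0)"
        using A by (simp split: if_splits)
      have "F `` {w} = (if w \<in> E `` {v} then insert u A else A)"
        using True edge_sym by (auto simp: F_def reattach_def A_def)
      then have 2: "sum x (F `` {w}) = sum x A + (if w \<in> E `` {v} then x u else 0)"
        using A by (simp split: if_splits)
      have "sum x (E `` {w}) = sum x (F `` {w})"
        using eigen eigen_of_quad_ge[OF cls ge] True by simp
      then show ?thesis
        using 1 2 x_pos[OF uv(1)] by (auto split: if_splits)
    next
      case False
      then show ?thesis
        using u_nbr no_loop edgeD by blast
    qed
  qed
qed simp

section \<open>Critical vertices and the neighbourhood of a heavy vertex\<close>

definition proper_on :: "'a set \<Rightarrow> ('a \<Rightarrow> nat) \<Rightarrow> bool" where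
  "proper_on W f \<longleftrightarrow> (\<forall>w\<in>W. f w < r) \<and> (\<forall>a\<in>W. \<forall>b\<in>W. (a, b) \<in> E \<longrightarrow> f a \<noteq> f b)"

lemma colorable_iff_proper_on: "colorable r W E \<longleftrightarrow> (\<exists>f. proper_on W f)"
  by (simp add: colorable_def proper_on_def)

lemma proper_onD:
  assumes "proper_on W f"
  shows "w \<in> W \<Longrightarrow> f w < r" "a \<in> W \<Longrightarrow> b \<in> W \<Longrightarrow> (a, b) \<in> E \<Longrightarrow> f a \<noteq> f b"
  using assms by (auto simp: proper_on_def)

text \<open>Otherwise the edge \<open>tw\<close> between two colours could be added: a clique
  through \<open>c\<close> misses \<open>t\<close> and hence the new edge, while a clique avoiding
  \<open>c\<close> is still properly coloured by \<open>f\<close>. Edge maximality then puts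
  \<open>tw\<close> into \<open>E\<close>.\<close>

lemma critical_nbrs:
  assumes c: "c \<in> V" "t \<in> V" "t \<noteq> c" "(t, c) \<notin> E"
    and "proper_on (V - {c}) f"
  shows "E `` {t} = {w \<in> V - {c}. f w \<noteq> f t}"
proof
  note f = proper_onD[OF assms(5)]
  show "E `` {t} \<subseteq> {w \<in> V - {c}. f w \<noteq> f t}"
  proof
    fix w assume "w \<in> E `` {t}"
    then have w: "(t, w) \<in> E" by simp
    then have "w \<in> V - {c}"
      using c edgeD(2)[OF w] by auto
    then show "w \<in> {w \<in> V - {c}. f w \<noteq> f t}"
      using f(2)[of t w] c w by auto
  qed
  show "{w \<in> V - {c}. f w \<noteq> f t} \<subseteq> E `` {t}"
  proof
    fix w assume "w \<in> {w \<in> V - {c}. f w \<noteq> f t}"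
    then have w: "w \<in> V" "w \<noteq> c" "f w \<noteq> f t"
      by auto
    define F where "F = E \<union> {(t, w), (w, t)}"
    have Fs: "simple_graph V F"
      using E_simple c w unfolding simple_graph_def F_def sym_def irrefl_def by auto
    have "clique_free (r + 1) V F"
    proof (rule clique_freeI)
      fix C assume C: "C \<subseteq> V" "clique F C" "card C = r + 1"
      show False
      proof (cases "c \<in> C")
        case True
        then have "t \<notin> C"
          using C(2) c w edge_sym unfolding clique_def F_def by auto
        then have "clique E C"
          using C(2) unfolding clique_def F_def by auto
        then show False
          using clique_free_card_le[OF E_clique_free finV C(1)] C(3) by simp
      next
        case False
        have "card C \<le> r"
        proof (rule clique_card_le_colors[OF C(2), of f])
          show "\<forall>v\<in>C. f v < r"
            using False C(1) f(1) by auto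
          show "\<forall>u\<in>C. \<forall>v\<in>C. (u, v) \<in> F \<longrightarrow> f u \<noteq> f v"
            using False C(1) f(2) w unfolding F_def by (auto dest: sym)
        qed
        then show False using C(3) by simp
      qed
    qed
    then have "F = E"
      using edge_maximal Fs by (auto simp: F_def)
    then show "w \<in> E `` {t}"
      by (auto simp: F_def)
  qed
qed

text \<open>If all nonadjacent pairs were twins, one vertex for each neighbourhood would form a
  clique, so there would be at most \<open>r\<close> neighbourhoods, and these would serve as
  colours.\<close>

lemma not_complete_multipartite:
  "\<exists>t\<in>V. \<exists>u\<in>V. (t, u) \<notin> E \<and> E `` {t} \<noteq> E `` {u}"
proof (rule ccontr)
  assume "\<not> ?thesis"
  then have full: "E `` {t} = E `` {u}" if "t \<in> V" "u \<in> V" "(t, u) \<notin> E" for t u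
    using that by blast
  define M where "M = (\<lambda>u. E `` {u}) ` V"
  have finM: "finite M"
    using finV by (simp add: M_def)
  have "\<forall>m\<in>M. \<exists>u\<in>V. E `` {u} = m"
    by (auto simp: M_def)
  then obtain h where h: "\<And>m. m \<in> M \<Longrightarrow> h m \<in> V \<and> E `` {h m} = m"
    by metis
  have inj: "inj_on h M"
    using h by (metis inj_onI)
  have "clique E (h ` M)"
    unfolding clique_def
  proof (intro ballI impI)
    fix a b assume "a \<in> h ` M" "b \<in> h ` M" "a \<noteq> b"
    then show "(a, b) \<in> E"
      using h full by (metis imageE)
  qed
  then have "card (h ` M) \<le> r"
    using h by (intro clique_free_card_le[OF E_clique_free finV]) auto
  then have "card M \<le> r"
    using card_image[OF inj] by simp
  obtain g where g: "bij_betw g M {0..<card M}"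
    using ex_bij_betw_finite_nat[OF finM] by blast
  have "colorable r V E"
    unfolding colorable_def
  proof (intro exI[of _ "\<lambda>u. g (E `` {u})"] conjI ballI impI)
    fix u assume "u \<in> V"
    then have "g (E `` {u}) \<in> {0..<card M}"
      using g by (auto simp: M_def bij_betw_def)
    then show "g (E `` {u}) < r"
      using \<open>card M \<le> r\<close> by simp
  next
    fix u v assume uv: "u \<in> V" "v \<in> V" "(u, v) \<in> E"
    then have "E `` {u} \<noteq> E `` {v}"
      using no_loop by blast
    then show "g (E `` {u}) \<noteq> g (E `` {v})"
      using g uv by (auto simp: M_def bij_betw_def inj_on_def)
  qed
  then show False
    using E_not_colorable by simp
qed

text \<open>In the final labelling \<open>v\<close> lies in class 0, the other nonneighbours being
  its twins, and \<open>y\<close> and \<open>z\<close> are the single vertices labelled 3 and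
  4.\<close>

definition center :: "'a \<Rightarrow> 'a \<Rightarrow> 'a \<Rightarrow> bool" where
  "center v y z \<longleftrightarrow> v \<in> V \<and> (y, z) \<in> E \<and> (v, y) \<notin> E \<and> (v, z) \<notin> E \<and>
     colorable r (V - {y}) E \<and> colorable r (V - {z}) E \<and>
     (\<forall>w\<in>V. (v, w) \<notin> E \<longrightarrow> w = y \<or> w = z \<or> E `` {w} = E `` {v})"

lemma centerD:
  assumes "center v y z"
  shows "v \<in> V" "(y, z) \<in> E" "(v, y) \<notin> E" "(v, z) \<notin> E"
    "colorable r (V - {y}) E" "colorable r (V - {z}) E"
proof -
  note * = assms[unfolded center_def]
  show "v \<in> V"
    using * by (elim conjE)
  show "(y, z) \<in> E"
    using * by (elim conjE)
  show "(v, y) \<notin> E"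
    using * by (elim conjE)
  show "(v, z) \<notin> E"
    using * by (elim conjE)
  show "colorable r (V - {y}) E"
    using * by (elim conjE)
  show "colorable r (V - {z}) E"
    using * by (elim conjE)
qed

lemma center_twin:
  assumes "center v y z" "w \<in> V" "(v, w) \<notin> E" "w \<noteq> y" "w \<noteq> z"
  shows "E `` {w} = E `` {v}"
proof -
  have "\<forall>w\<in>V. (v, w) \<notin> E \<longrightarrow> w = y \<or> w = z \<or> E `` {w} = E `` {v}"
    using assms(1) unfolding center_def by (elim conjE)
  from bspec[OF this assms(2)] assms(3-) show ?thesis
    by simp
qed

lemma center_sym:
  assumes c: "center v y z"
  shows "center v z y"
  unfolding center_def
proof (intro conjI ballI impI)
  fix w assume w: "w \<in> V" "(v, w) \<notin> E"
  show "w = z \<or> w = y \<or> E `` {w} = E `` {v}"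
    using center_twin[OF c w] by (cases "w = y"; cases "w = z") simp_all
qed (rule centerD[OF c] edgeD(3)[OF centerD(2)[OF c]])+

text \<open>Choose \<open>v\<close> heaviest in \<open>U\<close>. A nonneighbour outside
  \<open>U\<close> would be a twin of \<open>v\<close> and would make all nonneighbours of
  \<open>v\<close> twins; so every nonneighbour weighs at most \<open>x v\<close>, and
  symmetrization shows that each non-twin \<open>y\<close> among them is critical. If
  \<open>y\<close> had no neighbour \<open>z\<close> among the nonneighbours of \<open>v\<close>, it
  could take the colour of \<open>v\<close>. A further non-twin \<open>w\<close> would be critical
  too, and in a colouring of \<open>V - {w}\<close> both \<open>y\<close> and \<open>z\<close> would
  share the colour of \<open>v\<close>, although they are adjacent.\<close>

lemma center_exists: "\<exists>v y z. center v y z"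
proof -
  define U where "U = {t \<in> V. \<exists>u\<in>V. (t, u) \<notin> E \<and> E `` {t} \<noteq> E `` {u}}"
  have "finite U" "U \<noteq> {}"
    using finV not_complete_multipartite by (auto simp: U_def)
  then have "Max (x ` U) \<in> x ` U"
    by (intro Max_in) auto
  then obtain v where v: "v \<in> U" "x v = Max (x ` U)"
    by auto
  have vmax: "x u \<le> x v" if "u \<in> U" for u
    using that \<open>finite U\<close> v(2) by simp
  have vV: "v \<in> V" using v by (simp add: U_def)
  have le: "x u \<le> x v" if u: "u \<in> V" "(v, u) \<notin> E" for u
  proof (rule vmax, rule ccontr)
    assume "u \<notin> U"
    then have *: "(u, w) \<notin> E \<Longrightarrow> E `` {u} = E `` {w}" if "w \<in> V" for w
      using u that by (auto simp: U_def)
    then have vu: "E `` {u} = E `` {v}"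
      using u vV edge_sym by blast
    obtain w where "w \<in> V" "(v, w) \<notin> E" "E `` {v} \<noteq> E `` {w}"
      using v(1) by (auto simp: U_def)
    then show False
      using * vu by blast
  qed
  have crit: "colorable r (V - {u}) E" if "u \<in> V" "(v, u) \<notin> E" "E `` {u} \<noteq> E `` {v}" for u
    using twins[of u v] le[of u] that vV edge_sym by blast
  obtain y where y: "y \<in> V" "(v, y) \<notin> E" "E `` {v} \<noteq> E `` {y}"
    using v(1) by (auto simp: U_def)
  then have cy: "colorable r (V - {y}) E"
    using crit by metis
  then obtain f where pf: "proper_on (V - {y}) f"
    by (auto simp: colorable_iff_proper_on)
  note f = proper_onD[OF pf]
  have "v \<noteq> y"
    using y by blast
  have nv: "E `` {v} = {w \<in> V - {y}. f w \<noteq> f v}"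
    using critical_nbrs[OF y(1) vV \<open>v \<noteq> y\<close> y(2) pf] .
  have "\<exists>z\<in>V. (v, z) \<notin> E \<and> (y, z) \<in> E"
  proof (rule ccontr)
    assume *: "\<not> ?thesis"
    have yz: "f z \<noteq> f v" if "z \<in> V" "(y, z) \<in> E" for z
      using * nv that by blast
    have "colorable r V E"
      unfolding colorable_def
    proof (intro exI[of _ "f(y := f v)"] conjI ballI impI)
      fix w assume "w \<in> V"
      then show "(f(y := f v)) w < r"
        using f(1) vV \<open>v \<noteq> y\<close> by auto
    next
      fix a b assume ab: "a \<in> V" "b \<in> V" "(a, b) \<in> E"
      then show "(f(y := f v)) a \<noteq> (f(y := f v)) b"
        using yz[of a] yz[of b] f(2)[of a b] edge_sym no_loop by auto
    qed
    then show False
      using E_not_colorable by simp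
  qed
  then obtain z where z: "z \<in> V" "(v, z) \<notin> E" "(y, z) \<in> E"
    by blast
  have "E `` {z} \<noteq> E `` {v}"
    using z y edge_sym by blast
  then have cz: "colorable r (V - {z}) E"
    using crit z by blast
  have tw: "E `` {w} = E `` {v}" if w: "w \<in> V" "(v, w) \<notin> E" "w \<noteq> y" "w \<noteq> z" for w
  proof (rule ccontr)
    assume ne: "E `` {w} \<noteq> E `` {v}"
    have "colorable r (V - {w}) E"
      using crit w ne by simp
    then obtain g where g: "proper_on (V - {w}) g"
      by (auto simp: colorable_iff_proper_on)
    have "E `` {v} = {u \<in> V - {w}. g u \<noteq> g v}"
      using critical_nbrs[OF w(1) vV _ _ g] w ne by blast
    moreover have "y \<in> V - {w}" "z \<in> V - {w}" "y \<notin> E `` {v}" "z \<notin> E `` {v}"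
      using y z w by auto
    ultimately have "g y = g v" "g z = g v"
      by auto
    then show False
      using proper_onD(2)[OF g, of y z] y z w by auto
  qed
  have "center v y z"
    unfolding center_def
  proof (intro conjI ballI impI)
    fix w assume w: "w \<in> V" "(v, w) \<notin> E"
    show "w = y \<or> w = z \<or> E `` {w} = E `` {v}"
      using tw[OF w] by (cases "w = y"; cases "w = z") simp_all
  qed (rule vV z(3) y(2) z(2) cy cz)+
  then show ?thesis
    by (intro exI)
qed

end

context extremal
begin

lemma center_basics:
  assumes c: "center v y z"
  shows "y \<in> V" "z \<in> V" "y \<noteq> z" "v \<noteq> y" "v \<noteq> z" "y \<notin> E `` {v}" "z \<notin> E `` {v}"
proof -
  show "y \<in> V" "z \<in> V" "y \<noteq> z"
    using edgeD[OF centerD(2)[OF c]] by simp_all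
  show "v \<noteq> y"
    using centerD(2,4)[OF c] by auto
  show "v \<noteq> z"
    using edgeD(3)[OF centerD(2)[OF c]] centerD(3)[OF c] by auto
  show "y \<notin> E `` {v}" "z \<notin> E `` {v}"
    using centerD(3,4)[OF c] by simp_all
qed

text \<open>
  If every nonneighbour of \<open>y\<close> in \<open>N(v)\<close> is adjacent to every nonneighbour of \<open>z\<close> in \<open>N(v)\<close>, then
  \<open>y\<close> can be moved to the twins of \<open>v\<close> as a full part; to avoid large cliques, \<open>z\<close> loses its
  neighbours among the nonneighbours of \<open>y\<close>. By symmetry this would give both \<open>x y < x z\<close> and \<open>x z < x y\<close>.
\<close>

lemma center_weight_less:
  assumes c: "center v y z"
    and PQ: "\<And>p q. p \<in> E `` {v} \<Longrightarrow> q \<in> E `` {v} \<Longrightarrow> (p, y) \<notin> E \<Longrightarrow> (q, z) \<notin> E \<Longrightarrow> (p, q) \<in> E"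
  shows "x y < x z"
proof -
  define N where "N = E `` {v}"
  define P where "P = {p \<in> N. (p, y) \<notin> E}"
  define Q where "Q = {q \<in> N. (q, z) \<notin> E}"
  define B where "B = {w \<in> V. (v, w) \<notin> E} - {y, z}"
  define S where "S = N - P - Q"
  note vV = centerD(1)[OF c] and yz = centerD(2)[OF c]
  note bas = center_basics[OF c]
  have yN: "y \<notin> N" "z \<notin> N"
    using bas by (simp_all add: N_def)
  have NV: "N \<subseteq> V" and finN: "finite N"
    using nbrs_subset fin_nbrs by (simp_all add: N_def)
  have finB: "finite B" and BV: "B \<subseteq> V"
    using finV by (auto simp: B_def)
  have sub: "P \<subseteq> N" "Q \<subseteq> N" "finite P" "finite Q" "S \<subseteq> N"
    using finN by (auto simp: P_def Q_def S_def)
  have BN: "(a, b) \<in> E \<longleftrightarrow> b \<in> N" if "a \<in> B" for a b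
    using center_twin[OF c, of a] that by (auto simp: B_def N_def)
  have vB: "v \<in> B"
    using vV bas no_loop by (auto simp: B_def)
  have Bdisj: "b \<notin> N" "b \<noteq> y" "b \<noteq> z" if "b \<in> B" for b
    using that by (auto simp: B_def N_def)
  have yzB: "y \<notin> B" "z \<notin> B"
    by (simp_all add: B_def)
  have Vcases: "w \<in> N \<or> w \<in> B \<or> w = y \<or> w = z" if "w \<in> V" for w
    using that by (auto simp: B_def N_def)
  have PQ': "(p, q) \<in> E" if "p \<in> P" "q \<in> Q" for p q
    using PQ[of p q] that by (simp add: P_def Q_def N_def)
  have PQdisj: "P \<inter> Q = {}"
    using PQ' no_loop by blast
  have nby: "E `` {y} = insert z (N - P)"
  proof (intro subset_antisym subsetI)
    fix w assume "w \<in> E `` {y}"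
    then have w: "(y, w) \<in> E" "(w, y) \<in> E" "w \<in> V"
      using edgeD by auto
    then have "w \<noteq> y" "w \<notin> B" "w \<notin> P"
      using no_loop BN yN by (auto simp: P_def)
    then show "w \<in> insert z (N - P)"
      using Vcases[OF w(3)] by auto
  next
    fix w assume "w \<in> insert z (N - P)"
    then show "w \<in> E `` {y}"
      using yz edgeD(3) by (auto simp: P_def)
  qed
  have nbz: "E `` {z} = insert y (N - Q)"
  proof (intro subset_antisym subsetI)
    fix w assume "w \<in> E `` {z}"
    then have w: "(z, w) \<in> E" "(w, z) \<in> E" "w \<in> V"
      using edgeD by auto
    then have "w \<noteq> z" "w \<notin> B" "w \<notin> Q"
      using no_loop BN yN by (auto simp: Q_def)
    then show "w \<in> insert y (N - Q)"
      using Vcases[OF w(3)] by auto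
  next
    fix w assume "w \<in> insert y (N - Q)"
    then show "w \<in> E `` {z}"
      using yz edgeD(3) by (auto simp: Q_def)
  qed
  define F1 where "F1 = reattach E y (insert z N)"
  define F where "F = reattach F1 z (insert y B \<union> S)"
  have F1s: "simple_graph V F1"
    unfolding F1_def using bas NV yN by (intro simple_graph_reattach[OF E_simple]) auto
  have T: "insert y B \<union> S \<subseteq> V" "z \<notin> insert y B \<union> S"
    using bas NV BV yN sub yzB by auto
  have Fs: "simple_graph V F"
    unfolding F_def using bas T by (intro simple_graph_reattach[OF F1s])
  have FN: "(a, b) \<in> F \<longleftrightarrow> (a, b) \<in> E" if "a \<in> N" "b \<in> N" for a b
    using that yN by (auto simp: F_def F1_def reattach_def)
  have FB: "(a, b) \<in> F \<longleftrightarrow> b \<in> insert z N" if "a \<in> insert y B" for a b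
  proof (cases "a = y")
    case True
    then show ?thesis
      using bas yN by (auto simp: F_def F1_def reattach_def)
  next
    case False
    then have "a \<in> B" using that by simp
    then show ?thesis
      using Bdisj[of a] BN[of a b] yN bas by (auto simp: F_def F1_def reattach_def)
  qed
  have Fz: "(z, b) \<in> F \<longleftrightarrow> b \<in> insert y B \<union> S" for b
    using T(2) by (auto simp: F_def reattach_def)
  have Fsym: "(a, b) \<in> F \<Longrightarrow> (b, a) \<in> F" for a b
    using simple_graph_edgeD(3)[OF Fs] .
  have "clique_free (r + 1) V F"
  proof (rule clique_freeI)
    fix C assume C: "C \<subseteq> V" "clique F C" "card C = r + 1"
    have finC: "finite C"
      using C finV finite_subset by blast
    define K where "K = C - insert y B"
    have "\<forall>a\<in>C \<inter> insert y B. \<forall>b\<in>C \<inter> insert y B. a = b"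
    proof (intro ballI, rule ccontr)
      fix a b assume ab: "a \<in> C \<inter> insert y B" "b \<in> C \<inter> insert y B" "a \<noteq> b"
      then have "(a, b) \<in> F"
        using C(2) by (simp add: clique_def)
      then show False
        using FB[of a b] ab Bdisj[of b] yN bas by auto
    qed
    then have "card (C \<inter> insert y B) \<le> 1"
      using finC by (simp add: card_le_Suc0_iff_eq)
    then have cK: "r \<le> card K"
      using card_Int_Diff[OF finC, of "insert y B"] C(3) by (simp add: K_def)
    have KN: "K \<subseteq> insert z N"
      using C(1) Vcases by (auto simp: K_def)
    have finK: "finite K"
      using finC by (simp add: K_def)
    have Kcl: "(a, b) \<in> F" if "a \<in> K" "b \<in> K" "a \<noteq> b" for a b
      using C(2) that by (simp add: clique_def K_def)
    \<comment> \<open>The clique meets the part \<open>insert y B\<close> at most once. The rest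
      \<open>K\<close> is enlarged inside \<open>E\<close>: by \<open>v\<close> if \<open>z\<close>
      is absent, otherwise by \<open>y\<close>, because \<open>K - {z}\<close> then lies in the
      common neighbourhood \<open>S\<close> of \<open>y\<close> and \<open>z\<close>.\<close>
    obtain D where D: "clique E D" "D \<subseteq> V" "card D = card K + 1"
    proof (cases "z \<in> K")
      case False
      then have KN': "K \<subseteq> N" using KN by auto
      have "clique E (insert v K)"
        unfolding clique_def
      proof (intro ballI impI)
        fix a b assume ab: "a \<in> insert v K" "b \<in> insert v K" "a \<noteq> b"
        consider "a = v" "b \<in> K" | "b = v" "a \<in> K" | "a \<in> K" "b \<in> K"
          using ab by auto
        then show "(a, b) \<in> E"
        proof cases
          case 1
          then show ?thesis using KN' by (auto simp: N_def)
        next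
          case 2
          then show ?thesis using KN' edgeD(3) by (auto simp: N_def)
        next
          case 3
          then show ?thesis using Kcl[of a b] FN[of a b] KN' ab by auto
        qed
      qed
      moreover have "v \<notin> K"
        using KN' no_loop by (auto simp: N_def)
      ultimately show ?thesis
        using that[of "insert v K"] KN' NV vV finK by auto
    next
      case True
      have KS: "K - {z} \<subseteq> S"
      proof
        fix w assume w: "w \<in> K - {z}"
        then have "(z, w) \<in> F"
          using Kcl[of z w] True by auto
        then show "w \<in> S"
          using Fz[of w] w by (auto simp: K_def)
      qed
      have yS: "(y, w) \<in> E" if "w \<in> S" for w
        using that edgeD(3) by (auto simp: S_def P_def)
      have zS: "(z, w) \<in> E" if "w \<in> S" for w
        using that edgeD(3) by (auto simp: S_def Q_def)
      have yK: "y \<notin> K" by (simp add: K_def)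
      have "clique E (insert y K)"
        unfolding clique_def
      proof (intro ballI impI)
        fix a b assume ab: "a \<in> insert y K" "b \<in> insert y K" "a \<noteq> b"
        have "w = y \<or> w = z \<or> w \<in> S" if "w \<in> insert y K" for w
          using that KS by auto
        then consider "a = y" "b = z" | "a = z" "b = y" | "a = y" "b \<in> S" | "b = y" "a \<in> S"
          | "a = z" "b \<in> S" | "b = z" "a \<in> S" | "a \<in> S" "b \<in> S"
          using ab by blast
        then show "(a, b) \<in> E"
        proof cases
          case 7
          then have "a \<in> K" "b \<in> K" "a \<in> N" "b \<in> N"
            using ab yN sub by auto
          then show ?thesis using Kcl[of a b] FN[of a b] ab by simp
        qed (use yz yS zS edgeD(3) in auto)
      qed
      then show ?thesis
        using that[of "insert y K"] KN NV bas finK yK by auto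
    qed
    then show False
      using clique_free_card_le[OF E_clique_free finV D(2,1)] cK by simp
  qed
  moreover have "\<not> colorable r V F"
  proof
    assume "colorable r V F"
    then obtain f :: "'a \<Rightarrow> nat" where f: "\<And>u. u \<in> V \<Longrightarrow> f u < r"
      "\<And>u w. u \<in> V \<Longrightarrow> w \<in> V \<Longrightarrow> (u, w) \<in> F \<Longrightarrow> f u \<noteq> f w"
      unfolding colorable_def by blast
    have fy: "f w \<noteq> f y" if "w \<in> insert z N" for w
      using f(2)[of y w] FB[of y w] that bas NV by auto
    have fN: "f a \<noteq> f b" if "a \<in> N" "b \<in> N" "(a, b) \<in> E" for a b
      using f(2)[of a b] FN[of a b] that NV by auto
    \<comment> \<open>The colour \<open>f y\<close> occurs neither on \<open>N\<close> nor at
      \<open>z\<close>. If within \<open>N\<close> the colour of \<open>z\<close> is confined to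
      nonneighbours of \<open>z\<close>, then \<open>y\<close> and the twins take
      \<open>f y\<close>. Otherwise some \<open>p\<close> in \<open>P\<close> has colour
      \<open>f z\<close>, and no neighbour of \<open>y\<close> in \<open>N\<close> can have it,
      since it would lie in \<open>Q\<close> and be adjacent to \<open>p\<close>; so
      \<open>y\<close> takes \<open>f z\<close>, and \<open>z\<close> and the twins take
      \<open>f y\<close>.\<close>
    have "colorable r V E"
    proof (cases "\<forall>w\<in>N. f w = f z \<longrightarrow> w \<in> Q")
      case True
      define g where "g w = (if w \<in> insert z N then f w else f y)" for w
      have gz: "f w \<noteq> f z" if "w \<in> N" "(w, z) \<in> E" for w
        using True that by (auto simp: Q_def)
      have half: "g a \<noteq> g b" if ab: "(a, b) \<in> E" "a \<in> insert z N" for a b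
      proof (cases "b \<in> insert z N")
        case True
        then consider "a \<in> N" "b \<in> N" | "a = z" "b \<in> N" | "a \<in> N" "b = z"
          using ab no_loop by auto
        then show ?thesis
          by cases (use fN[of a b] gz[of a] gz[of b] ab edgeD(3)[OF ab(1)] in \<open>auto simp: g_def\<close>)
      next
        case False
        then show ?thesis
          using fy[OF ab(2)] ab by (simp add: g_def)
      qed
      have no: "(a, b) \<notin> E" if "a \<in> insert y B" "b \<in> insert y B" for a b
        using that BN[of a b] BN[of b a] Bdisj[of a] Bdisj[of b] yN no_loop edgeD(3)[of a b] by auto
      show ?thesis
        unfolding colorable_def
      proof (intro exI[of _ g] conjI ballI impI)
        fix w assume "w \<in> V"
        then show "g w < r"
          using f(1) bas by (simp add: g_def)
      next
        fix a b assume ab: "a \<in> V" "b \<in> V" "(a, b) \<in> E"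
        consider "a \<in> insert z N" | "b \<in> insert z N" | "a \<in> insert y B" "b \<in> insert y B"
          using Vcases[OF ab(1)] Vcases[OF ab(2)] by auto
        then show "g a \<noteq> g b"
          using half[OF ab(3)] half[OF edgeD(3)[OF ab(3)]] no ab(3) by cases auto
      qed
    next
      case False
      then obtain p where p: "p \<in> N" "f p = f z" "p \<notin> Q" by blast
      have nSz: "f w \<noteq> f z" if "w \<in> S" for w
        using f(2)[of z w] Fz[of w] that bas sub NV by auto
      then have "p \<in> P"
        using p by (auto simp: S_def)
      have gy: "f w \<noteq> f z" if "w \<in> N" "(w, y) \<in> E" for w
      proof
        assume "f w = f z"
        moreover have "w \<notin> P" using that by (simp add: P_def)
        ultimately have "w \<in> Q"
          using nSz that by (auto simp: S_def)
        then have "(p, w) \<in> E"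
          using PQ' \<open>p \<in> P\<close> by simp
        then show False
          using fN[of p w] p that \<open>f w = f z\<close> by simp
      qed
      define g where "g w = (if w \<in> N then f w else if w = y then f z else f y)" for w
      have half: "g a \<noteq> g b" if ab: "(a, b) \<in> E" "a \<in> N" for a b
        using fN[of a b] fy[of a] gy[of a] ab by (auto simp: g_def)
      show ?thesis
        unfolding colorable_def
      proof (intro exI[of _ g] conjI ballI impI)
        fix w assume "w \<in> V"
        then show "g w < r"
          using f(1) bas by (simp add: g_def)
      next
        fix a b assume ab: "a \<in> V" "b \<in> V" "(a, b) \<in> E"
        have "a \<in> N \<or> b \<in> N \<or> (a = y \<and> b = z) \<or> (a = z \<and> b = y)"
          using Vcases[OF ab(1)] Vcases[OF ab(2)] BN[of a b] BN[of b a] ab(3) edgeD(3)[OF ab(3)] no_loop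
          by auto
        then show "g a \<noteq> g b"
          using half[OF ab(3)] half[OF edgeD(3)[OF ab(3)]] fy[of z] bas(3) yN by (auto simp: g_def)
      qed
    qed
    then show False
      using E_not_colorable by simp
  qed
  ultimately have cls: "nonpartite_class r V F"
    using Fs by (simp add: nonpartite_class_def)
  have F1z: "F1 `` {z} = insert y (N - Q)"
    using nbz bas yN by (auto simp: F1_def reattach_def)
  have sNP: "sum x (N - P) = sum x N - sum x P" and sNQ: "sum x (N - Q) = sum x N - sum x Q"
    using sub finN by (simp_all add: sum_diff)
  have sS: "sum x S = sum x N - sum x P - sum x Q"
  proof -
    have "S = N - (P \<union> Q)" by (auto simp: S_def)
    then show ?thesis
      using sub finN PQdisj by (simp add: sum_diff sum.union_disjoint)
  qed
  have "quad F1 x = quad E x + 2 * x y * sum x P"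
    unfolding F1_def
    by (subst quad_reattach[OF E_simple]) (use bas NV yN finN sNP nby in \<open>simp_all add: sum.insert\<close>)
  moreover have "quad F x = quad F1 x + 2 * x z * (sum x B - sum x P)"
  proof -
    have 1: "sum x (insert y B \<union> S) = x y + sum x B + sum x S"
    proof -
      have "insert y B \<union> S = insert y (B \<union> S)" by simp
      moreover have "B \<inter> S = {}" "y \<notin> B \<union> S"
        using Bdisj sub yN by auto
      ultimately show ?thesis
        using finB finN sub by (simp add: sum.union_disjoint finite_subset[of S N])
    qed
    have 2: "sum x (insert y (N - Q)) = x y + sum x (N - Q)"
      using finN yN by simp
    show ?thesis
      unfolding F_def quad_reattach[OF F1s bas(2) T] F1z 1 2 sS sNQ by (simp add: algebra_simps)
  qed
  \<comment> \<open>Rearranged, \<open>x z * sum x B \<le> (x z - x y) * sum x P\<close>, with a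
    positive left side because \<open>v\<close> lies in \<open>B\<close>.\<close>
  ultimately have "x y * sum x P + x z * (sum x B - sum x P) \<le> 0"
    using quad_le[OF cls] by simp
  moreover have "0 < sum x B"
    using vB finB BV x_pos by (intro sum_pos) auto
  moreover have "0 \<le> sum x P"
    using sub NV x_pos by (intro sum_nonneg) (meson less_imp_le subsetD)
  ultimately have *: "x y * sum x P + (x z * sum x B - x z * sum x P) \<le> 0"
      "0 < x z * sum x B" "0 \<le> sum x P"
    using x_pos[OF bas(2)] by (simp_all add: right_diff_distrib)
  show "x y < x z"
  proof (rule ccontr)
    assume "\<not> x y < x z"
    then have "x z * sum x P \<le> x y * sum x P"
      using *(3) by (intro mult_right_mono) auto
    then show False
      using *(1,2) by linarith
  qed
qed

lemma proper_on_transpose: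
  assumes "proper_on W f" "i < r" "j < r"
  shows "proper_on W (\<lambda>w. Transposition.transpose i j (f w))"
  unfolding proper_on_def
proof (intro conjI ballI impI)
  fix w assume "w \<in> W"
  then show "Transposition.transpose i j (f w) < r"
    using proper_onD(1)[OF assms(1)] assms(2,3) by (simp add: Transposition.transpose_def)
next
  fix a b assume "a \<in> W" "b \<in> W" "(a, b) \<in> E"
  then have "f a \<noteq> f b"
    by (rule proper_onD(2)[OF assms(1)])
  then show "Transposition.transpose i j (f a) \<noteq> Transposition.transpose i j (f b)"
    by (auto simp: Transposition.transpose_def)
qed

lemma proper_on_recolor:
  assumes f: "proper_on W f" and ab: "a \<in> W" "b \<in> W" "f a \<noteq> f b"
  obtains g where "proper_on W g" "g a = 0" "g b = 1"
proof -
  define g1 where "g1 = (\<lambda>w. Transposition.transpose 0 (f a) (f w))"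
  have g1: "proper_on W g1" "g1 a = 0"
    using proper_on_transpose[OF f, of 0 "f a"] r2 proper_onD(1)[OF f ab(1)] by (simp_all add: g1_def)
  have g1b: "g1 b \<noteq> 0"
    using ab(3) by (auto simp: g1_def Transposition.transpose_def)
  define g where "g = (\<lambda>w. Transposition.transpose 1 (g1 b) (g1 w))"
  have "proper_on W g"
    using proper_on_transpose[OF g1(1), of 1 "g1 b"] r2 proper_onD(1)[OF g1(1) ab(2)] by (simp add: g_def)
  moreover have "g a = 0" "g b = 1"
    using g1(2) g1b by (simp_all add: g_def Transposition.transpose_def)
  ultimately show ?thesis
    by (rule that)
qed

lemma critical_nbr_iff:
  assumes "c \<in> V" "t \<in> V" "t \<noteq> c" "(t, c) \<notin> E" "proper_on (V - {c}) f"
  shows "(t, w) \<in> E \<longleftrightarrow> w \<in> V \<and> w \<noteq> c \<and> f w \<noteq> f t"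
proof -
  have "w \<in> E `` {t} \<longleftrightarrow> w \<in> {w \<in> V - {c}. f w \<noteq> f t}"
    by (simp only: critical_nbrs[OF assms])
  then show ?thesis by simp
qed

text \<open>Colour \<open>V - {y}\<close> with \<open>v\<close> in colour 0 and \<open>p0\<close> in
  colour 1; then \<open>z\<close> gets colour 0 and \<open>q0\<close> colour 1. Colour 1 is split by
  adjacency to \<open>z\<close> into the labels 1 and 2. The only edges that may contradict the
  labelling come from the set \<open>C\<close> of vertices of colour 1 adjacent to both
  \<open>y\<close> and \<open>z\<close>. If \<open>C\<close> is empty, edge maximality gives
  equality; otherwise \<open>C\<close> is shown to be a single vertex lighter than
  \<open>p0\<close>, and replacing it by a copy of \<open>p0\<close> gains strictly.\<close>

theorem center_lab_graph:
  assumes c: "center v y z"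
    and p0: "p0 \<in> E `` {v}" "(p0, y) \<notin> E" and q0: "q0 \<in> E `` {v}" "(q0, z) \<notin> E"
    and pq: "(p0, q0) \<notin> E"
  shows "\<exists>\<kappa>. \<kappa> ` V = {..<r + 3} \<and> {w \<in> V. \<kappa> w = 3} = {y} \<and> {w \<in> V. \<kappa> w = 4} = {z} \<and> E = lab_graph V \<kappa>"
proof -
  note vV = centerD(1)[OF c] and yz = centerD(2)[OF c] and vy = centerD(3)[OF c]
  note bas = center_basics[OF c]
  have p0V: "p0 \<in> V" "p0 \<noteq> y" "p0 \<noteq> z" "(v, p0) \<in> E" and q0V: "q0 \<in> V" "q0 \<noteq> y" "q0 \<noteq> z" "(v, q0) \<in> E"
    using p0 q0 nbrs_subset bas by auto
  obtain f0 where f0: "proper_on (V - {y}) f0"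
    using centerD(5)[OF c] by (auto simp: colorable_iff_proper_on)
  obtain g where g: "proper_on (V - {z}) g"
    using centerD(6)[OF c] by (auto simp: colorable_iff_proper_on)
  have mem: "v \<in> V - {y}" "p0 \<in> V - {y}" "q0 \<in> V - {y}" "z \<in> V - {y}"
    using bas p0V q0V vV by auto
  obtain f where f: "proper_on (V - {y}) f" "f v = 0" "f p0 = 1"
    by (rule proper_on_recolor[OF f0 mem(1,2) proper_onD(2)[OF f0 mem(1,2) p0V(4)]])
  have nv: "(v, w) \<in> E \<longleftrightarrow> w \<in> V \<and> w \<noteq> y \<and> f w \<noteq> 0" for w
    using critical_nbr_iff[OF bas(1) vV bas(4) vy f(1)] f(2) by simp
  have np: "(p0, w) \<in> E \<longleftrightarrow> w \<in> V \<and> w \<noteq> y \<and> f w \<noteq> 1" for w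
    using critical_nbr_iff[OF bas(1) p0V(1,2) p0(2) f(1)] f(3) by simp
  have fz: "f z = 0"
    using nv[of z] centerD(4)[OF c] bas(2,3) by auto
  have fq: "f q0 = 1"
    using np[of q0] pq q0V by auto
  have nvg: "(v, w) \<in> E \<longleftrightarrow> w \<in> V \<and> w \<noteq> z \<and> g w \<noteq> g v" for w
    using critical_nbr_iff[OF bas(2) vV bas(5) centerD(4)[OF c] g] .
  have nqg: "(q0, w) \<in> E \<longleftrightarrow> w \<in> V \<and> w \<noteq> z \<and> g w \<noteq> g q0" for w
    using critical_nbr_iff[OF bas(2) q0V(1,3) q0(2) g] .
  have yq: "(q0, y) \<in> E"
    using nvg[of y] nvg[of q0] nqg[of y] vy q0V bas(1,3) by auto
  have gp: "g p0 = g q0"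
    using nqg[of p0] pq p0V edgeD(3)[of q0 p0] by auto
  have nq: "(q0, w) \<notin> E \<longleftrightarrow> w = z \<or> (w \<noteq> y \<and> f w = 1)" if w: "w \<in> V" for w
  proof
    assume qw: "(q0, w) \<notin> E"
    show "w = z \<or> (w \<noteq> y \<and> f w = 1)"
    proof (cases "w = z")
      case False
      have "w \<noteq> y" using qw yq by auto
      have "g w = g p0"
        using nqg[of w] qw False w gp by auto
      then have "(p0, w) \<notin> E"
        using proper_onD(2)[OF g, of p0 w] p0V w False by auto
      then show ?thesis
        using np[of w] w \<open>w \<noteq> y\<close> by auto
    qed simp
  next
    assume "w = z \<or> (w \<noteq> y \<and> f w = 1)"
    then show "(q0, w) \<notin> E"
      using q0(2) proper_onD(2)[OF f(1), of q0 w] mem(3) w fq by auto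
  qed
  define C where "C = {w \<in> V. w \<noteq> y \<and> f w = 1 \<and> (w, y) \<in> E \<and> (w, z) \<in> E}"
  define \<kappa> where "\<kappa> w = (if w = y then 3 else if w = z then 4 else if f w = 0 then 0
      else if f w = 1 then (if (w, z) \<in> E then 1 else 2) else f w + 3)" for w
  have fr: "f w < r" if "w \<in> V" "w \<noteq> y" for w
    using proper_onD(1)[OF f(1)] that by auto
  have zp0: "(p0, z) \<in> E"
    using np[of z] mem(4) fz by auto
  have \<kappa>v: "\<kappa> v = 0" "\<kappa> p0 = 1" "\<kappa> q0 = 2" "\<kappa> y = 3" "\<kappa> z = 4"
    using bas p0V q0V f fq q0(2) zp0 by (auto simp: \<kappa>_def)
  have img: "\<kappa> ` V = {..<r + 3}"
  proof (intro subset_antisym subsetI)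
    fix i assume "i \<in> \<kappa> ` V"
    then show "i \<in> {..<r + 3}"
      using fr r2 by (auto simp: \<kappa>_def)
  next
    fix i assume i: "i \<in> {..<r + 3}"
    show "i \<in> \<kappa> ` V"
    proof (cases "i < 5")
      case True
      then have "i \<in> {0, 1, 2, 3, 4}" by auto
      then show ?thesis
        using \<kappa>v vV p0V(1) q0V(1) bas(1,2) by (metis image_eqI insertE singletonD)
    next
      case False
      have "\<exists>w\<in>V - {y}. f w = i - 3"
      proof (rule ccontr)
        assume "\<not> ?thesis"
        then have no: "f w \<noteq> i - 3" if "w \<in> V" "w \<noteq> y" for w
          using that by blast
        have "proper_on V (f(y := i - 3))"
          unfolding proper_on_def
        proof (intro conjI ballI impI)
          fix w assume "w \<in> V"
          then show "(f(y := i - 3)) w < r"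
            using fr i False by auto
        next
          fix a b assume ab: "a \<in> V" "b \<in> V" "(a, b) \<in> E"
          then show "(f(y := i - 3)) a \<noteq> (f(y := i - 3)) b"
            using no[of a] no[of b] proper_onD(2)[OF f(1), of a b] no_loop[of y] by auto
        qed
        then show False
          using E_not_colorable colorable_iff_proper_on by blast
      qed
      then obtain w where w: "w \<in> V" "w \<noteq> y" "f w = i - 3"
        by blast
      moreover have "w \<noteq> z"
        using fz w False by auto
      ultimately have "\<kappa> w = i"
        using False by (simp add: \<kappa>_def)
      then show ?thesis using w by auto
    qed
  qed
  have singles: "{w \<in> V. \<kappa> w = 3} = {y}" "{w \<in> V. \<kappa> w = 4} = {z}"
    using bas by (auto simp: \<kappa>_def split: if_splits)
  define L where "L = lab_graph V \<kappa>"
  have clsL: "nonpartite_class r V L"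
    unfolding L_def by (rule nonpartite_class_lab_graph[OF r2 finV img])
  have h0: "(w, y) \<notin> E" "(w, z) \<notin> E" if "w \<in> V" "w \<noteq> y" "w \<noteq> z" "f w = 0" for w
  proof -
    have "(v, w) \<notin> E"
      using nv[of w] that by auto
    then have *: "E `` {w} = E `` {v}"
      using center_twin[OF c that(1)] that by blast
    have "y \<notin> E `` {w}" "z \<notin> E `` {w}"
      unfolding * by (rule bas(6), rule bas(7))
    then show "(w, y) \<notin> E" "(w, z) \<notin> E"
      by simp_all
  qed
  have EL: "lab_adj (\<kappa> a) (\<kappa> b)" if ab: "(a, b) \<in> E" "a \<notin> C" "b \<notin> C" for a b
  proof -
    note abV = edgeD[OF ab(1)]
    have fab: "f a \<noteq> f b" if "a \<noteq> y" "b \<noteq> y"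
      using proper_onD(2)[OF f(1), of a b] abV ab(1) that by auto
    have y1: "lab_adj 3 (\<kappa> w)" if w: "w \<in> V" "w \<noteq> y" "(w, y) \<in> E" "w \<notin> C" for w
      using h0[of w] w by (auto simp: \<kappa>_def lab_adj_def C_def)
    have z1: "lab_adj 4 (\<kappa> w)" if w: "w \<in> V" "w \<noteq> z" "(w, z) \<in> E" for w
      using h0[of w] w by (auto simp: \<kappa>_def lab_adj_def)
    consider "a = y" | "b = y" | "a = z" | "b = z" | "a \<noteq> y" "b \<noteq> y" "a \<noteq> z" "b \<noteq> z"
      by blast
    then show ?thesis
    proof cases
      case 5
      then show ?thesis
        using fab by (auto simp: \<kappa>_def lab_adj_def)
    qed (use y1[of a] y1[of b] z1[of a] z1[of b] abV ab lab_adj_sym \<kappa>v in auto)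
  qed
  show ?thesis
  proof (cases "C = {}")
    case True
    then have "E \<subseteq> L"
      using EL edgeD by (auto simp: L_def lab_graph_def)
    then have "L = E"
      using edge_maximal clsL by (auto simp: nonpartite_class_def)
    then show ?thesis
      using img singles L_def by blast
  next
    case False
    then obtain c0 where c0: "c0 \<in> C" by blast
    have Cn: "w \<in> V" "(w, y) \<in> E" "(w, z) \<in> E" "(w, p0) \<notin> E" "(w, q0) \<notin> E" "w \<noteq> p0" if "w \<in> C" for w
    proof -
      show w: "w \<in> V" "(w, y) \<in> E" "(w, z) \<in> E"
        using that by (auto simp: C_def)
      show "w \<noteq> p0"
        using w p0(2) by auto
      show "(w, p0) \<notin> E"
        using that np[of w] edgeD(3)[of w p0] by (auto simp: C_def)
      show "(w, q0) \<notin> E"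
        using that nq[OF w(1)] edgeD(3)[of w q0] by (auto simp: C_def)
    qed
    \<comment> \<open>Without \<open>p0\<close> the vertex \<open>q0\<close> would still miss both
      \<open>c0\<close> and \<open>z\<close>. Since \<open>q0\<close> is not adjacent to
      \<open>p0\<close>, rigidity would give both of them the colour of \<open>q0\<close>, although
      \<open>c0\<close> and \<open>z\<close> are adjacent.\<close>
    have p0_noncritical: "\<not> colorable r (V - {p0}) E"
    proof
      assume "colorable r (V - {p0}) E"
      then obtain h where h: "proper_on (V - {p0}) h"
        by (auto simp: colorable_iff_proper_on)
      have ne: "q0 \<noteq> p0"
        using q0(2) zp0 by auto
      have "(q0, p0) \<notin> E"
        using pq edgeD(3) by blast
      then have nqh: "(q0, w) \<in> E \<longleftrightarrow> w \<in> V \<and> w \<noteq> p0 \<and> h w \<noteq> h q0" for w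
        using critical_nbr_iff[OF p0V(1) q0V(1) ne _ h] by simp
      have "c0 \<in> V - {p0}" "z \<in> V - {p0}"
        using Cn[OF c0] bas p0V by auto
      moreover from this have "h c0 = h q0" "h z = h q0"
        using nqh[of c0] nqh[of z] Cn(5)[OF c0] q0(2) edgeD(3)[of q0 c0] by auto
      ultimately show False
        using proper_onD(2)[OF h, of c0 z] Cn(3)[OF c0] by auto
    qed
    have yp0: "y \<notin> E `` {p0}"
      using np[of y] by auto
    have yc0: "y \<in> E `` {c0}"
      using Cn(2)[OF c0] by simp
    have less: "x c0 < x p0"
    proof (rule ccontr)
      assume "\<not> x c0 < x p0"
      then have "E `` {p0} = E `` {c0}"
        using Cn(1,4)[OF c0] edgeD(3)[of p0 c0] by (intro twins[OF p0V(1) _ _ _ p0_noncritical]) auto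
      then show False
        using yp0 yc0 by simp
    qed
    have "colorable r (V - {c0}) E"
    proof (rule ccontr)
      assume "\<not> ?thesis"
      then have "E `` {c0} = E `` {p0}"
        using Cn(1,4)[OF c0] less p0V(1) by (intro twins) auto
      then show False
        using yp0 yc0 by simp
    qed
    then obtain h where h: "proper_on (V - {c0}) h"
      by (auto simp: colorable_iff_proper_on)
    have "p0 \<noteq> c0" "(p0, c0) \<notin> E"
      using Cn(4,6)[OF c0] edgeD(3)[of p0 c0] by auto
    then have nph: "(p0, w) \<in> E \<longleftrightarrow> w \<in> V \<and> w \<noteq> c0 \<and> h w \<noteq> h p0" for w
      using critical_nbr_iff[OF Cn(1)[OF c0] p0V(1) _ _ h] by simp
    \<comment> \<open>Now \<open>c0\<close> is critical and not adjacent to \<open>p0\<close>. A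
      second vertex of \<open>C\<close> and \<open>y\<close> both miss \<open>p0\<close>, so they
      would share its colour; but they are adjacent.\<close>
    have C1: "C = {c0}"
    proof (rule ccontr)
      assume "C \<noteq> {c0}"
      then obtain c1 where c1: "c1 \<in> C" "c1 \<noteq> c0"
        using c0 by blast
      have "y \<noteq> c0"
        using c0 by (auto simp: C_def)
      then have "h y = h p0" "h c1 = h p0"
        using yp0 nph[of y] nph[of c1] bas(1) Cn(1)[OF c1(1)] Cn(4)[OF c1(1)] edgeD(3)[of p0 c1] c1(2)
        by auto
      then show False
        using proper_onD(2)[OF h, of c1 y] Cn(1,2)[OF c1(1)] c1(2) bas(1) \<open>y \<noteq> c0\<close> by auto
    qed
    define F where "F = reattach E c0 (E `` {p0})"
    have c0p: "c0 \<notin> E `` {p0}"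
      using Cn(4)[OF c0] edgeD(3)[of p0 c0] by auto
    have "c0 \<noteq> z"
      using Cn(3)[OF c0] no_loop by auto
    then have \<kappa>c: "\<kappa> c0 = 1"
      using c0 by (auto simp: C_def \<kappa>_def)
    have p1: "lab_adj 1 (\<kappa> w)" "w \<in> V" if "w \<in> E `` {p0}" for w
      using that np[of w] fz by (auto simp: \<kappa>_def lab_adj_def)
    have "F \<subseteq> L"
    proof safe
      fix a b assume "(a, b) \<in> F"
      then consider "a \<noteq> c0" "b \<noteq> c0" "(a, b) \<in> E" | "a = c0" "b \<in> E `` {p0}" | "b = c0" "a \<in> E `` {p0}"
        by (auto simp: F_def reattach_def)
      then show "(a, b) \<in> L"
      proof cases
        case 1
        then show ?thesis
          using EL[of a b] C1 edgeD[of a b] by (auto simp: L_def lab_graph_def)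
      next
        case 2
        then show ?thesis
          using p1[of b] \<kappa>c Cn(1)[OF c0] by (auto simp: L_def lab_graph_def)
      next
        case 3
        then show ?thesis
          using p1[of a] \<kappa>c Cn(1)[OF c0] lab_adj_sym[of 1 "\<kappa> a"] by (auto simp: L_def lab_graph_def)
      qed
    qed
    moreover have Ls: "simple_graph V L"
      using clsL by (simp add: nonpartite_class_def)
    ultimately have "quad F x \<le> quad L x"
      using simple_graphD(5)[OF Ls] simple_graph_edgeD[OF Ls] x_pos
      by (intro quad_mono) (auto intro: less_imp_le)
    moreover have "quad F x = quad E x + 2 * x c0 * (lam * x p0 - lam * x c0)"
      unfolding F_def quad_reattach[OF E_simple Cn(1)[OF c0] nbrs_subset c0p]
      using eigen[OF p0V(1)] eigen[OF Cn(1)[OF c0]] by simp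
    moreover have "0 < 2 * x c0 * (lam * x p0 - lam * x c0)"
      using x_pos[OF Cn(1)[OF c0]] lam_pos less by simp
    ultimately show ?thesis
      using quad_le[OF clsL] by linarith
  qed
qed

theorem lab_graph_structure:
  obtains \<kappa> where "\<kappa> ` V = {..<r + 3}" "card {w \<in> V. \<kappa> w = 3} = 1" "card {w \<in> V. \<kappa> w = 4} = 1"
    "E = lab_graph V \<kappa>"
proof -
  obtain v y z where c: "center v y z"
    using center_exists by blast
  have "\<exists>p q. p \<in> E `` {v} \<and> (p, y) \<notin> E \<and> q \<in> E `` {v} \<and> (q, z) \<notin> E \<and> (p, q) \<notin> E"
  proof (rule ccontr)
    assume "\<not> ?thesis"
    then have *: "(p, q) \<in> E" if "p \<in> E `` {v}" "q \<in> E `` {v}" "(p, y) \<notin> E" "(q, z) \<notin> E" for p q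
      using that by blast
    have "x y < x z"
      using center_weight_less[OF c *] .
    moreover have "x z < x y"
      using center_weight_less[OF center_sym[OF c] edgeD(3)[OF *]] .
    ultimately show False by simp
  qed
  then obtain p q where "p \<in> E `` {v}" "(p, y) \<notin> E" "q \<in> E `` {v}" "(q, z) \<notin> E" "(p, q) \<notin> E"
    by blast
  from center_lab_graph[OF c this] obtain \<kappa> where \<kappa>: "\<kappa> ` V = {..<r + 3}" "{w \<in> V. \<kappa> w = 3} = {y}"
    "{w \<in> V. \<kappa> w = 4} = {z}" "E = lab_graph V \<kappa>"
    by blast
  show ?thesis
    by (rule that[OF \<kappa>(1) _ _ \<kappa>(4)]) (simp_all add: \<kappa>(2,3))
qed

end

subsection \<open>Class sizes\<close>

definition label_count :: "'a set \<Rightarrow> ('a \<Rightarrow> nat) \<Rightarrow> nat \<Rightarrow> nat" where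
  "label_count V \<kappa> i = card {w \<in> V. \<kappa> w = i}"

lemma sum_by_label:
  fixes h :: "nat \<Rightarrow> real"
  assumes "finite V" "\<kappa> ` V \<subseteq> {..<k}"
  shows "(\<Sum>w\<in>V. h (\<kappa> w)) = (\<Sum>i<k. real (label_count V \<kappa> i) * h i)"
proof -
  have "(\<Sum>w\<in>V. h (\<kappa> w)) = (\<Sum>i<k. \<Sum>w | w \<in> V \<and> \<kappa> w = i. h (\<kappa> w))"
    using assms by (intro sum.group[symmetric]) auto
  also have "\<dots> = (\<Sum>i<k. real (label_count V \<kappa> i) * h i)"
    by (intro sum.cong) (auto simp: label_count_def)
  finally show ?thesis .
qed

lemma sum_nbrs_lab_graph:
  fixes \<xi> :: "nat \<Rightarrow> real"
  assumes "finite V" "\<kappa> ` V \<subseteq> {..<k}" "u \<in> V"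
  shows "(\<Sum>w\<in>lab_graph V \<kappa> `` {u}. \<xi> (\<kappa> w)) =
    (\<Sum>j<k. if lab_adj (\<kappa> u) j then real (label_count V \<kappa> j) * \<xi> j else 0)"
proof -
  have "lab_graph V \<kappa> `` {u} = {w \<in> V. lab_adj (\<kappa> u) (\<kappa> w)}"
    using assms by (auto simp: lab_graph_def)
  then have "(\<Sum>w\<in>lab_graph V \<kappa> `` {u}. \<xi> (\<kappa> w)) = (\<Sum>w\<in>V. if lab_adj (\<kappa> u) (\<kappa> w) then \<xi> (\<kappa> w) else 0)"
    using assms(1) by (simp add: sum.inter_filter)
  also have "\<dots> = (\<Sum>j<k. real (label_count V \<kappa> j) * (if lab_adj (\<kappa> u) j then \<xi> j else 0))"
    by (rule sum_by_label[OF assms(1,2)])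
  finally show ?thesis
    by (simp add: if_distrib cong: if_cong)
qed

text \<open>For vectors constant on the label classes the form reduces to the quotient on
  \<open>r + 3\<close> labels, weighted by class sizes.\<close>

lemma quad_lab_graph:
  fixes \<xi> :: "nat \<Rightarrow> real"
  assumes "finite V" "\<kappa> ` V \<subseteq> {..<k}"
  shows "quad (lab_graph V \<kappa>) (\<xi> \<circ> \<kappa>) = (\<Sum>i<k. real (label_count V \<kappa> i) *
    (\<xi> i * (\<Sum>j<k. if lab_adj i j then real (label_count V \<kappa> j) * \<xi> j else 0)))"
proof -
  have "quad (lab_graph V \<kappa>) (\<xi> \<circ> \<kappa>) =
      (\<Sum>u\<in>V. \<xi> (\<kappa> u) * (\<Sum>w\<in>lab_graph V \<kappa> `` {u}. \<xi> (\<kappa> w)))"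
    using assms(1) by (subst quad_conv_sum[of V]) (auto simp: lab_graph_def)
  also have "\<dots> = (\<Sum>u\<in>V. \<xi> (\<kappa> u) * (\<Sum>j<k. if lab_adj (\<kappa> u) j then real (label_count V \<kappa> j) * \<xi> j else 0))"
    using sum_nbrs_lab_graph[OF assms] by (intro sum.cong) auto
  also have "\<dots> = (\<Sum>i<k. real (label_count V \<kappa> i) *
    (\<xi> i * (\<Sum>j<k. if lab_adj i j then real (label_count V \<kappa> j) * \<xi> j else 0)))"
    by (rule sum_by_label[OF assms])
  finally show ?thesis .
qed

lemma sum_lessThan_split5:
  fixes g :: "nat \<Rightarrow> real"
  assumes "2 \<le> r"
  shows "(\<Sum>j<r + 3. g j) = g 0 + g 1 + g 2 + g 3 + g 4 + (\<Sum>j = 5..<r + 3. g j)"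
proof -
  have "{..<r + 3} = {..<5} \<union> {5..<r + 3}"
    using assms by auto
  then have "(\<Sum>j<r + 3. g j) = (\<Sum>j<5. g j) + (\<Sum>j = 5..<r + 3. g j)"
    by (metis finite_atLeastLessThan finite_lessThan ivl_disj_int_one(2) sum.union_disjoint)
  moreover have "(\<Sum>j<5. g j) = g 0 + g 1 + g 2 + g 3 + g 4"
    by (simp add: eval_nat_numeral lessThan_Suc ac_simps)
  ultimately show ?thesis by simp
qed

lemma lab_adj_core [simp]:
  "lab_adj 0 1" "lab_adj 0 2" "lab_adj 1 0" "lab_adj 1 4" "lab_adj 2 0" "lab_adj 2 3" "lab_adj 3 2"
  "lab_adj 3 4" "lab_adj 4 1" "lab_adj 4 3"
  "\<not> lab_adj 0 3" "\<not> lab_adj 0 4" "\<not> lab_adj 1 2" "\<not> lab_adj 1 3" "\<not> lab_adj 2 1" "\<not> lab_adj 2 4"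
  "\<not> lab_adj 3 0" "\<not> lab_adj 3 1" "\<not> lab_adj 4 0" "\<not> lab_adj 4 2"
  by (simp_all add: lab_adj_def)

lemma lab_adj_core_Suc [simp]: "lab_adj 0 (Suc 0)" "lab_adj (Suc 0) 0" "lab_adj (Suc 0) 4"
  "lab_adj 4 (Suc 0)" "\<not> lab_adj (Suc 0) 2" "\<not> lab_adj 2 (Suc 0)" "\<not> lab_adj (Suc 0) 3" "\<not> lab_adj 3 (Suc 0)"
  by (simp_all add: lab_adj_def)

lemma lab_adj_part: "5 \<le> j \<Longrightarrow> lab_adj i j \<longleftrightarrow> i \<noteq> j" "5 \<le> j \<Longrightarrow> lab_adj j i \<longleftrightarrow> i \<noteq> j"
  by (auto simp: lab_adj_def)

lemma label_sum_core:
  fixes g :: "nat \<Rightarrow> real"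
  assumes "2 \<le> r"
  defines "R \<equiv> \<Sum>j = 5..<r + 3. g j"
  shows "(\<Sum>j<r + 3. if lab_adj 0 j then g j else 0) = R + g 1 + g 2"
    "(\<Sum>j<r + 3. if lab_adj 1 j then g j else 0) = R + g 0 + g 4"
    "(\<Sum>j<r + 3. if lab_adj 2 j then g j else 0) = R + g 0 + g 3"
    "(\<Sum>j<r + 3. if lab_adj 3 j then g j else 0) = R + g 2 + g 4"
    "(\<Sum>j<r + 3. if lab_adj 4 j then g j else 0) = R + g 1 + g 3"
proof -
  have R: "(\<Sum>j = 5..<r + 3. if lab_adj i j then g j else 0) = R" if "i < 5" for i
    unfolding R_def using that by (intro sum.cong) (auto simp: lab_adj_part)
  show "(\<Sum>j<r + 3. if lab_adj 0 j then g j else 0) = R + g 1 + g 2"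
    "(\<Sum>j<r + 3. if lab_adj 1 j then g j else 0) = R + g 0 + g 4"
    "(\<Sum>j<r + 3. if lab_adj 2 j then g j else 0) = R + g 0 + g 3"
    "(\<Sum>j<r + 3. if lab_adj 3 j then g j else 0) = R + g 2 + g 4"
    "(\<Sum>j<r + 3. if lab_adj 4 j then g j else 0) = R + g 1 + g 3"
    using R by (simp_all add: sum_lessThan_split5[OF assms(1)] del: One_nat_def)
qed

lemma label_sum_part:
  fixes g :: "nat \<Rightarrow> real"
  assumes "5 \<le> i" "i < k"
  shows "(\<Sum>j<k. if lab_adj i j then g j else 0) = (\<Sum>j<k. g j) - g i"
proof -
  have "(\<Sum>j<k. if lab_adj i j then g j else 0) = (\<Sum>j<k. g j - (if j = i then g i else 0))"
    using assms by (intro sum.cong) (auto simp: lab_adj_part)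
  then show ?thesis
    using assms by (simp add: sum_subtractf)
qed

lemma lab_graph_permute:
  assumes "\<And>i j. lab_adj (\<sigma> i) (\<sigma> j) = lab_adj i j"
  shows "lab_graph V (\<sigma> \<circ> \<kappa>) = lab_graph V \<kappa>"
  using assms by (simp add: lab_graph_def)

text \<open>The reflection of the pentagon through label 3; \<open>reflect_B\<close> is the one
  through label 0. They supply the two "without loss of generality" steps on the class
  sizes.\<close>

definition reflect_y :: "nat \<Rightarrow> nat" where
  "reflect_y i = (if i = 0 then 1 else if i = 1 then 0 else if i = 2 then 4 else if i = 4 then 2 else i)"

definition reflect_B :: "nat \<Rightarrow> nat" where
  "reflect_B i = (if i = 1 then 2 else if i = 2 then 1 else if i = 3 then 4 else if i = 4 then 3 else i)"

lemma reflect_adj: "lab_adj (reflect_y i) (reflect_y j) = lab_adj i j"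
  "lab_adj (reflect_B i) (reflect_B j) = lab_adj i j"
  by (auto simp: lab_adj_def reflect_y_def reflect_B_def)

lemma reflect_involution [simp]: "reflect_y (reflect_y i) = i" "reflect_B (reflect_B i) = i"
  by (auto simp: reflect_y_def reflect_B_def)

lemma image_involution:
  assumes "\<kappa> ` V = {..<k}" "\<And>i. \<sigma> (\<sigma> i) = i" "\<And>i. i < k \<Longrightarrow> \<sigma> i < (k :: nat)"
  shows "(\<sigma> \<circ> \<kappa>) ` V = {..<k}"
proof -
  have *: "\<sigma> ` {..<k} = {..<k}"
    using assms(2,3) by (auto intro!: image_eqI[where x = "\<sigma> _"])
  show ?thesis
    by (simp only: image_comp[symmetric] assms(1) *)
qed

lemma label_count_involution:
  assumes "\<And>i. \<sigma> (\<sigma> i) = i"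
  shows "label_count V (\<sigma> \<circ> \<kappa>) i = label_count V \<kappa> (\<sigma> i)"
proof -
  have "{w \<in> V. (\<sigma> \<circ> \<kappa>) w = i} = {w \<in> V. \<kappa> w = \<sigma> i}"
    using assms by (auto simp: comp_def)
  then show ?thesis
    by (simp add: label_count_def)
qed

section \<open>Eigenvalue equations on labels and the effect of moving a vertex\<close>

locale lab_extremal = extremal +
  fixes \<kappa> :: "'a \<Rightarrow> nat"
  assumes img: "\<kappa> ` V = {..<r + 3}"
    and E_lab: "E = lab_graph V \<kappa>"
begin

abbreviation N :: "nat \<Rightarrow> nat" where
  "N i \<equiv> label_count V \<kappa> i"

lemma label_lt: "w \<in> V \<Longrightarrow> \<kappa> w < r + 3"
  using img by auto

lemma img_sub: "\<kappa> ` V \<subseteq> {..<r + 3}"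
  using img by simp

lemma N_pos: "i < r + 3 \<Longrightarrow> 1 \<le> N i"
proof -
  assume "i < r + 3"
  then obtain w where "w \<in> V" "\<kappa> w = i"
    using img by (metis imageE lessThan_iff)
  then have "{w \<in> V. \<kappa> w = i} \<noteq> {}" by auto
  then show ?thesis
    using finV by (simp add: label_count_def Suc_le_eq card_gt_0_iff)
qed

lemma label_rep:
  assumes "i < r + 3"
  obtains w where "w \<in> V" "\<kappa> w = i"
  using assms img by (metis imageE lessThan_iff)

lemma label_rep2:
  assumes "2 \<le> N i"
  obtains u w where "u \<in> V" "\<kappa> u = i" "w \<in> V" "\<kappa> w = i" "u \<noteq> w"
proof -
  obtain T where "T \<subseteq> {w \<in> V. \<kappa> w = i}" "card T = 2"
    using assms obtain_subset_with_card_n[of 2 "{w \<in> V. \<kappa> w = i}"] by (auto simp: label_count_def)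
  then show ?thesis
    using that by (auto simp: card_2_iff)
qed

lemma nbrs_lab: "u \<in> V \<Longrightarrow> E `` {u} = {w \<in> V. lab_adj (\<kappa> u) (\<kappa> w)}"
  by (auto simp: E_lab lab_graph_def)

lemma x_const:
  assumes "u \<in> V" "w \<in> V" "\<kappa> u = \<kappa> w"
  shows "x u = x w"
proof -
  have "E `` {u} = E `` {w}"
    using assms by (simp add: nbrs_lab)
  then have "lam * x u = lam * x w"
    using eigen assms(1,2) by metis
  then show ?thesis
    using lam_pos by simp
qed

lemma img_minus:
  assumes "t' \<in> V" "t' \<noteq> t" "\<kappa> t' = \<kappa> t"
  shows "\<kappa> ` (V - {t}) = {..<r + 3}"
proof -
  have "\<kappa> w \<in> \<kappa> ` (V - {t})" if "w \<in> V" for w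
    using assms that by (cases "w = t") (auto intro: image_eqI[of _ \<kappa> t'])
  then show ?thesis
    unfolding img[symmetric] by blast
qed

definition \<xi> :: "nat \<Rightarrow> real" where
  "\<xi> i = x (SOME w. w \<in> V \<and> \<kappa> w = i)"

lemma x_eq: "w \<in> V \<Longrightarrow> x w = \<xi> (\<kappa> w)"
  unfolding \<xi>_def by (rule x_const) (use someI[of "\<lambda>u. u \<in> V \<and> \<kappa> u = \<kappa> w" w] in auto)

lemma xi_pos: "i < r + 3 \<Longrightarrow> 0 < \<xi> i"
  using label_rep x_eq x_pos by metis

lemma weight_nonneg: "i < r + 3 \<Longrightarrow> 0 \<le> real (N i) * \<xi> i"
  using xi_pos[of i] by simp

lemma xi_eigen:
  assumes "i < r + 3"
  shows "lam * \<xi> i = (\<Sum>j<r + 3. if lab_adj i j then real (N j) * \<xi> j else 0)"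
proof -
  obtain u where u: "u \<in> V" "\<kappa> u = i"
    using label_rep[OF assms] .
  have "lam * \<xi> i = sum x (E `` {u})"
    using eigen[OF u(1)] x_eq[OF u(1)] u(2) by simp
  also have "\<dots> = (\<Sum>w\<in>lab_graph V \<kappa> `` {u}. \<xi> (\<kappa> w))"
    using nbrs_subset[of u] x_eq by (intro sum.cong) (auto simp: E_lab)
  also have "\<dots> = (\<Sum>j<r + 3. if lab_adj i j then real (N j) * \<xi> j else 0)"
    using sum_nbrs_lab_graph[OF finV img_sub u(1)] u(2) by simp
  finally show ?thesis .
qed

definition R :: real where
  "R = (\<Sum>j = 5..<r + 3. real (N j) * \<xi> j)"

definition S :: real where
  "S = (\<Sum>j<r + 3. real (N j) * \<xi> j)"

lemma S_eq: "S = R + real (N 0) * \<xi> 0 + real (N 1) * \<xi> 1 + real (N 2) * \<xi> 2 + real (N 3) * \<xi> 3 + real (N 4) * \<xi> 4"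
  unfolding S_def R_def using sum_lessThan_split5[OF r2, of "\<lambda>j. real (N j) * \<xi> j"] by simp

lemma core_eigen:
  "lam * \<xi> 0 = R + real (N 1) * \<xi> 1 + real (N 2) * \<xi> 2"
  "lam * \<xi> 1 = R + real (N 0) * \<xi> 0 + real (N 4) * \<xi> 4"
  "lam * \<xi> 2 = R + real (N 0) * \<xi> 0 + real (N 3) * \<xi> 3"
  "lam * \<xi> 3 = R + real (N 2) * \<xi> 2 + real (N 4) * \<xi> 4"
  "lam * \<xi> 4 = R + real (N 1) * \<xi> 1 + real (N 3) * \<xi> 3"
  using r2 label_sum_core[OF r2, of "\<lambda>j. real (N j) * \<xi> j"] unfolding R_def
  by (subst xi_eigen; simp)+

lemma part_eigen: "5 \<le> i \<Longrightarrow> i < r + 3 \<Longrightarrow> lam * \<xi> i = S - real (N i) * \<xi> i"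
  using xi_eigen[of i] label_sum_part[of i "r + 3" "\<lambda>j. real (N j) * \<xi> j"] by (simp add: S_def)

lemma part_le_R: "5 \<le> i \<Longrightarrow> i < r + 3 \<Longrightarrow> real (N i) * \<xi> i \<le> R"
  unfolding R_def by (intro member_le_sum) (auto intro: weight_nonneg)

lemma two_parts_le_R:
  assumes "5 \<le> i" "i < r + 3" "5 \<le> j" "j < r + 3" "i \<noteq> j"
  shows "real (N i) * \<xi> i + real (N j) * \<xi> j \<le> R"
proof -
  have "(\<Sum>l\<in>{i, j}. real (N l) * \<xi> l) \<le> R"
    unfolding R_def using assms by (intro sum_mono2) (auto intro: weight_nonneg)
  then show ?thesis
    using assms by simp
qed

lemma R_nonneg: "0 \<le> R"
  unfolding R_def by (intro sum_nonneg) (auto intro: weight_nonneg)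

text \<open>After the move \<open>t\<close> has the neighbours of class \<open>i\<close> except
  itself: it used to be one of them, and it is not its own neighbour. This lost \<open>x t\<close>
  turns the factor \<open>lam\<close> into \<open>lam + 1\<close>. For the same reason each old
  vertex of class \<open>i\<close> loses \<open>t\<close> as a neighbour.\<close>

lemma quad_move:
  assumes t: "t \<in> V" and i: "i < r + 3" and adj: "lab_adj i (\<kappa> t)"
  shows "quad (lab_graph V (\<kappa>(t := i))) x = quad E x + 2 * x t * (lam * \<xi> i - (lam + 1) * \<xi> (\<kappa> t))"
    and "u \<in> V \<Longrightarrow> \<kappa> u = i \<Longrightarrow> sum x (lab_graph V (\<kappa>(t := i)) `` {u}) = lam * x u - x t"
proof -
  define Z where "Z = {w \<in> V. w \<noteq> t \<and> lab_adj i (\<kappa> w)}"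
  have F: "lab_graph V (\<kappa>(t := i)) = reattach E t Z"
    unfolding E_lab Z_def by (rule lab_graph_fun_upd[OF t])
  have finZ: "finite Z" "t \<notin> Z" "Z \<subseteq> V"
    using finV by (auto simp: Z_def)
  have Eu: "E `` {u} = insert t Z" if "u \<in> V" "\<kappa> u = i" for u
    using adj t that by (auto simp: nbrs_lab Z_def)
  have sZ: "sum x Z = lam * x u - x t" if u: "u \<in> V" "\<kappa> u = i" for u
    using eigen[OF u(1)] Eu[OF u] finZ by simp
  obtain u0 where u0: "u0 \<in> V" "\<kappa> u0 = i"
    using label_rep[OF i] .
  have sZ': "sum x Z = lam * \<xi> i - \<xi> (\<kappa> t)"
    using sZ[OF u0] x_eq[OF t] x_eq[OF u0(1)] u0(2) by simp
  have sE: "sum x (E `` {t}) = lam * \<xi> (\<kappa> t)"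
    using eigen[OF t] x_eq[OF t] by simp
  show "quad (lab_graph V (\<kappa>(t := i))) x = quad E x + 2 * x t * (lam * \<xi> i - (lam + 1) * \<xi> (\<kappa> t))"
    unfolding F quad_reattach[OF E_simple t finZ(3,2)] sZ' sE by (simp add: algebra_simps)
  assume u: "u \<in> V" "\<kappa> u = i"
  have "u \<noteq> t" using adj u by auto
  then have "reattach E t Z `` {u} = Z"
    using Eu[OF u] finZ(2) u by (auto simp: reattach_def Z_def)
  then show "sum x (lab_graph V (\<kappa>(t := i)) `` {u}) = lam * x u - x t"
    unfolding F using sZ[OF u] by simp
qed

text \<open>A class of size at least two survives the loss of a vertex, so the new graph is still in
  the class and the form cannot rise. Nor can it stay equal: \<open>x\<close> would then satisfy the
  row of an old vertex of class \<open>i\<close>, which has just lost the weight of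
  \<open>t\<close>.\<close>

lemma move_vertex:
  assumes j: "2 \<le> N j" and i: "i < r + 3" and adj: "lab_adj i j"
  shows "lam * \<xi> i < (lam + 1) * \<xi> j"
proof (rule ccontr)
  assume *: "\<not> ?thesis"
  obtain t t' where t: "t \<in> V" "\<kappa> t = j" "t' \<in> V" "\<kappa> t' = j" "t \<noteq> t'"
    using label_rep2[OF j] .
  obtain u where u: "u \<in> V" "\<kappa> u = i"
    using label_rep[OF i] .
  define F where "F = lab_graph V (\<kappa>(t := i))"
  have "(\<kappa>(t := i)) ` V = insert i (\<kappa> ` (V - {t}))"
    using t(1) by auto
  then have "(\<kappa>(t := i)) ` V = {..<r + 3}"
    using img_minus[of t' t] t i by auto
  then have cls: "nonpartite_class r V F"
    unfolding F_def by (rule nonpartite_class_lab_graph[OF r2 finV])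
  note move = quad_move[OF t(1) i, unfolded t(2), OF adj, folded F_def]
  have "0 \<le> 2 * x t * (lam * \<xi> i - (lam + 1) * \<xi> j)"
    using * x_pos[OF t(1)] by simp
  then have "sum x (F `` {u}) = lam * x u"
    using move(1) by (intro eigen_of_quad_ge[OF cls _ u(1)]) linarith
  then show False
    using move(2)[OF u] x_pos[OF t(1)] by simp
qed

text \<open>Grouped by labels, the sum is the form minus \<open>lam\<close> times the squared norm
  at the vector \<open>\<eta> \<circ> \<kappa>'\<close>. For nonnegative \<open>\<eta>\<close> it is
  enough that every row of the new graph is at least \<open>lam * \<eta> i\<close>, strictly at some
  occupied label with \<open>0 < \<eta> i\<close>.\<close>

lemma supersolution_contradiction:
  fixes \<eta> :: "nat \<Rightarrow> real"
  assumes img': "\<kappa>' ` V = {..<r + 3}"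
    and gt: "(\<Sum>i<r + 3. real (label_count V \<kappa>' i) * (\<eta> i * ((\<Sum>j<r + 3. if lab_adj i j then
      real (label_count V \<kappa>' j) * \<eta> j else 0) - lam * \<eta> i))) > 0"
  shows False
proof -
  have sub: "\<kappa>' ` V \<subseteq> {..<r + 3}"
    using img' by simp
  have cls: "nonpartite_class r V (lab_graph V \<kappa>')"
    by (rule nonpartite_class_lab_graph[OF r2 finV img'])
  have "(\<Sum>u\<in>V. ((\<eta> \<circ> \<kappa>') u)\<^sup>2) = (\<Sum>i<r + 3. real (label_count V \<kappa>' i) * (\<eta> i)\<^sup>2)"
    using sum_by_label[OF finV sub, of "\<lambda>i. (\<eta> i)\<^sup>2"] by (simp add: comp_def)
  then have "quad (lab_graph V \<kappa>') (\<eta> \<circ> \<kappa>') \<le> lam * (\<Sum>i<r + 3. real (label_count V \<kappa>' i) * (\<eta> i)\<^sup>2)"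
    using quad_bound[OF cls, of "\<eta> \<circ> \<kappa>'"] by simp
  then show False
    using gt unfolding quad_lab_graph[OF finV sub]
    by (simp add: sum_distrib_left right_diff_distrib sum_subtractf power2_eq_square mult.left_commute)
qed

lemma reflected:
  assumes "\<And>i. \<sigma> (\<sigma> i) = i" "\<And>i j. lab_adj (\<sigma> i) (\<sigma> j) = lab_adj i j" "\<And>i. i < r + 3 \<Longrightarrow> \<sigma> i < r + 3"
  shows "lab_extremal V E x lam r (\<sigma> \<circ> \<kappa>)"
proof
  show "(\<sigma> \<circ> \<kappa>) ` V = {..<r + 3}"
    by (rule image_involution[OF img assms(1,3)])
  show "E = lab_graph V (\<sigma> \<circ> \<kappa>)"
    using lab_graph_permute[OF assms(2), of V \<kappa>] E_lab by simp
qed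

text \<open>Deleting a vertex from a class of size at least two leaves all labels occupied, so such
  a vertex is not critical. If the classes 1 and 2 both had this size, symmetrization, in the
  direction given by the weights, would make nonadjacent vertices of these classes twins; but class
  3 is joined only to class 2.\<close>

lemma one_side_single: "N 1 = 1 \<or> N 2 = 1"
proof (rule ccontr)
  assume "\<not> ?thesis"
  then have N12: "2 \<le> N 1" "2 \<le> N 2"
    using N_pos[of 1] N_pos[of 2] by auto
  have noncrit: "\<not> colorable r (V - {t}) E" if t: "t \<in> V" "2 \<le> N (\<kappa> t)" for t
  proof
    assume c: "colorable r (V - {t}) E"
    obtain a b where ab: "a \<in> V" "\<kappa> a = \<kappa> t" "b \<in> V" "\<kappa> b = \<kappa> t" "a \<noteq> b"
      using label_rep2[OF t(2)] .
    then have "\<kappa> ` (V - {t}) = {..<r + 3}"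
      using img_minus[of a t] img_minus[of b t] by (cases "a = t") auto
    then have "\<not> colorable r (V - {t}) (lab_graph (V - {t}) \<kappa>)"
      using nonpartite_class_lab_graph[OF r2, of "V - {t}" \<kappa>] finV by (simp add: nonpartite_class_def)
    moreover have "colorable r (V - {t}) (lab_graph (V - {t}) \<kappa>)"
      by (rule colorable_mono[OF c]) (auto simp: E_lab lab_graph_def)
    ultimately show False by simp
  qed
  obtain p where p: "p \<in> V" "\<kappa> p = 1"
    using label_rep[of 1] by auto
  obtain q where q: "q \<in> V" "\<kappa> q = 2"
    using label_rep[of 2] by auto
  obtain y where y: "y \<in> V" "\<kappa> y = 3"
    using label_rep[of 3] r2 by auto
  have "(p, q) \<notin> E" "(q, p) \<notin> E"
    using p q by (auto simp: E_lab lab_graph_def)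
  then have "E `` {p} = E `` {q}"
    using twins[of p q] twins[of q p] noncrit[of p] noncrit[of q] p q N12 by (cases "x p \<le> x q") auto
  moreover have "y \<in> E `` {q}" "y \<notin> E `` {p}"
    using p q y by (auto simp: nbrs_lab)
  ultimately show False by simp
qed

end

section \<open>Inequalities that decide single-vertex moves\<close>

lemma pentagon_sizes_contradiction:
  fixes lam R b p \<beta> \<pi> a c d :: real
  assumes pos: "0 < lam" "0 \<le> R" "0 < \<beta>" "0 < \<pi>" "0 < a" "0 < c" "0 < d"
    and bp: "1 \<le> p" "p + 2 \<le> b"
    and e0: "lam * \<beta> = R + a + p * \<pi>"
    and e1: "lam * \<pi> = R + d + b * \<beta>"
    and e2: "lam * a = R + c + b * \<beta>"
    and e3: "lam * c = R + a + d"
    and e4: "lam * d = R + c + p * \<pi>"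
    and less: "lam * \<pi> < (lam + 1) * \<beta>"
  shows False
proof -
  \<comment> \<open>The classes 0 and 1 have sizes \<open>b\<close> and \<open>p\<close> and weights
    \<open>\<beta>\<close> and \<open>\<pi>\<close>; \<open>a\<close>, \<open>c\<close>,
    \<open>d\<close> are the weights of the labels 2, 3, 4. Subtracting equations gives
    \<open>lam^2 * (\<pi> - \<beta>) = (lam - 1) * \<Delta>\<close>, so the move condition
    \<open>less\<close> caps \<open>\<Delta>\<close>. With \<open>p + 2 \<le> b\<close> this makes
    \<open>p\<close> and \<open>b\<close> large compared with \<open>lam\<close>, and the equations
    for \<open>a\<close> and \<open>c\<close> then leave an inequality in \<open>lam\<close>
    alone.\<close>
  define \<Delta> where "\<Delta> = b * \<beta> - p * \<pi>"
  have b3: "3 * \<beta> \<le> b * \<beta>"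
    using bp pos by (intro mult_right_mono) auto
  have p1: "\<pi> \<le> p * \<pi>"
    using mult_right_mono[of 1 p \<pi>] bp pos by simp
  have "lam * (lam * \<beta>) \<ge> lam * (a + \<pi>)"
    using e0 p1 pos by (intro mult_left_mono) linarith+
  also have "lam * (a + \<pi>) \<ge> 6 * \<beta>"
    using e1 e2 b3 pos distrib_left[of lam a \<pi>] by linarith
  finally have "(6 - lam\<^sup>2) * \<beta> \<le> 0"
    by (simp add: power2_eq_square algebra_simps)
  then have lam6: "6 \<le> lam\<^sup>2"
    using pos(3) by (simp add: mult_le_0_iff)
  \<comment> \<open>A decimal between \<open>1 + sqrt 2\<close> and \<open>sqrt 6\<close>: the upper
    bound makes it follow from \<open>lam6\<close>, the lower one gives
    \<open>1 < lam * (lam - 2)\<close> at the end.\<close>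
  have lam: "2.42 < lam"
    using lam6 pos(1) power_mono[of lam "2.42" 2] by (auto simp: power2_eq_square not_less[symmetric])
  have 1: "lam * (lam * (\<pi> - \<beta>)) = \<Delta> * (lam - 1)"
  proof -
    have A: "lam * (\<pi> - \<beta>) = (d - a) + \<Delta>"
      using e0 e1 by (simp add: \<Delta>_def algebra_simps)
    have B: "lam * (d - a) = - \<Delta>"
      using e2 e4 by (simp add: \<Delta>_def algebra_simps)
    have "lam * (lam * (\<pi> - \<beta>)) = lam * (d - a) + lam * \<Delta>"
      unfolding A by (rule distrib_left)
    then show ?thesis
      unfolding B by (simp add: algebra_simps)
  qed
  have pi_gt: "\<beta> < \<pi>"
  proof (rule ccontr)
    assume *: "\<not> \<beta> < \<pi>"
    have "p * \<pi> \<le> p * \<beta>"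
      using * bp by (intro mult_left_mono) auto
    moreover have "(p + 2) * \<beta> \<le> b * \<beta>"
      using bp pos by (intro mult_right_mono) auto
    ultimately have "0 < \<Delta>"
      using pos by (simp add: \<Delta>_def distrib_right)
    then have "0 < lam * (lam * (\<pi> - \<beta>))"
      unfolding 1 using lam by simp
    then show False
      using * pos(1) by (simp add: zero_less_mult_iff)
  qed
  have "lam * (lam * (\<pi> - \<beta>)) < lam * \<beta>"
    using less pos(1) by (intro mult_strict_left_mono) (auto simp: algebra_simps)
  then have \<Delta>: "\<Delta> * (lam - 1) < lam * \<beta>"
    unfolding 1 .
  \<comment> \<open>\<open>\<Delta>\<close> is at least
    \<open>2 * \<beta> - p * (\<pi> - \<beta>)\<close>, while \<open>less\<close> bounds both
    \<open>\<Delta>\<close> and \<open>\<pi> - \<beta>\<close> from above; this is possible only for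
    large \<open>p\<close>.\<close>
  have pl: "lam\<^sup>2 - 2 * lam < p * (lam - 1)"
  proof -
    have "(p + 2) * \<beta> \<le> b * \<beta>"
      using bp pos by (intro mult_right_mono) auto
    then have "2 * \<beta> - p * (\<pi> - \<beta>) \<le> \<Delta>"
      by (simp add: \<Delta>_def algebra_simps)
    then have "lam * (2 * \<beta>) - p * (lam * (\<pi> - \<beta>)) \<le> lam * \<Delta>"
      using mult_left_mono[of "2 * \<beta> - p * (\<pi> - \<beta>)" \<Delta> lam] pos(1) by (simp add: algebra_simps)
    moreover have "p * (lam * (\<pi> - \<beta>)) \<le> p * \<beta>"
      using less bp by (intro mult_left_mono) (auto simp: algebra_simps)
    ultimately have "(2 * lam - p) * \<beta> \<le> lam * \<Delta>"
      by (simp add: algebra_simps)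
    then have "(2 * lam - p) * \<beta> * (lam - 1) \<le> lam * \<Delta> * (lam - 1)"
      using lam by (intro mult_right_mono) auto
    also have "\<dots> < lam * (lam * \<beta>)"
      using \<Delta> pos(1) mult_strict_left_mono[of "\<Delta> * (lam - 1)" "lam * \<beta>" lam] by (simp add: algebra_simps)
    finally have "0 < (lam\<^sup>2 - (2 * lam - p) * (lam - 1)) * \<beta>"
      by (simp add: power2_eq_square algebra_simps)
    then have "0 < lam\<^sup>2 - (2 * lam - p) * (lam - 1)"
      by (rule zero_less_mult_pos2[OF _ pos(3)])
    then show ?thesis
      by (simp add: power2_eq_square algebra_simps)
  qed
  have bl: "lam\<^sup>2 - 2 < b * (lam - 1)"
  proof -
    have "(p + 2) * (lam - 1) \<le> b * (lam - 1)"
      using bp lam by (intro mult_right_mono) auto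
    then show ?thesis
      using pl by (simp add: algebra_simps)
  qed
  have 2: "lam * lam * c \<ge> 4 * \<beta>"
  proof -
    have "lam * a \<ge> 3 * \<beta>" "lam * d \<ge> \<beta>"
      using e2 e4 b3 p1 pos pi_gt by linarith+
    moreover have "lam * (lam * c) \<ge> lam * (a + d)"
      using e3 pos by (intro mult_left_mono) auto
    ultimately show ?thesis
      by (simp add: distrib_left)
  qed
  have "(lam - 1) * (a + b * \<beta>) < lam * lam * \<beta>"
  proof -
    have "a + b * \<beta> - \<Delta> \<le> lam * \<beta>"
      using e0 pos(2) by (simp add: \<Delta>_def)
    then have "(lam - 1) * (a + b * \<beta> - \<Delta>) \<le> (lam - 1) * (lam * \<beta>)"
      using lam by (intro mult_left_mono) auto
    then show ?thesis
      using \<Delta> by (simp add: algebra_simps)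
  qed
  then have "lam * ((lam - 1) * (a + b * \<beta>)) < lam * (lam * lam * \<beta>)"
    using pos(1) by (rule mult_strict_left_mono)
  moreover have "(lam - 1) * (c + b * \<beta>) \<le> (lam - 1) * (lam * a)"
    using e2 pos lam by (intro mult_left_mono) auto
  ultimately have 3: "(lam - 1) * c + (lam + 1) * (b * (lam - 1)) * \<beta> < lam * lam * lam * \<beta>"
    by (simp add: algebra_simps)
  moreover have "(lam + 1) * (lam\<^sup>2 - 2) * \<beta> \<le> (lam + 1) * (b * (lam - 1)) * \<beta>"
    using bl pos by (intro mult_right_mono mult_left_mono) auto
  ultimately have "(lam - 1) * c < (2 + 2 * lam - lam\<^sup>2) * \<beta>"
    by (simp add: power2_eq_square algebra_simps)
  then have "lam * lam * ((lam - 1) * c) < lam * lam * ((2 + 2 * lam - lam\<^sup>2) * \<beta>)"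
    using pos(1) by (intro mult_strict_left_mono) auto
  moreover have "(lam - 1) * (4 * \<beta>) \<le> (lam - 1) * (lam * lam * c)"
    using 2 lam by (intro mult_left_mono) auto
  ultimately have "0 < (4 - (lam\<^sup>2 - 2) * (lam * (lam - 2))) * \<beta>"
    by (simp add: power2_eq_square algebra_simps)
  then have "0 < 4 - (lam\<^sup>2 - 2) * (lam * (lam - 2))"
    by (rule zero_less_mult_pos2[OF _ pos(3)])
  moreover have "4 * (lam * (lam - 2)) \<le> (lam\<^sup>2 - 2) * (lam * (lam - 2))"
    using lam6 lam by (intro mult_right_mono) auto
  moreover have "1 < lam * (lam - 2)"
  proof -
    have "1.42 * 1.42 \<le> (lam - 1) * (lam - 1)"
      using lam by (intro mult_mono) auto
    then show ?thesis by (simp add: algebra_simps)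
  qed
  ultimately show False by linarith
qed

text \<open>Moving a vertex from class 0 to a part of size \<open>m \<le> b\<close> pays. For
  \<open>T = lam * (\<gamma> - \<beta>)\<close> the equations of labels 3 and 4 add up to
  \<open>lam * (c + d) = R + lam * \<beta> + c + d\<close>. If \<open>T \<le> \<beta>\<close>, the
  only negative term in \<open>lam * T\<close>, namely \<open>m * T\<close>, is at most
  \<open>m * \<gamma> \<le> R\<close>, so \<open>lam * T\<close> would exceed
  \<open>lam * \<beta>\<close>.\<close>

lemma small_part_weight:
  fixes lam R b p \<beta> \<pi> a c d m \<gamma> :: real
  assumes pos: "0 < lam" "0 < \<beta>" "0 < \<gamma>" "0 < c" "0 < d" "0 < m"
    and R: "m * \<gamma> \<le> R" and mb: "m \<le> b"
    and e0: "lam * \<beta> = R + a + p * \<pi>"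
    and e3: "lam * c = R + a + d"
    and e4: "lam * d = R + c + p * \<pi>"
    and ej: "lam * \<gamma> = R + b * \<beta> + p * \<pi> + a + c + d - m * \<gamma>"
  shows "(lam + 1) * \<beta> < lam * \<gamma>"
proof (rule ccontr)
  assume "\<not> ?thesis"
  then have le: "lam * (\<gamma> - \<beta>) \<le> \<beta>"
    by (simp add: algebra_simps)
  define T where "T = lam * (\<gamma> - \<beta>)"
  have T: "T = b * \<beta> + c + d - m * \<gamma>"
    using e0 ej by (simp add: T_def algebra_simps)
  have gt: "\<beta> < \<gamma>"
  proof (rule ccontr)
    assume *: "\<not> \<beta> < \<gamma>"
    have "m * \<gamma> \<le> m * \<beta>" "m * \<beta> \<le> b * \<beta>"
      using * pos mb by (auto intro!: mult_left_mono mult_right_mono)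
    then have "0 < T"
      using T pos by linarith
    then show False
      using * pos(1) by (simp add: T_def zero_less_mult_iff)
  qed
  have "lam * (b * \<beta> + c + d - m * \<gamma>) = lam * ((b - m) * \<beta>) + lam * (c + d) - m * (lam * (\<gamma> - \<beta>))"
    by (simp add: algebra_simps)
  then have "lam * T = lam * ((b - m) * \<beta>) + lam * (c + d) - m * T"
    by (simp only: T_def[symmetric] T[symmetric])
  moreover have "0 \<le> lam * ((b - m) * \<beta>)"
    using pos mb by simp
  moreover have "lam * (c + d) = R + lam * \<beta> + c + d"
    using e0 e3 e4 by (simp add: algebra_simps)
  moreover have "m * T \<le> m * \<beta>" "m * \<beta> \<le> m * \<gamma>"
    using le gt pos by (auto simp: T_def)
  ultimately have "lam * \<beta> < lam * T"
    using R pos by linarith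
  then show False
    using le pos(1) by (simp add: T_def)
qed

text \<open>Both products \<open>(lam + m) * \<gamma>\<close> and
  \<open>(lam + m') * \<gamma>'\<close> equal \<open>S\<close>, so the smaller part has the heavier
  vertices. The weak conclusion suffices because \<open>move_vertex\<close> is strict.\<close>

lemma balanced_part_weight:
  fixes lam S m m' \<gamma> \<gamma>' :: real
  assumes pos: "0 < lam" "0 < \<gamma>" "0 < \<gamma>'" "0 < m'" and mm: "m' + 2 \<le> m"
    and S: "m * \<gamma> + m' * \<gamma>' \<le> S"
    and ej: "lam * \<gamma> = S - m * \<gamma>" "lam * \<gamma>' = S - m' * \<gamma>'"
  shows "(lam + 1) * \<gamma> \<le> lam * \<gamma>'"
proof -
  have eq: "(lam + m) * \<gamma> = (lam + m') * \<gamma>'"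
    using ej by (simp add: algebra_simps)
  have le: "\<gamma> \<le> \<gamma>'"
  proof (rule ccontr)
    assume "\<not> \<gamma> \<le> \<gamma>'"
    then have "(lam + m') * \<gamma>' < (lam + m') * \<gamma>"
      using pos by (intro mult_strict_left_mono) auto
    also have "\<dots> \<le> (lam + m) * \<gamma>"
      using pos mm by (intro mult_right_mono) auto
    finally show False using eq by simp
  qed
  have "m' * \<gamma> \<le> m' * \<gamma>'"
    using le pos by simp
  then have "m' * \<gamma> \<le> lam * \<gamma>"
    using S ej(1) by linarith
  \<comment> \<open>This is exactly the condition for
    \<open>(lam + m') * (lam + 1) \<le> lam * (lam + m' + 2)\<close>.\<close>
  then have m': "m' \<le> lam"
    using pos by simp
  have "(lam + m') * ((lam + 1) * \<gamma>) \<le> (lam * (lam + m)) * \<gamma>"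
  proof -
    have "lam * (m' + 2) \<le> lam * m"
      using mm pos by (intro mult_left_mono) auto
    then have "(lam + m') * (lam + 1) \<le> lam * (lam + m)"
      using m' by (simp add: algebra_simps)
    then have "(lam + m') * (lam + 1) * \<gamma> \<le> lam * (lam + m) * \<gamma>"
      using pos by (intro mult_right_mono) auto
    then show ?thesis by (simp add: algebra_simps)
  qed
  also have "\<dots> = (lam + m') * (lam * \<gamma>')"
    using eq by (simp add: mult.assoc mult.left_commute[of lam])
  finally show ?thesis
    using pos by simp
qed

text \<open>The equations of a pentagon of single vertices, written through nonneighbours. The rows
  of a largest value \<open>M\<close> and a smallest value \<open>m\<close> give
  \<open>(lam + 1) * M + 2 * m \<le> S \<le> (lam + 1) * m + 2 * M\<close>, hence
  \<open>(lam - 1) * (M - m) \<le> 0\<close>.\<close>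

lemma pentagon_all_equal:
  fixes lam S x0 x1 x2 x3 x4 :: real
  assumes lam: "1 < lam"
    and "(lam + 1) * x0 + x3 + x4 = S" "(lam + 1) * x1 + x2 + x3 = S" "(lam + 1) * x2 + x1 + x4 = S"
      "(lam + 1) * x3 + x0 + x1 = S" "(lam + 1) * x4 + x0 + x2 = S"
  shows "x1 = x0 \<and> x2 = x0 \<and> x3 = x0 \<and> x4 = x0"
proof -
  define A where "A = {x0, x1, x2, x3, x4}"
  have A: "finite A" "A \<noteq> {}" "x0 \<in> A" "x1 \<in> A" "x2 \<in> A" "x3 \<in> A" "x4 \<in> A"
    by (simp_all add: A_def)
  define m where "m = Min A"
  define M where "M = Max A"
  have bounds: "m \<le> y" "y \<le> M" if "y \<in> A" for y
    using that A(1) by (simp_all add: m_def M_def)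
  have row: "(lam + 1) * y + 2 * m \<le> S \<and> S \<le> (lam + 1) * y + 2 * M" if y: "y \<in> A" for y
  proof -
    note b = A(3-7)[THEN bounds(1)] A(3-7)[THEN bounds(2)]
    consider "y = x0" | "y = x1" | "y = x2" | "y = x3" | "y = x4"
      using y unfolding A_def by blast
    then show ?thesis
      by (cases; simp only:; intro conjI; use b assms(2-) in linarith)
  qed
  have "M \<in> A" "m \<in> A"
    using A by (simp_all add: m_def M_def)
  from row[OF this(1)] row[OF this(2)]
  have "(lam - 1) * (M - m) \<le> 0"
    by (simp add: algebra_simps)
  then have "M \<le> m"
    using lam by (simp add: mult_le_0_iff)
  then have "y = M" if "y \<in> A" for y
    using bounds[OF that] by linarith
  from A(3-7)[THEN this] show ?thesis
    by simp
qed

text \<open>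
  The edge counts before and after moving a vertex from the part of size \<open>n\<close> to the class of size \<open>b\<close>
  agree when \<open>n = b + 3\<close>, so comparing the graphs on the old eigenvector is not sufficient. The vector
  constructed here follows the exact solution of the eigenvalue equations for the new graph to second
  order in \<open>1 / lam\<close>; \<open>\<delta>\<close> is the increase of the total weight of the enlarged class.
\<close>

lemma enlarged_pentagon_supersolution:
  fixes lam b p n \<beta> \<pi> a c d \<gamma> :: real
  assumes lam: "3 \<le> lam" and b: "1 \<le> b" and p: "2 \<le> p" and n: "b + 3 \<le> n"
    and pos: "0 < \<beta>" "0 < \<pi>" "0 < a" "0 < c" "0 < d" "0 < \<gamma>"
    and rB: "(lam + b) * \<beta> + c + d = 1"
    and rP: "(lam + p) * \<pi> + a + c = 1"
    and rQ: "(lam + 1) * a + p * \<pi> + d = 1"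
    and rY: "(lam + 1) * c + b * \<beta> + p * \<pi> = 1"
    and rZ: "(lam + 1) * d + b * \<beta> + a = 1"
    and rG: "(lam + n) * \<gamma> = 1"
    and tot: "b * \<beta> + p * \<pi> + a + c + d + n * \<gamma> \<le> 1"
  obtains \<beta>' \<pi>' a' c' d' \<gamma>' where
    "0 < \<beta>'" "0 \<le> \<pi>'" "0 \<le> a'" "0 \<le> c'" "0 \<le> d'" "0 \<le> \<gamma>'"
    "b * \<beta> + p * \<pi> + a + c + d + n * \<gamma> < (b + 1) * \<beta>' + p * \<pi>' + a' + c' + d' + (n - 1) * \<gamma>'"
    "(lam + (b + 1)) * \<beta>' + c' + d' \<le> 1" "(lam + p) * \<pi>' + a' + c' \<le> 1"
    "(lam + 1) * a' + p * \<pi>' + d' \<le> 1" "(lam + 1) * c' + (b + 1) * \<beta>' + p * \<pi>' \<le> 1"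
    "(lam + 1) * d' + (b + 1) * \<beta>' + a' \<le> 1" "(lam + (n - 1)) * \<gamma>' \<le> 1"
proof -
  define m where "m = lam + 1"
  define i where "i = 1 / m"
  \<comment> \<open>Per unit of \<open>\<delta>\<close>, the weights \<open>c\<close> and
    \<open>d\<close> will drop by \<open>wc\<close> and \<open>wd\<close>, \<open>a\<close> rises by
    \<open>a0\<close> and \<open>p * \<pi>\<close> by \<open>2 * a0\<close>. The choice of
    \<open>wc\<close> and \<open>wd\<close> keeps the rows of \<open>c\<close> and \<open>d\<close>
    exact. The rows of \<open>a\<close> and, for \<open>p = 2\<close>, of \<open>\<pi>\<close>
    require \<open>a0 * (m + 2)\<close> to be at most \<open>wd\<close> and \<open>wc\<close>; both
    exceed \<open>i\<close>, and \<open>a0\<close> is the value solving this with \<open>i\<close>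
    on the right.\<close>
  define a0 where "a0 = i / (m + 2)"
  define wc where "wc = (1 + 2 * a0) * i"
  define wd where "wd = (1 + a0) * i"
  define k where "k = 1 - wc - wd"
  define h where "h = k + 3 * a0"
  define X where "X = b * \<beta>"
  define Y where "Y = p * \<pi>"
  define N where "N = lam + n"
  \<comment> \<open>Exactness of the row of the enlarged class determines \<open>\<delta>\<close>:
    it reads \<open>lam * (X + \<delta>) + (b + 1) * k * \<delta> = (b + 1) * lam * \<beta>\<close>.
    The total weight of the classes in the pentagon then grows by
    \<open>h * \<delta>\<close>.\<close>
  define D where "D = lam + k * (b + 1)"
  define \<delta> where "\<delta> = lam * \<beta> / D"
  have m: "4 \<le> m" and lm: "lam = m - 1"
    using lam by (simp_all add: m_def)
  have im: "i * m = 1" and i0: "0 < i" and i4: "i \<le> 1 / 4"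
    using m by (simp_all add: i_def divide_simps)
  have ai: "a0 * (m + 2) = i" and a00: "0 < a0"
    using m i0 by (simp_all add: a0_def)
  have a24: "a0 \<le> 1 / 24"
  proof -
    have "a0 * 6 \<le> a0 * (m + 2)"
      using m a00 by (intro mult_left_mono) auto
    then show ?thesis using ai i4 by linarith
  qed
  have a0m: "a0 * m = i - 2 * a0"
    using ai by (simp add: algebra_simps)
  have wcm: "wc * m = 1 + 2 * a0" and wdm: "wd * m = 1 + a0"
    using im by (simp_all add: wc_def wd_def mult.assoc)
  have w0: "0 < wc" "0 < wd"
    using a00 i0 by (simp_all add: wc_def wd_def)
  have wsum: "wc + wd = 2 * i + 3 * (a0 * i)"
    by (simp add: wc_def wd_def algebra_simps)
  have a0i: "0 < a0 * i" "a0 * i \<le> 1 / 96"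
  proof -
    show "0 < a0 * i" using a00 i0 by simp
    have "a0 * i \<le> (1 / 24) * (1 / 4)"
      using a24 i4 a00 i0 by (intro mult_mono) auto
    then show "a0 * i \<le> 1 / 96" by simp
  qed
  have k: "2 / 5 < k" "k < 1" and h: "2 / 5 < h" "h < 1"
  proof -
    show "2 / 5 < k" "k < 1"
      using wsum a0i i4 w0 by (simp_all add: k_def)
    then show "2 / 5 < h"
      using a00 by (simp add: h_def)
    have "a0 * 6 \<le> i"
      using ai m a00 mult_left_mono[of 6 "m + 2" a0] by simp
    then show "h < 1"
      unfolding h_def k_def using wsum a0i(1) a00 by linarith
  qed
  have XY: "0 < X" "0 < Y"
    using b p pos by (simp_all add: X_def Y_def)
  have rB': "lam * \<beta> + X + c + d = 1" and rP': "lam * \<pi> + Y + a + c = 1" and rQ': "m * a + Y + d = 1"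
    and rY': "m * c + X + Y = 1" and rZ': "m * d + X + a = 1" and rG': "N * \<gamma> = 1"
    using rB rP rQ rY rZ rG by (simp_all add: X_def Y_def m_def N_def algebra_simps)
  have lp: "2 * (lam + p) \<le> p * (lam + 2)"
    using mult_right_mono[of 2 p lam] p lam by (simp add: algebra_simps)
  have D: "lam < D" "0 < lam + k * b"
    using k b lam by (simp_all add: D_def add_pos_nonneg)
  have dD: "\<delta> * D = lam * \<beta>" and d0: "0 < \<delta>" and d\<beta>: "\<delta> \<le> \<beta>"
  proof -
    show "\<delta> * D = lam * \<beta>" "0 < \<delta>"
      using D lam pos by (simp_all add: \<delta>_def)
    show "\<delta> \<le> \<beta>"
      using D lam pos by (simp add: \<delta>_def divide_le_eq mult.commute[of \<beta>] mult_right_mono)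
  qed
  \<comment> \<open>By symmetry of the matrix the response coefficients also serve as multipliers:
    add the old rows of \<open>c\<close> and \<open>d\<close> with factors \<open>wc\<close> and
    \<open>wd\<close>, subtract those of \<open>a\<close> and \<open>\<pi>\<close> with
    \<open>a0\<close> and \<open>2 * a0\<close>. The leftover terms in \<open>a\<close> and
    \<open>\<pi>\<close> are nonnegative, and the row of \<open>\<beta>\<close> gives the
    bound.\<close>
  have wt: "h \<le> (lam + k * b) * \<beta>"
  proof -
    have "wc * (m * c + X + Y) = wc" "wd * (m * d + X + a) = wd" "a0 * (m * a + Y + d) = a0"
      "2 * a0 * (lam * \<pi> + Y + a + c) = 2 * a0"
      by (simp_all only: rY' rZ' rQ' rP' mult_1_right)
    then have eqs: "(wc * m) * c + wc * X + wc * Y = wc" "(wd * m) * d + wd * X + wd * a = wd"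
      "(a0 * m) * a + a0 * Y + a0 * d = a0"
      "2 * (a0 * (lam * \<pi>)) + 2 * (a0 * Y) + 2 * (a0 * a) + 2 * (a0 * c) = 2 * a0"
      by (simp_all add: algebra_simps)
    have "(1 + 2 * a0) * c + wc * X + wc * Y = wc" "(1 + a0) * d + wd * X + wd * a = wd"
      "(i - 2 * a0) * a + a0 * Y + a0 * d = a0"
      using eqs unfolding wcm wdm a0m by simp_all
    moreover note eqs(4)
    moreover have "0 \<le> wc * Y - a0 * Y - 2 * (a0 * (lam * \<pi>)) - 2 * (a0 * Y)"
    proof -
      have "a0 * (p + 2 * (lam + p)) \<le> a0 * (p * (m + 2))"
        using lp a00 by (intro mult_left_mono) (simp_all add: m_def algebra_simps)
      also have "\<dots> = p * i"
        by (subst ai[symmetric]) (rule mult.left_commute)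
      also have "\<dots> \<le> p * wc"
        using p a00 i0 by (simp add: wc_def)
      finally have "a0 * (p + 2 * (lam + p)) * \<pi> \<le> p * wc * \<pi>"
        using pos by (intro mult_right_mono) auto
      then show ?thesis
        by (simp add: Y_def algebra_simps)
    qed
    moreover have "0 \<le> wd * a - (i - 2 * a0) * a - 2 * (a0 * a)"
    proof -
      have "wd * a - (i - 2 * a0) * a - 2 * (a0 * a) = (a0 * i) * a"
        by (simp add: wd_def algebra_simps)
      then show ?thesis using a0i pos by simp
    qed
    ultimately have "c + d + wc * X + wd * X \<le> wc + wd - 3 * a0"
      by (simp add: algebra_simps)
    then have "h + wc * X + wd * X \<le> lam * \<beta> + X"
      using rB' by (simp add: h_def k_def)
    then show ?thesis
      by (simp add: k_def X_def algebra_simps)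
  qed
  \<comment> \<open>This inequality says that the pentagon gains more than the part loses. Products
    of neighbouring values are completed to squares about their midpoints: the left side is
    \<open>K^2 - k^2 / 4\<close>, and \<open>N * (N - 1) = (N - 1 / 2)^2 - 1 / 4\<close>. From
    \<open>b + 3 \<le> n\<close> comes \<open>m + b + 3 / 2 \<le> N - 1 / 2\<close>, so
    \<open>T\<close> against \<open>K\<close> decides; the margin \<open>15 / 4 * a0\<close>
    outweighs the difference of the quarter squares.\<close>
  have key: "(lam + k * b) * D < h\<^sup>2 * (N * (N - 1))"
  proof -
    define T where "T = h * (m + b + 3 / 2)"
    define K where "K = lam + k * (b + 1 / 2)"
    have TK: "15 / 4 * a0 \<le> T - K"
    proof -
      have km: "k * m = m - 2 - 3 * a0"
        using wcm wdm by (simp add: k_def algebra_simps)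
      have "T - K = (k * m + 3 * (a0 * m)) + k + 3 * a0 * (b + 3 / 2) - (m - 1)"
        by (simp add: T_def K_def h_def lm algebra_simps)
      also have "\<dots> = 3 * i - (wc + wd) + 3 * a0 * b - 9 / 2 * a0"
        unfolding km a0m by (simp add: k_def algebra_simps)
      also have "\<dots> = i - 3 * (a0 * i) + 3 * (a0 * b) - 9 / 2 * a0"
        unfolding wsum by simp
      finally have 1: "T - K = i - 3 * (a0 * i) + 3 * (a0 * b) - 9 / 2 * a0" .
      have "a0 * 1 \<le> a0 * b"
        using b a00 by (intro mult_left_mono) auto
      moreover have "a0 * i \<le> a0 * (1 / 4)"
        using i4 a00 by (intro mult_left_mono) auto
      moreover have "6 * a0 \<le> i"
        using ai m a00 mult_left_mono[of 6 "m + 2" a0] by simp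
      ultimately show ?thesis
        unfolding 1 by linarith
    qed
    have K3: "3 \<le> K"
    proof -
      have "0 \<le> k * (b + 1 / 2)"
        using k b by simp
      then show ?thesis
        using lam by (simp only: K_def)
    qed
    have "15 / 4 * a0 * 6 \<le> (T - K) * (T + K)"
      using TK K3 a00 by (intro mult_mono) auto
    moreover have "(h - k) * (h + k) \<le> 3 * a0 * 2"
      using h k a00 by (intro mult_mono) (auto simp: h_def)
    ultimately have 1: "K\<^sup>2 - k\<^sup>2 / 4 < T\<^sup>2 - h\<^sup>2 / 4"
      using a00 by (simp add: power2_eq_square algebra_simps)
    have "T \<le> h * (N - 1 / 2)"
      unfolding T_def N_def m_def using n h by (intro mult_left_mono) auto
    then have "T\<^sup>2 \<le> (h * (N - 1 / 2))\<^sup>2"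
      using TK K3 a00 by (intro power_mono) auto
    then have 2: "T\<^sup>2 - h\<^sup>2 / 4 \<le> h\<^sup>2 * (N * (N - 1))"
      by (simp add: power2_eq_square algebra_simps)
    have "(lam + k * b) * D = K\<^sup>2 - k\<^sup>2 / 4"
      by (simp add: K_def D_def power2_eq_square algebra_simps)
    then show ?thesis
      using 1 2 by linarith
  qed
  define \<gamma>' where "\<gamma>' = 1 / (N - 1)"
  have N: "1 < N"
    using lam n b by (simp add: N_def)
  have g': "\<gamma>' * (N - 1) = 1" "0 < \<gamma>'"
    using N by (simp_all add: \<gamma>'_def)
  have eta: "n * \<gamma> - (n - 1) * \<gamma>' = lam * (\<gamma> * \<gamma>')"
  proof -
    have "n * \<gamma> - (n - 1) * \<gamma>' = n * \<gamma> * (\<gamma>' * (N - 1)) - (n - 1) * \<gamma>' * (N * \<gamma>)"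
      using g' rG' by simp
    also have "\<dots> = lam * (\<gamma> * \<gamma>')"
      by (simp add: N_def algebra_simps)
    finally show ?thesis .
  qed
  have gain: "lam * (\<gamma> * \<gamma>') < \<delta> * h"
  proof -
    have "(\<gamma> * \<gamma>') * ((lam + k * b) * D) < (\<gamma> * \<gamma>') * (h\<^sup>2 * (N * (N - 1)))"
      using key pos g' by (intro mult_strict_left_mono) auto
    also have "\<dots> = h\<^sup>2 * ((N * \<gamma>) * (\<gamma>' * (N - 1)))"
      by (simp add: algebra_simps)
    also have "\<dots> = h * h"
      using g' rG' by (simp add: power2_eq_square)
    also have "\<dots> \<le> h * ((lam + k * b) * \<beta>)"
      using wt h by (intro mult_left_mono) auto
    finally have "0 < (h * \<beta> - (\<gamma> * \<gamma>') * D) * (lam + k * b)"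
      by (simp add: algebra_simps)
    then have "0 < h * \<beta> - (\<gamma> * \<gamma>') * D"
      by (rule zero_less_mult_pos2[OF _ D(2)])
    then have "lam * ((\<gamma> * \<gamma>') * D) < lam * (h * \<beta>)"
      using lam by (intro mult_strict_left_mono) auto
    also have "\<dots> = h * (\<delta> * D)"
      using dD by simp
    finally have "0 < (\<delta> * h - lam * (\<gamma> * \<gamma>')) * D"
      by (simp add: algebra_simps)
    then have "0 < \<delta> * h - lam * (\<gamma> * \<gamma>')"
      by (rule zero_less_mult_pos2) (use D lam in linarith)
    then show ?thesis by simp
  qed
  \<comment> \<open>Keeps \<open>c'\<close> and \<open>d'\<close> nonnegative, since
    \<open>tot\<close> makes \<open>m * c\<close> and \<open>m * d\<close> at least
    \<open>n * \<gamma>\<close>. The constant \<open>13 / 12\<close> below is the bound on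
    \<open>1 + 2 * a0\<close> coming from \<open>a0 \<le> 1 / 24\<close>.\<close>
  have small: "\<delta> * (1 + 2 * a0) \<le> n * \<gamma>"
  proof -
    have l\<beta>: "lam * \<beta> \<le> lam * \<gamma> + n * \<gamma>"
      using rB' rG' XY pos by (simp add: N_def algebra_simps)
    have "23 / 12 * (35 / 12) \<le> (lam - 13 / 12) * (n - 13 / 12)"
      using lam n b by (intro mult_mono) auto
    then have "13 / 12 * (lam + n) \<le> lam * n"
      by (simp add: algebra_simps)
    then have "13 / 12 * (lam + n) * \<gamma> \<le> lam * n * \<gamma>"
      using pos by (intro mult_right_mono) auto
    then have "13 / 12 * (lam * \<beta>) \<le> lam * (n * \<gamma>)"
      using l\<beta> by (simp add: algebra_simps)
    then have "lam * (13 / 12 * \<beta>) \<le> lam * (n * \<gamma>)"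
      by simp
    then have "13 / 12 * \<beta> \<le> n * \<gamma>"
      using lam by (subst (asm) mult_le_cancel_left_pos) auto
    moreover have "\<delta> * (1 + 2 * a0) \<le> \<beta> * (13 / 12)"
      using d\<beta> d0 a24 a00 by (intro mult_mono) auto
    ultimately show ?thesis by linarith
  qed
  define \<beta>' where "\<beta>' = (X + \<delta>) / (b + 1)"
  define \<pi>' where "\<pi>' = \<pi> + 2 * a0 * \<delta> / p"
  define a' where "a' = a + a0 * \<delta>"
  define c' where "c' = c - \<delta> * wc"
  define d' where "d' = d - \<delta> * wd"
  have X': "(b + 1) * \<beta>' = X + \<delta>"
    using b by (simp add: \<beta>'_def)
  have Y': "p * \<pi>' = Y + 2 * a0 * \<delta>"
    using p by (simp add: \<pi>'_def Y_def algebra_simps)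
  have mc: "m * c' = m * c - \<delta> * (1 + 2 * a0)" and md: "m * d' = m * d - \<delta> * (1 + a0)"
    unfolding wcm[symmetric] wdm[symmetric] by (simp_all add: c'_def d'_def algebra_simps)
  show ?thesis
  proof (rule that[of \<beta>' \<pi>' a' c' d' \<gamma>'])
    show "0 < \<beta>'"
      using b XY d0 by (simp add: \<beta>'_def)
    show "0 \<le> \<pi>'" "0 \<le> a'" "0 \<le> \<gamma>'"
      using pos a00 d0 p g' by (simp_all add: \<pi>'_def a'_def)
    have "0 \<le> m * c'" 
      unfolding mc using rY' tot small pos by (simp add: X_def Y_def)
    then show "0 \<le> c'"
      using m by (simp add: zero_le_mult_iff)
    have "\<delta> * (1 + a0) \<le> \<delta> * (1 + 2 * a0)"
      using d0 a00 by (intro mult_left_mono) auto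
    then have "0 \<le> m * d'"
      unfolding md using rZ' tot small pos XY by (simp add: X_def Y_def)
    then show "0 \<le> d'"
      using m by (simp add: zero_le_mult_iff)
    have "(b + 1) * \<beta>' + p * \<pi>' + a' + c' + d' = X + Y + a + c + d + \<delta> * h"
      unfolding X' Y' by (simp add: a'_def c'_def d'_def h_def k_def algebra_simps)
    then show "b * \<beta> + p * \<pi> + a + c + d + n * \<gamma> < (b + 1) * \<beta>' + p * \<pi>' + a' + c' + d' + (n - 1) * \<gamma>'"
      using gain eta by (simp add: X_def Y_def)
    have "(b + 1) * (lam * \<beta>' + \<delta> * k) = lam * ((b + 1) * \<beta>') + (b + 1) * (\<delta> * k)"
      by (simp add: algebra_simps)
    also have "\<dots> = lam * X + \<delta> * D"
      unfolding X' by (simp add: D_def algebra_simps)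
    also have "\<dots> = (b + 1) * (lam * \<beta>)"
      unfolding dD by (simp add: X_def algebra_simps)
    finally have "lam * \<beta>' + \<delta> * k = lam * \<beta>"
      using b by simp
    moreover have "(lam + (b + 1)) * \<beta>' + c' + d' = lam * \<beta>' + (b + 1) * \<beta>' + c' + d'"
      by (simp add: algebra_simps)
    moreover have "\<dots> = lam * \<beta>' + \<delta> * k + X + c + d"
      unfolding X' by (simp add: c'_def d'_def k_def algebra_simps)
    ultimately show "(lam + (b + 1)) * \<beta>' + c' + d' \<le> 1"
      using rB' by linarith
    have "(lam + p) * (2 * a0 * \<delta> / p) + a0 * \<delta> \<le> \<delta> * wc"
    proof -
      have "2 * (lam + p) / p \<le> lam + 2"
        using lp p by (simp add: divide_le_eq mult.commute)
      then have "a0 * (2 * (lam + p) / p) \<le> a0 * (lam + 2)"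
        using a00 by (intro mult_left_mono) auto
      then have "a0 * (2 * (lam + p) / p) + a0 \<le> i"
        using ai by (simp add: m_def algebra_simps)
      also have "\<dots> \<le> wc"
        using a00 i0 by (simp add: wc_def)
      finally have "\<delta> * (a0 * (2 * (lam + p) / p) + a0) \<le> \<delta> * wc"
        using d0 by (intro mult_left_mono) auto
      then show ?thesis
        by (simp add: algebra_simps)
    qed
    moreover have "(lam + p) * \<pi>' + a' + c' = (lam + p) * \<pi> + a + c + ((lam + p) * (2 * a0 * \<delta> / p) + a0 * \<delta> - \<delta> * wc)"
      by (simp add: \<pi>'_def a'_def c'_def distrib_left)
    ultimately show "(lam + p) * \<pi>' + a' + c' \<le> 1"
      using rP by linarith
    have "(lam + 1) * a' + p * \<pi>' + d' = m * a + Y + d + \<delta> * (a0 * m + 2 * a0 - wd)"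
      unfolding Y' by (simp add: a'_def d'_def m_def algebra_simps)
    moreover have "\<delta> * (a0 * m + 2 * a0 - wd) \<le> 0"
      unfolding a0m using d0 a0i by (intro mult_nonneg_nonpos) (simp_all add: wd_def algebra_simps)
    ultimately show "(lam + 1) * a' + p * \<pi>' + d' \<le> 1"
      using rQ' by linarith
    show "(lam + 1) * c' + (b + 1) * \<beta>' + p * \<pi>' \<le> 1"
      unfolding X' Y' m_def[symmetric] mc using rY' by (simp add: algebra_simps)
    show "(lam + 1) * d' + (b + 1) * \<beta>' + a' \<le> 1"
      unfolding X' m_def[symmetric] md a'_def using rZ' by (simp add: algebra_simps)
    show "(lam + (n - 1)) * \<gamma>' \<le> 1"
      using g' by (simp add: N_def algebra_simps)
  qed
qed

section \<open>Sizes of the classes of an extremal graph\<close>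

lemma label_count_fun_upd:
  assumes "finite V" "t \<in> V" "\<kappa> t \<noteq> i"
  shows "label_count V (\<kappa>(t := i)) i = label_count V \<kappa> i + 1"
    "label_count V (\<kappa>(t := i)) (\<kappa> t) = label_count V \<kappa> (\<kappa> t) - 1"
    "l \<noteq> i \<Longrightarrow> l \<noteq> \<kappa> t \<Longrightarrow> label_count V (\<kappa>(t := i)) l = label_count V \<kappa> l"
proof -
  have "{w \<in> V. (\<kappa>(t := i)) w = i} = insert t {w \<in> V. \<kappa> w = i}"
    using assms by auto
  then show "label_count V (\<kappa>(t := i)) i = label_count V \<kappa> i + 1"
    using assms by (simp add: label_count_def)
  have "{w \<in> V. (\<kappa>(t := i)) w = \<kappa> t} = {w \<in> V. \<kappa> w = \<kappa> t} - {t}"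
    using assms by auto
  then show "label_count V (\<kappa>(t := i)) (\<kappa> t) = label_count V \<kappa> (\<kappa> t) - 1"
    using assms by (simp add: label_count_def card_Diff_singleton)
  assume l: "l \<noteq> i" "l \<noteq> \<kappa> t"
  then have "{w \<in> V. (\<kappa>(t := i)) w = l} = {w \<in> V. \<kappa> w = l}"
    by auto
  then show "label_count V (\<kappa>(t := i)) l = label_count V \<kappa> l"
    by (simp add: label_count_def)
qed

text \<open>The single classes 2, 3, 4 form a path in the pentagon. In terms of
  \<open>Y_graph\<close> the smallest part has size \<open>N 1 + 1\<close> and the largest
  \<open>N 0 + 2\<close>; being balanced means \<open>N 0 \<le> N 1 \<le> N 0 + 1\<close> with all
  full parts in between. The reflection through label 3 exchanges the classes 0 and 1.\<close>

locale pentagon_extremal = lab_extremal +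
  assumes N2: "label_count V \<kappa> 2 = 1" and N3: "label_count V \<kappa> 3 = 1" and N4: "label_count V \<kappa> 4 = 1"
begin

lemma core_lt: "0 < r + 3" "1 < r + 3" "2 < r + 3" "3 < r + 3" "4 < r + 3"
  using r2 by auto

lemmas core_pos = core_lt[THEN xi_pos]

lemma core_eqs:
  "lam * \<xi> 0 = R + \<xi> 2 + real (N 1) * \<xi> 1"
  "lam * \<xi> 1 = R + \<xi> 4 + real (N 0) * \<xi> 0"
  "lam * \<xi> 2 = R + \<xi> 3 + real (N 0) * \<xi> 0"
  "lam * \<xi> 3 = R + \<xi> 2 + \<xi> 4"
  "lam * \<xi> 4 = R + \<xi> 3 + real (N 1) * \<xi> 1"
  using core_eigen by (simp_all add: N2 N3 N4)

lemma S_core: "S = R + real (N 0) * \<xi> 0 + real (N 1) * \<xi> 1 + \<xi> 2 + \<xi> 3 + \<xi> 4"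
  using S_eq by (simp add: N2 N3 N4)

lemma N01_pos: "1 \<le> N 0" "1 \<le> N 1"
  using N_pos core_lt by simp_all

lemma reflected_y: "pentagon_extremal V E x lam r (reflect_y \<circ> \<kappa>)"
proof -
  interpret L: lab_extremal V E x lam r "reflect_y \<circ> \<kappa>"
  proof (rule reflected)
    show "reflect_y (reflect_y i) = i" for i
      by simp
    show "lab_adj (reflect_y i) (reflect_y j) = lab_adj i j" for i j
      by (rule reflect_adj)
    show "i < r + 3 \<Longrightarrow> reflect_y i < r + 3" for i
      using r2 by (auto simp: reflect_y_def)
  qed
  show ?thesis
  proof
    show "label_count V (reflect_y \<circ> \<kappa>) 2 = 1" "label_count V (reflect_y \<circ> \<kappa>) 3 = 1"
      "label_count V (reflect_y \<circ> \<kappa>) 4 = 1"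
      using N2 N3 N4 by (simp_all add: label_count_involution reflect_y_def)
  qed
qed

lemma reflected_counts:
  "label_count V (reflect_y \<circ> \<kappa>) 0 = N 1" "label_count V (reflect_y \<circ> \<kappa>) 1 = N 0"
  "5 \<le> j \<Longrightarrow> label_count V (reflect_y \<circ> \<kappa>) j = N j"
  by (simp_all add: label_count_involution reflect_y_def)

lemma N0_le: "N 0 \<le> N 1 + 1"
proof (rule ccontr)
  assume "\<not> ?thesis"
  then have *: "N 1 + 2 \<le> N 0" by simp
  then have "real (N 1) + 2 \<le> real (N 0)"
    by linarith
  moreover have "lam * \<xi> 1 < (lam + 1) * \<xi> 0"
    using * core_lt by (intro move_vertex) auto
  moreover have "1 \<le> real (N 1)"
    using N01_pos by simp
  ultimately show False
    using pentagon_sizes_contradiction[OF lam_pos R_nonneg core_pos(1-5)] core_eqs by blast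
qed

lemma part_weight:
  assumes "5 \<le> j" "j < r + 3" "N j \<le> N 0"
  shows "(lam + 1) * \<xi> 0 < lam * \<xi> j"
proof (rule small_part_weight[OF lam_pos core_pos(1) xi_pos[OF assms(2)] core_pos(4,5)])
  show "0 < real (N j)"
    using N_pos[OF assms(2)] by simp
  show "real (N j) * \<xi> j \<le> R"
    using part_le_R assms by blast
  show "real (N j) \<le> real (N 0)"
    using assms by simp
  show "lam * \<xi> j = R + real (N 0) * \<xi> 0 + real (N 1) * \<xi> 1 + \<xi> 2 + \<xi> 3 + \<xi> 4 - real (N j) * \<xi> j"
    using part_eigen[OF assms(1,2)] S_core by simp
qed (fact core_eqs)+

lemma part_gt_N0:
  assumes "5 \<le> j" "j < r + 3" "2 \<le> N 0"
  shows "N 0 < N j"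
proof (rule ccontr)
  assume "\<not> ?thesis"
  then have "(lam + 1) * \<xi> 0 < lam * \<xi> j"
    using part_weight assms by simp
  moreover have "lam * \<xi> j < (lam + 1) * \<xi> 0"
    using assms by (intro move_vertex) (auto simp: lab_adj_part)
  ultimately show False by simp
qed

lemma parts_balanced:
  assumes "5 \<le> i" "i < r + 3" "5 \<le> j" "j < r + 3"
  shows "N i \<le> N j + 1"
proof (rule ccontr)
  assume "\<not> ?thesis"
  then have *: "N j + 2 \<le> N i" by simp
  then have ij: "i \<noteq> j" by auto
  have "R \<le> S"
    using S_core core_pos N01_pos by (simp add: add_nonneg_nonneg less_imp_le)
  then have "real (N i) * \<xi> i + real (N j) * \<xi> j \<le> S"
    using two_parts_le_R[OF assms ij] by linarith
  moreover have "real (N j) + 2 \<le> real (N i)"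
    using * by linarith
  moreover have "0 < real (N j)"
    using N_pos[OF assms(4)] by simp
  ultimately have "(lam + 1) * \<xi> i \<le> lam * \<xi> j"
    using balanced_part_weight[OF lam_pos xi_pos[OF assms(2)] xi_pos[OF assms(4)]]
      part_eigen assms by blast
  moreover have "lam * \<xi> j < (lam + 1) * \<xi> i"
    using * assms ij by (intro move_vertex) (auto simp: lab_adj_part)
  ultimately show False by simp
qed

lemma part_le_N0:
  assumes j: "5 \<le> j" "j < r + 3" and N1: "2 \<le> N 1"
  shows "N j \<le> N 0 + 2"
proof (rule ccontr)
  assume "\<not> ?thesis"
  then have nj: "N 0 + 3 \<le> N j" by simp
  define b where "b = real (N 0)"
  define p where "p = real (N 1)"
  define n where "n = real (N j)"
  have bpn: "1 \<le> b" "2 \<le> p" "b + 3 \<le> n"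
    using N01_pos N1 nj unfolding b_def p_def n_def by linarith+
  have R: "n * \<xi> j \<le> R"
    using part_le_R[OF j] by (simp add: n_def)
  note g0 = xi_pos[OF j(2)]
  have eqs: "lam * \<xi> 0 = R + \<xi> 2 + p * \<xi> 1" "lam * \<xi> 1 = R + \<xi> 4 + b * \<xi> 0" "lam * \<xi> 2 = R + \<xi> 3 + b * \<xi> 0"
    "lam * \<xi> 3 = R + \<xi> 2 + \<xi> 4" "lam * \<xi> 4 = R + \<xi> 3 + p * \<xi> 1"
    and S: "S = R + b * \<xi> 0 + p * \<xi> 1 + \<xi> 2 + \<xi> 3 + \<xi> 4" and ej: "lam * \<xi> j = S - n * \<xi> j"
    using core_eqs S_core part_eigen[OF j] by (simp_all add: b_def p_def n_def)
  have b1: "\<xi> 0 \<le> b * \<xi> 0" "2 * \<xi> 1 \<le> p * \<xi> 1" "4 * \<xi> j \<le> n * \<xi> j"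
    using bpn core_pos(1,2) g0 by simp_all
  have lam3: "3 \<le> lam"
  proof (rule ccontr)
    assume "\<not> 3 \<le> lam"
    then have "lam * \<xi> 0 < 3 * \<xi> 0" "lam * \<xi> 1 < 3 * \<xi> 1" "lam * \<xi> j < 3 * \<xi> j"
      using core_pos g0 by simp_all
    then show False
      using eqs S ej b1 R core_pos g0 by linarith
  qed
  have S0: "0 < S"
    using S b1 core_pos R R_nonneg by linarith
  define f where "f i = \<xi> i / S" for i
  have fpos: "i < r + 3 \<Longrightarrow> 0 < f i" for i
    using xi_pos S0 by (simp add: f_def)
  have Sf: "S * f i = \<xi> i" for i
    using S0 by (simp add: f_def)
  have norm: "t = 1" if "S * t = S" for t
    using that S0 by simp
  note push = distrib_left mult.left_commute[of S] Sf
  have rows: "(lam + b) * f 0 + f 3 + f 4 = 1" "(lam + p) * f 1 + f 2 + f 3 = 1"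
    "(lam + 1) * f 2 + p * f 1 + f 4 = 1" "(lam + 1) * f 3 + b * f 0 + p * f 1 = 1"
    "(lam + 1) * f 4 + b * f 0 + f 2 = 1" "(lam + n) * f j = 1"
    by (rule norm, simp only: push, use eqs S ej in \<open>simp add: algebra_simps\<close>)+
  have "S * (b * f 0 + p * f 1 + f 2 + f 3 + f 4 + n * f j) \<le> S * 1"
    unfolding push using S R by simp
  then have tot: "b * f 0 + p * f 1 + f 2 + f 3 + f 4 + n * f j \<le> 1"
    using S0 by (subst (asm) mult_le_cancel_left_pos)
  obtain \<beta>' \<pi>' a' c' d' \<gamma>' where pr: "0 < \<beta>'" "0 \<le> \<pi>'" "0 \<le> a'" "0 \<le> c'" "0 \<le> d'" "0 \<le> \<gamma>'"
    "b * f 0 + p * f 1 + f 2 + f 3 + f 4 + n * f j < (b + 1) * \<beta>' + p * \<pi>' + a' + c' + d' + (n - 1) * \<gamma>'"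
    "(lam + (b + 1)) * \<beta>' + c' + d' \<le> 1" "(lam + p) * \<pi>' + a' + c' \<le> 1"
    "(lam + 1) * a' + p * \<pi>' + d' \<le> 1" "(lam + 1) * c' + (b + 1) * \<beta>' + p * \<pi>' \<le> 1"
    "(lam + 1) * d' + (b + 1) * \<beta>' + a' \<le> 1" "(lam + (n - 1)) * \<gamma>' \<le> 1"
    using enlarged_pentagon_supersolution[OF lam3 bpn core_lt(1,2,3,4,5)[THEN fpos] fpos[OF j(2)] rows tot]
    by blast
  have "2 \<le> N j" using nj by simp
  then obtain t t' where t: "t \<in> V" "\<kappa> t = j" "t' \<in> V" "\<kappa> t' = j" "t \<noteq> t'"
    using label_rep2 by metis
  define \<kappa>' where "\<kappa>' = \<kappa>(t := 0)"
  define m where "m i = real (label_count V \<kappa>' i)" for i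
  have "\<kappa>' ` V = insert 0 (\<kappa> ` (V - {t}))"
    unfolding \<kappa>'_def using t(1) by auto
  then have img': "\<kappa>' ` V = {..<r + 3}"
    using img_minus[of t' t] t by auto
  have t0: "\<kappa> t \<noteq> 0" using t j by auto
  have m: "m 0 = b + 1" "m j = n - 1" "l \<noteq> 0 \<Longrightarrow> l \<noteq> j \<Longrightarrow> m l = real (N l)" for l
    using label_count_fun_upd[of V t \<kappa> 0, OF finV t(1) t0] t(2) nj by (simp_all add: m_def \<kappa>'_def b_def n_def of_nat_diff)
  have mc: "m 1 = p" "m 2 = 1" "m 3 = 1" "m 4 = 1"
    using m(3) j N2 N3 N4 by (simp_all add: p_def)
  define \<eta> where "\<eta> i = (if i = 0 then \<beta>' else if i = 1 then \<pi>' else if i = 2 then a' else if i = 3 then c'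
    else if i = 4 then d' else if i = j then \<gamma>' else f i)" for i
  have \<eta>c: "\<eta> 0 = \<beta>'" "\<eta> 1 = \<pi>'" "\<eta> 2 = a'" "\<eta> 3 = c'" "\<eta> 4 = d'" "\<eta> j = \<gamma>'"
    "5 \<le> i \<Longrightarrow> i \<noteq> j \<Longrightarrow> \<eta> i = f i" for i
    using j by (simp_all add: \<eta>_def)
  have \<eta>nn: "0 \<le> \<eta> i" if "i < r + 3" for i
    using pr fpos[OF that] by (auto simp: \<eta>_def)
  define Q where "Q = (\<Sum>i\<in>{5..<r + 3} - {j}. real (N i) * f i)"
  define R' where "R' = (\<Sum>i = 5..<r + 3. m i * \<eta> i)"
  have R'_eq: "R' = (n - 1) * \<gamma>' + Q"
  proof -
    have "R' = m j * \<eta> j + (\<Sum>i\<in>{5..<r + 3} - {j}. m i * \<eta> i)"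
      unfolding R'_def using j by (intro sum.remove) auto
    also have "(\<Sum>i\<in>{5..<r + 3} - {j}. m i * \<eta> i) = Q"
      unfolding Q_def using m(3) \<eta>c(7) by (intro sum.cong) auto
    finally show ?thesis
      by (simp add: m(2) \<eta>c(6))
  qed
  have "R = real (N j) * \<xi> j + (\<Sum>i\<in>{5..<r + 3} - {j}. real (N i) * \<xi> i)"
    unfolding R_def using j by (intro sum.remove) auto
  also have "(\<Sum>i\<in>{5..<r + 3} - {j}. real (N i) * \<xi> i) = S * Q"
    unfolding Q_def f_def using S0 by (simp add: sum_distrib_left)
  finally have "R = n * \<xi> j + S * Q"
    by (simp add: n_def)
  then have "S * (b * f 0 + p * f 1 + f 2 + f 3 + f 4 + n * f j + Q) = S"
    unfolding push using S by simp
  then have Q: "b * f 0 + p * f 1 + f 2 + f 3 + f 4 + n * f j + Q = 1"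
    by (rule norm)
  define S' where "S' = R' + (b + 1) * \<beta>' + p * \<pi>' + a' + c' + d'"
  have S': "1 < S'"
    using pr(7) Q by (simp add: S'_def R'_eq)
  define row where "row i = (\<Sum>l<r + 3. if lab_adj i l then m l * \<eta> l else 0)" for i
  have row_core: "row 0 = R' + p * \<pi>' + a'" "row 1 = R' + (b + 1) * \<beta>' + d'" "row 2 = R' + (b + 1) * \<beta>' + c'"
    "row 3 = R' + a' + d'" "row 4 = R' + p * \<pi>' + c'"
    unfolding row_def label_sum_core[OF r2] R'_def[symmetric] by (simp_all only: \<eta>c m(1) mc mult_1_left)
  have row_part: "row i = S' - m i * \<eta> i" if i: "5 \<le> i" "i < r + 3" for i
  proof -
    have "row i = (\<Sum>l<r + 3. m l * \<eta> l) - m i * \<eta> i"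
      unfolding row_def by (rule label_sum_part[OF i])
    also have "(\<Sum>l<r + 3. m l * \<eta> l) = S'"
      unfolding sum_lessThan_split5[OF r2] R'_def[symmetric] by (simp only: \<eta>c m(1) mc S'_def)
    finally show ?thesis .
  qed
  \<comment> \<open>A row falls short of \<open>S'\<close> by the weight of the nonneighbours, and
    that weight plus \<open>lam * \<eta> i\<close> is at most 1. So the gain \<open>S' - 1\<close>
    in total weight becomes a surplus in every row at once.\<close>
  have ge: "S' - 1 \<le> row i - lam * \<eta> i" if i: "i < r + 3" for i
  proof -
    show ?thesis
    proof (cases "5 \<le> i")
      case False
      then have "i = 0 \<or> i = 1 \<or> i = 2 \<or> i = 3 \<or> i = 4"
        by arith
      then show ?thesis
        using pr(8-12) by (elim disjE) (simp_all only: row_core \<eta>c(1-5) S'_def, simp_all add: algebra_simps)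
    next
      case i5: True
      show ?thesis
      proof (cases "i = j")
        case True
        have "row j = S' - (n - 1) * \<gamma>'"
          unfolding row_part[OF j] m(2) \<eta>c(6) ..
        then show ?thesis
          using pr(13) unfolding True \<eta>c(6) by (simp add: algebra_simps)
      next
        case False
        have "lam * \<xi> i = S - real (N i) * \<xi> i"
          using part_eigen i5 i by simp
        then have "S * (lam * f i + real (N i) * f i) = S"
          unfolding push by simp
        from norm[OF this] have "lam * f i = 1 - real (N i) * f i"
          by linarith
        moreover have "row i = S' - real (N i) * f i" "\<eta> i = f i"
          using row_part[OF i5 i] m(3)[of i] \<eta>c(7)[OF i5 False] i5 False by simp_all
        ultimately show ?thesis
          by simp
      qed
    qed
  qed
  have "0 < (\<Sum>i<r + 3. m i * (\<eta> i * (row i - lam * \<eta> i)))"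
  proof (rule sum_pos2[of _ 0])
    have "0 < row 0 - lam * \<eta> 0"
      using ge[of 0] S' by simp
    then show "0 < m 0 * (\<eta> 0 * (row 0 - lam * \<eta> 0))"
      using pr(1) bpn by (simp add: m(1) \<eta>c(1))
    fix i assume "i \<in> {..<r + 3}"
    then have "0 \<le> \<eta> i" "0 \<le> row i - lam * \<eta> i"
      using \<eta>nn ge[of i] S' by auto
    then show "0 \<le> m i * (\<eta> i * (row i - lam * \<eta> i))"
      by (simp add: m_def)
  qed auto
  then show False
    unfolding row_def m_def by (rule supersolution_contradiction[OF img'])
qed

text \<open>
  Here moving a vertex does not help; instead the defect is relocated to the large part \<open>j\<close>: two of its
  vertices become the vertices labelled \<open>3\<close> and \<open>4\<close>, and the old classes \<open>0\<close>, \<open>3\<close>, \<open>4\<close> form a full part.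
\<close>

lemma part_le_3:
  assumes j: "5 \<le> j" "j < r + 3" and N01: "N 0 = 1" "N 1 = 1"
  shows "N j \<le> 3"
proof (rule ccontr)
  assume "\<not> ?thesis"
  then have nj: "4 \<le> N j" by simp
  define n where "n = real (N j)"
  have n4: "4 \<le> n" using nj by (simp add: n_def)
  have eqs: "lam * \<xi> 0 = R + \<xi> 2 + \<xi> 1" "lam * \<xi> 1 = R + \<xi> 4 + \<xi> 0" "lam * \<xi> 2 = R + \<xi> 3 + \<xi> 0"
    "lam * \<xi> 3 = R + \<xi> 2 + \<xi> 4" "lam * \<xi> 4 = R + \<xi> 3 + \<xi> 1"
    and S: "S = R + \<xi> 0 + \<xi> 1 + \<xi> 2 + \<xi> 3 + \<xi> 4" and ej: "lam * \<xi> j = S - n * \<xi> j"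
    using core_eqs S_core part_eigen[OF j] N01 by (simp_all add: n_def)
  have "2 * (\<xi> 0 + \<xi> 1 + \<xi> 2 + \<xi> 3 + \<xi> 4) \<le> lam * (\<xi> 0 + \<xi> 1 + \<xi> 2 + \<xi> 3 + \<xi> 4)"
    using eqs R_nonneg by (simp add: distrib_left)
  then have "2 \<le> lam"
    using core_pos by (subst (asm) mult_le_cancel_right_pos) auto
  then have "1 < lam" by simp
  from pentagon_all_equal[OF this, of "\<xi> 0" "\<xi> 3" "\<xi> 4" S "\<xi> 1" "\<xi> 2"]
  have eq: "\<xi> 1 = \<xi> 0" "\<xi> 2 = \<xi> 0" "\<xi> 3 = \<xi> 0" "\<xi> 4 = \<xi> 0"
    using eqs S by (simp_all add: algebra_simps)
  define \<alpha> where "\<alpha> = \<xi> 0"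
  define \<gamma> where "\<gamma> = \<xi> j"
  have lamS: "lam * \<alpha> = R + 2 * \<alpha>" "S = R + 5 * \<alpha>" "lam * \<gamma> = S - n * \<gamma>"
    using eqs(1) S ej eq by (simp_all add: \<alpha>_def \<gamma>_def)
  have pos: "0 < \<alpha>" "0 < \<gamma>"
    using core_pos xi_pos[OF j(2)] by (simp_all add: \<alpha>_def \<gamma>_def)
  have neq: "\<alpha> \<noteq> \<gamma>"
  proof
    assume "\<alpha> = \<gamma>"
    then have "n * \<alpha> = 3 * \<alpha>"
      using lamS by simp
    then show False
      using pos n4 by simp
  qed
  have "2 \<le> N j" using nj by simp
  then obtain u w where u: "u \<in> V" "\<kappa> u = j" and w: "w \<in> V" "\<kappa> w = j" and uw: "u \<noteq> w"
    using label_rep2 by metis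
  define \<kappa>' where "\<kappa>' v = (if v = u then 3 else if v = w then 4 else if \<kappa> v = j then 0
    else if \<kappa> v \<in> {0, 3, 4} then j else \<kappa> v)" for v
  define m where "m i = real (label_count V \<kappa>' i)" for i
  have sets: "{v \<in> V. \<kappa>' v = 0} = {v \<in> V. \<kappa> v = j} - {u, w}" "{v \<in> V. \<kappa>' v = 3} = {u}"
    "{v \<in> V. \<kappa>' v = 4} = {w}"
    "{v \<in> V. \<kappa>' v = j} = {v \<in> V. \<kappa> v = 0} \<union> ({v \<in> V. \<kappa> v = 3} \<union> {v \<in> V. \<kappa> v = 4})"
    "l \<notin> {0, 3, 4, j} \<Longrightarrow> {v \<in> V. \<kappa>' v = l} = {v \<in> V. \<kappa> v = l}" for l
    using j u w uw by (auto simp: \<kappa>'_def split: if_splits)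
  have c0: "label_count V \<kappa>' 0 = N j - 2"
    unfolding label_count_def sets(1) using finV u w uw by (subst card_Diff_subset) auto
  have cj: "label_count V \<kappa>' j = 3"
  proof -
    have "label_count V \<kappa>' j = N 0 + (N 3 + N 4)"
      unfolding label_count_def sets(4) using finV by (subst card_Un_disjoint, simp, simp, force)+ simp
    then show ?thesis using N01 N3 N4 by simp
  qed
  have cl: "label_count V \<kappa>' l = N l" if "l \<notin> {0, 3, 4, j}" for l
    unfolding label_count_def sets(5)[OF that] ..
  have c34: "label_count V \<kappa>' 3 = 1" "label_count V \<kappa>' 4 = 1"
    unfolding label_count_def sets(2,3) by simp_all
  have m: "m 0 = n - 2" "m 1 = 1" "m 2 = 1" "m 3 = 1" "m 4 = 1" "m j = 3"
    "l \<notin> {0, 3, 4, j} \<Longrightarrow> m l = real (N l)" for l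
    using c0 c34 cj cl[of 1] cl[of 2] cl[of l] N01 N2 j nj by (simp_all add: m_def n_def of_nat_diff)
  have img': "\<kappa>' ` V = {..<r + 3}"
  proof (intro subset_antisym subsetI)
    fix i assume "i \<in> \<kappa>' ` V"
    then show "i \<in> {..<r + 3}"
      using label_lt r2 j by (auto simp: \<kappa>'_def split: if_splits)
  next
    fix i assume i: "i \<in> {..<r + 3}"
    have "label_count V \<kappa>' i \<noteq> 0"
      using c0 c34 cj cl[of i] nj N_pos[of i] i by (cases "i \<in> {0, 3, 4, j}") auto
    then have "{v \<in> V. \<kappa>' v = i} \<noteq> {}"
      unfolding label_count_def by (metis card.empty)
    then show "i \<in> \<kappa>' ` V"
      by auto
  qed
  \<comment> \<open>All five pentagon weights are \<open>\<alpha>\<close>, so every vertex keeps its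
    old weight and \<open>\<eta> \<circ> \<kappa>'\<close> is \<open>x\<close> itself. The
    relocation gains two nonadjacent pairs of weight \<open>\<alpha> * \<alpha>\<close> and one of
    \<open>\<gamma> * \<gamma>\<close>, and loses one of \<open>\<alpha> * \<alpha>\<close> and two
    of \<open>\<alpha> * \<gamma>\<close>. Counted in both directions this is
    \<open>2 * (\<alpha> - \<gamma>)^2\<close>, which would vanish only for
    \<open>n = 3\<close>.\<close>
  define \<eta> where "\<eta> i = (if i \<in> {0, 3, 4} then \<gamma> else if i \<in> {1, 2, j} then \<alpha> else \<xi> i)" for i
  have \<eta>c: "\<eta> 0 = \<gamma>" "\<eta> 1 = \<alpha>" "\<eta> 2 = \<alpha>" "\<eta> 3 = \<gamma>" "\<eta> 4 = \<gamma>" "\<eta> j = \<alpha>"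
    "5 \<le> i \<Longrightarrow> i \<noteq> j \<Longrightarrow> \<eta> i = \<xi> i" for i
    using j by (simp_all add: \<eta>_def)
  define R' where "R' = (\<Sum>i = 5..<r + 3. m i * \<eta> i)"
  have R'_eq: "R' = R - n * \<gamma> + 3 * \<alpha>"
  proof -
    have "R' = m j * \<eta> j + (\<Sum>i\<in>{5..<r + 3} - {j}. m i * \<eta> i)"
      unfolding R'_def using j by (intro sum.remove) auto
    also have "(\<Sum>i\<in>{5..<r + 3} - {j}. m i * \<eta> i) = (\<Sum>i\<in>{5..<r + 3} - {j}. real (N i) * \<xi> i)"
      using m(7) \<eta>c(7) by (intro sum.cong) auto
    also have "R = real (N j) * \<xi> j + (\<Sum>i\<in>{5..<r + 3} - {j}. real (N i) * \<xi> i)"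
      unfolding R_def using j by (intro sum.remove) auto
    ultimately show ?thesis
      by (simp add: m(6) \<eta>c(6) n_def \<gamma>_def)
  qed
  define row where "row i = (\<Sum>l<r + 3. if lab_adj i l then m l * \<eta> l else 0)" for i
  have row_core: "row 0 = R' + \<alpha> + \<alpha>" "row 1 = R' + (n - 2) * \<gamma> + \<gamma>" "row 2 = R' + (n - 2) * \<gamma> + \<gamma>"
    "row 3 = R' + \<alpha> + \<gamma>" "row 4 = R' + \<alpha> + \<gamma>"
    unfolding row_def label_sum_core[OF r2] R'_def[symmetric] by (simp_all only: \<eta>c m(1-5) mult_1_left)
  have row_part: "row i - lam * \<eta> i = 0" if i: "5 \<le> i" "i < r + 3" for i
  proof -
    have "row i = (\<Sum>l<r + 3. m l * \<eta> l) - m i * \<eta> i"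
      unfolding row_def by (rule label_sum_part[OF i])
    also have "(\<Sum>l<r + 3. m l * \<eta> l) = S"
      unfolding sum_lessThan_split5[OF r2] R'_def[symmetric]
      by (simp only: \<eta>c m(1-5) R'_eq lamS(2)) (simp add: algebra_simps)
    finally have *: "row i = S - m i * \<eta> i" .
    show ?thesis
    proof (cases "i = j")
      case True
      then show ?thesis
        using * lamS by (simp add: m(6) \<eta>c(6))
    next
      case False
      then show ?thesis
        using * part_eigen[OF i] i by (simp add: m(7) \<eta>c(7))
    qed
  qed
  have "(\<Sum>i = 5..<r + 3. m i * (\<eta> i * (row i - lam * \<eta> i))) = 0"
    by (intro sum.neutral) (simp add: row_part)
  then have "(\<Sum>i<r + 3. m i * (\<eta> i * (row i - lam * \<eta> i))) = 2 * (\<alpha> - \<gamma>)\<^sup>2"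
    unfolding sum_lessThan_split5[OF r2] \<eta>c m(1-5) row_core R'_eq
    using lamS by (simp add: power2_eq_square algebra_simps)
  then have "0 < (\<Sum>i<r + 3. m i * (\<eta> i * (row i - lam * \<eta> i)))"
    using neq by simp
  then show False
    unfolding row_def m_def by (rule supersolution_contradiction[OF img'])
qed

end

context pentagon_extremal
begin

text \<open>A full part is forced to exceed \<open>N 1\<close> only when class 1 can spare a vertex.
  This leaves the second alternative: a pentagon of single vertices, parts of size at most 2 and at
  least one of size 1. It has at most \<open>2 * r\<close> vertices and is treated
  separately.\<close>

lemma sizes:
  assumes "N 0 \<le> N 1"
  shows "(N 1 \<le> N 0 + 1 \<and> (\<forall>j. 5 \<le> j \<longrightarrow> j < r + 3 \<longrightarrow> N 1 + 1 \<le> N j \<and> N j \<le> N 0 + 2)) \<or>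
    (N 0 = 1 \<and> N 1 = 1 \<and> (\<exists>j. 5 \<le> j \<and> j < r + 3 \<and> N j = 1) \<and> (\<forall>j. 5 \<le> j \<longrightarrow> j < r + 3 \<longrightarrow> N j \<le> 2))"
proof -
  interpret M: pentagon_extremal V E x lam r "reflect_y \<circ> \<kappa>"
    by (rule reflected_y)
  have 1: "N 1 \<le> N 0 + 1"
    using M.N0_le by (simp only: reflected_counts)
  have gt: "N 1 + 1 \<le> N j" if "5 \<le> j" "j < r + 3" "2 \<le> N 1" for j
    using M.part_gt_N0[of j] that by (simp add: reflected_counts del: One_nat_def)
  have le: "N j \<le> N 0 + 2" if "5 \<le> j" "j < r + 3" for j
  proof (cases "2 \<le> N 1")
    case True
    then show ?thesis using part_le_N0 that by blast
  next
    case False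
    then show ?thesis
      using part_le_3[of j] that assms N01_pos by auto
  qed
  show ?thesis
  proof (cases "\<exists>j. 5 \<le> j \<and> j < r + 3 \<and> N j \<le> N 1")
    case True
    then obtain j where j: "5 \<le> j" "j < r + 3" "N j \<le> N 1" by blast
    then have "N 1 = 1"
      using gt[of j] N01_pos by fastforce
    moreover from this have "N 0 = 1" "N j = 1"
      using assms N01_pos j N_pos[of j] by auto
    moreover have "\<forall>i. 5 \<le> i \<longrightarrow> i < r + 3 \<longrightarrow> N i \<le> 2"
      using parts_balanced[OF _ _ j(1,2)] \<open>N j = 1\<close> by fastforce
    ultimately show ?thesis
      using j by blast
  next
    case False
    then show ?thesis
      using 1 le by (metis Suc_eq_plus1 not_less_eq_eq)
  qed
qed

end

subsection \<open>The graph \<open>Y\<^sub>r(n)\<close>\<close>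

lemma fiberwise_bij_betw:
  assumes "finite V" "finite W" "\<And>i. card {a \<in> V. \<sigma> a = i} = card {a \<in> W. \<tau> a = i}"
  obtains \<phi> where "bij_betw \<phi> V W" "\<And>a. a \<in> V \<Longrightarrow> \<tau> (\<phi> a) = \<sigma> a"
proof -
  have "\<exists>g. bij_betw g {a \<in> V. \<sigma> a = i} {a \<in> W. \<tau> a = i}" for i
    using assms by (intro finite_same_card_bij) auto
  then obtain g where g: "\<And>i. bij_betw (g i) {a \<in> V. \<sigma> a = i} {a \<in> W. \<tau> a = i}"
    by metis
  define \<phi> where "\<phi> a = g (\<sigma> a) a" for a
  have \<phi>: "\<phi> a \<in> W" "\<tau> (\<phi> a) = \<sigma> a" if "a \<in> V" for a
    using bij_betw_apply[OF g, of a "\<sigma> a"] that by (auto simp: \<phi>_def)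
  have "inj_on \<phi> V"
  proof (rule inj_onI)
    fix a b assume ab: "a \<in> V" "b \<in> V" "\<phi> a = \<phi> b"
    then have "\<sigma> a = \<sigma> b"
      using \<phi> by metis
    then show "a = b"
      using ab bij_betw_imp_inj_on[OF g, of "\<sigma> a"] by (auto simp: \<phi>_def inj_on_def)
  qed
  moreover have "\<phi> ` V = W"
  proof (intro subset_antisym subsetI)
    fix c assume c: "c \<in> W"
    then have "c \<in> g (\<tau> c) ` {a \<in> V. \<sigma> a = \<tau> c}"
      using bij_betw_imp_surj_on[OF g, of "\<tau> c"] by simp
    then obtain a where a: "a \<in> V" "\<sigma> a = \<tau> c" "c = g (\<tau> c) a"
      by blast
    then have "c = \<phi> a"
      by (simp add: \<phi>_def)
    then show "c \<in> \<phi> ` V"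
      using a(1) by blast
  qed (use \<phi> in auto)
  ultimately show ?thesis
    using that \<phi>(2) by (auto simp: bij_betw_def)
qed

text \<open>The construction for an arbitrary part map \<open>\<tau>\<close> and arbitrary
  \<open>u\<close>, \<open>w\<close>, \<open>v\<close>, so that it can be transported along
  bijections. The fibre of 1 plays the role of the smallest part.\<close>

definition Y_model :: "'a set \<Rightarrow> ('a \<Rightarrow> nat) \<Rightarrow> 'a \<Rightarrow> 'a \<Rightarrow> 'a \<Rightarrow> ('a \<times> 'a) set" where
  "Y_model V \<tau> u w v = {(a, b). a \<in> V \<and> b \<in> V \<and>
     (\<tau> a \<noteq> \<tau> b \<and> \<not> (\<tau> a = 1 \<and> b \<in> {u, w}) \<and> \<not> (\<tau> b = 1 \<and> a \<in> {u, w}) \<or>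
      a = u \<and> b = w \<or> a = w \<and> b = u \<or> a = u \<and> b = v \<or> a = v \<and> b = u \<or>
      a = w \<and> \<tau> b = 1 \<and> b \<noteq> v \<or> b = w \<and> \<tau> a = 1 \<and> a \<noteq> v)}"

lemma Y_graph_eq_Y_model:
  assumes "2 \<le> r" "r + 1 \<le> n"
  shows "parcs (Y_graph r n) = Y_model (pverts (Y_graph r n)) fst (r, 1) (r, 2) (1, 1)"
proof -
  define W where "W = pverts (Y_graph r n)"
  have W: "W = (\<Union>i\<in>{1..r}. turan_part r n i)"
    by (simp add: W_def Y_graph_def Let_def turan_graph_def)
  have part: "a \<in> turan_part r n i \<longleftrightarrow> a \<in> W \<and> fst a = i" if "i \<in> {1..r}" for a i
    using that by (auto simp: W turan_part_def)
  have mem: "(r, 1) \<in> W" "(r, 2) \<in> W" "(1, 1) \<in> W"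
    using Y_graph_vertices_exist[OF assms] assms part[of r] part[of 1] by auto
  have T: "(a, b) \<in> parcs (turan_graph r n) \<longleftrightarrow> a \<in> W \<and> b \<in> W \<and> fst a \<noteq> fst b" for a b
  proof -
    have "(a, b) \<in> parcs (turan_graph r n) \<longleftrightarrow>
        (\<exists>i\<in>{1..r}. \<exists>j\<in>{1..r}. j \<noteq> i \<and> a \<in> turan_part r n i \<and> b \<in> turan_part r n j)"
      by (auto simp: turan_graph_def)
    also have "\<dots> \<longleftrightarrow> a \<in> W \<and> b \<in> W \<and> fst a \<noteq> fst b"
    proof
      assume "\<exists>i\<in>{1..r}. \<exists>j\<in>{1..r}. j \<noteq> i \<and> a \<in> turan_part r n i \<and> b \<in> turan_part r n j"
      then obtain i j where "i \<in> {1..r}" "j \<in> {1..r}" "j \<noteq> i" "a \<in> turan_part r n i" "b \<in> turan_part r n j"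
        by blast
      then show "a \<in> W \<and> b \<in> W \<and> fst a \<noteq> fst b"
        using part[of i a] part[of j b] by simp
    next
      assume ab: "a \<in> W \<and> b \<in> W \<and> fst a \<noteq> fst b"
      then have "fst a \<in> {1..r}" "fst b \<in> {1..r}"
        by (auto simp: W turan_part_def)
      then show "\<exists>i\<in>{1..r}. \<exists>j\<in>{1..r}. j \<noteq> i \<and> a \<in> turan_part r n i \<and> b \<in> turan_part r n j"
        using ab part[of "fst a" a] part[of "fst b" b] by metis
    qed
    finally show ?thesis .
  qed
  have T1: "a \<in> turan_part r n 1 \<longleftrightarrow> a \<in> W \<and> fst a = 1" for a
    using part[of 1] assms by simp
  have "(a, b) \<in> parcs (Y_graph r n) \<longleftrightarrow> (a, b) \<in> Y_model W fst (r, 1) (r, 2) (1, 1)" for a b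
    unfolding Y_graph_def Let_def Y_model_def edges_between_def
    using T[of a b] T1[of a] T1[of b] mem by auto
  then show ?thesis
    unfolding W_def[symmetric] by auto
qed

lemma Y_model_transport:
  assumes "bij_betw \<phi> V W" "\<And>a. a \<in> V \<Longrightarrow> \<tau>' (\<phi> a) = \<tau> a" "{u, w, v} \<subseteq> V"
  shows "map_prod \<phi> \<phi> ` Y_model V \<tau> u w v = Y_model W \<tau>' (\<phi> u) (\<phi> w) (\<phi> v)"
proof -
  have inj: "\<phi> a = \<phi> b \<longleftrightarrow> a = b" if "a \<in> V" "b \<in> V" for a b
    using assms(1) that by (auto simp: bij_betw_def inj_on_def)
  have W: "W = \<phi> ` V"
    using assms(1) by (simp add: bij_betw_def)
  have *: "(\<phi> a, \<phi> b) \<in> Y_model W \<tau>' (\<phi> u) (\<phi> w) (\<phi> v) \<longleftrightarrow> (a, b) \<in> Y_model V \<tau> u w v"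
    if "a \<in> V" "b \<in> V" for a b
    using that assms(2,3) inj by (simp add: Y_model_def W)
  show ?thesis
  proof (intro subset_antisym subsetI)
    fix e assume "e \<in> map_prod \<phi> \<phi> ` Y_model V \<tau> u w v"
    then obtain a b where "(a, b) \<in> Y_model V \<tau> u w v" "e = (\<phi> a, \<phi> b)"
      by auto
    moreover from this have "a \<in> V" "b \<in> V"
      by (simp_all add: Y_model_def)
    ultimately show "e \<in> Y_model W \<tau>' (\<phi> u) (\<phi> w) (\<phi> v)"
      using * by simp
  next
    fix e assume e: "e \<in> Y_model W \<tau>' (\<phi> u) (\<phi> w) (\<phi> v)"
    then obtain c d where "e = (c, d)" "c \<in> W" "d \<in> W"
      by (auto simp: Y_model_def)
    then obtain a b where "e = (\<phi> a, \<phi> b)" "a \<in> V" "b \<in> V"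
      by (auto simp: W)
    then show "e \<in> map_prod \<phi> \<phi> ` Y_model V \<tau> u w v"
      using e * by (auto intro: image_eqI[of _ _ "(a, b)"])
  qed
qed

text \<open>For values in \<open>{q, q + 1}\<close> the sum determines how often each value occurs,
  so both size lists have the same multiset of values.\<close>

lemma balanced_permutation:
  fixes s t :: "nat \<Rightarrow> nat"
  assumes "finite M" "\<And>i. i \<in> M \<Longrightarrow> q \<le> s i \<and> s i \<le> q + 1" "\<And>i. i \<in> M \<Longrightarrow> q \<le> t i \<and> t i \<le> q + 1"
    and "sum s M = sum t M"
  obtains \<pi> where "bij_betw \<pi> M M" "\<And>i. i \<in> M \<Longrightarrow> t (\<pi> i) = s i"
proof -
  have sum: "sum f M = q * card M + card {i \<in> M. f i = q + 1}" "card {i \<in> M. f i = q} + card {i \<in> M. f i = q + 1} = card M"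
    "l \<noteq> q \<Longrightarrow> l \<noteq> q + 1 \<Longrightarrow> {i \<in> M. f i = l} = {}"
    if f: "\<And>i. i \<in> M \<Longrightarrow> q \<le> f i \<and> f i \<le> q + 1" for f :: "nat \<Rightarrow> nat" and l
  proof -
    have "f i = q + (if f i = q + 1 then 1 else 0)" if "i \<in> M" for i
      using f[OF that] by auto
    then have "sum f M = (\<Sum>i\<in>M. q + (if f i = q + 1 then 1 else 0))"
      by (rule sum.cong[OF refl])
    also have "\<dots> = q * card M + card {i \<in> M. f i = q + 1}"
      using assms(1) by (simp add: sum.distrib sum.If_cases Int_def)
    finally show "sum f M = q * card M + card {i \<in> M. f i = q + 1}" .
    have "{i \<in> M. f i = q} \<union> {i \<in> M. f i = q + 1} = M"
      using f by fastforce
    moreover have "card ({i \<in> M. f i = q} \<union> {i \<in> M. f i = q + 1}) = card {i \<in> M. f i = q} + card {i \<in> M. f i = q + 1}"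
      using assms(1) by (intro card_Un_disjoint) auto
    ultimately show "card {i \<in> M. f i = q} + card {i \<in> M. f i = q + 1} = card M"
      by simp
    show "l \<noteq> q \<Longrightarrow> l \<noteq> q + 1 \<Longrightarrow> {i \<in> M. f i = l} = {}"
      using f by fastforce
  qed
  have 1: "card {i \<in> M. s i = q + 1} = card {i \<in> M. t i = q + 1}"
    using sum(1)[where f = s, OF assms(2)] sum(1)[where f = t, OF assms(3)] assms(4) by simp
  then have 2: "card {i \<in> M. s i = q} = card {i \<in> M. t i = q}"
    using sum(2)[where f = s, OF assms(2)] sum(2)[where f = t, OF assms(3)] by simp
  have "card {i \<in> M. s i = l} = card {i \<in> M. t i = l}" for l
  proof (cases "l = q \<or> l = q + 1")
    case True
    then show ?thesis using 1 2 by auto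
  next
    case False
    then have "{i \<in> M. s i = l} = {}" "{i \<in> M. t i = l} = {}"
      using sum(3)[where f = s, OF assms(2)] sum(3)[where f = t, OF assms(3)] by blast+
    then show ?thesis by (simp only:)
  qed
  then show ?thesis
    using fiberwise_bij_betw[OF assms(1,1), of s t] that by blast
qed

text \<open>The parts between the first and the last may come in any order, whereas
  \<open>turan_part\<close> sorts them by size. Balance and the total \<open>n\<close> fix the first
  and last sizes; a permutation aligns the middle ones.\<close>

lemma Y_model_iso:
  assumes r: "2 \<le> r" and V: "finite V" "card V = n" and \<tau>: "\<tau> ` V \<subseteq> {1..r}"
    and uwv: "{u, w, v} \<subseteq> V" "u \<noteq> w" "\<tau> u = r" "\<tau> w = r" "\<tau> v = 1" "r + 1 \<le> n"
    and sizes: "card {a \<in> V. \<tau> a = 1} = q" "card {a \<in> V. \<tau> a = r} \<le> q + 1"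
      "\<And>i. i \<in> {1..r} \<Longrightarrow> q \<le> card {a \<in> V. \<tau> a = i} \<and> card {a \<in> V. \<tau> a = i} \<le> card {a \<in> V. \<tau> a = r}"
  shows "\<exists>\<phi>. bij_betw \<phi> V (pverts (Y_graph r n)) \<and>
    map_prod \<phi> \<phi> ` Y_model V \<tau> u w v = parcs (Y_graph r n)"
proof -
  define s where "s i = card {a \<in> V. \<tau> a = i}" for i
  define t where "t i = (n + i - 1) div r" for i
  have s: "s 1 = q" "s r \<le> q + 1" "i \<in> {1..r} \<Longrightarrow> q \<le> s i \<and> s i \<le> s r" for i
    using sizes by (simp_all add: s_def)
  have ssum: "(\<Sum>i\<in>{1..r}. s i) = n"
  proof -
    have "(\<Sum>a\<in>V. 1) = (\<Sum>i\<in>{1..r}. \<Sum>a | a \<in> V \<and> \<tau> a = i. (1 :: nat))"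
      using V \<tau> by (intro sum.group[symmetric]) auto
    then show ?thesis
      using V by (simp add: s_def)
  qed
  have tsum: "(\<Sum>i\<in>{1..r}. t i) = n"
    unfolding t_def using sum_turan_sizes[of r n] r by simp
  define M where "M = {2..<r}"
  have "{1..r} = insert 1 (insert r M)"
    using r by (auto simp: M_def)
  then have split: "(\<Sum>i\<in>{1..r}. f i) = f 1 + (f r + sum f M)" for f :: "nat \<Rightarrow> nat"
    using r by (simp add: M_def)
  have t1: "t 1 = s 1" and tr: "t r = s r"
  proof -
    \<comment> \<open>The remainder stays below \<open>r\<close> because part 1 has size
      \<open>q\<close> even when the last part has size \<open>q + 1\<close>.\<close>
    have "\<exists>e<r. n = r * q + e \<and> (s r = q \<and> e = 0 \<or> s r = q + 1 \<and> 0 < e)"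
    proof (cases "s r = q")
      case True
      then have "(\<Sum>i\<in>{1..r}. s i) = (\<Sum>i\<in>{1..r}. q)"
        using s(3) by (intro sum.cong) fastforce+
      then show ?thesis
        using ssum True r by (intro exI[of _ 0]) simp
    next
      case False
      then have sr: "s r = q + 1"
        using s(2) s(3)[of r] r by simp
      have Mc: "card M = r - 2"
        by (simp add: M_def)
      have "sum s M \<le> card M * (q + 1)" "card M * q \<le> sum s M"
        using s(3) sr sum_bounded_above[of M s "q + 1"] sum_bounded_below[of M q s] by (auto simp: M_def)
      moreover have "n = q + (q + 1 + sum s M)"
        using split[of s] ssum s(1) sr by simp
      ultimately have "n \<le> q + (q + 1) + (r - 2) * (q + 1)" "q + (q + 1) + (r - 2) * q \<le> n"
        unfolding Mc by linarith+
      moreover obtain r' where r': "r = r' + 2"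
        using r by (metis add.commute le_Suc_ex)
      ultimately have "r * q + 1 \<le> n" "n < r * q + r"
        by (simp_all add: algebra_simps)
      then show ?thesis
        using sr by (intro exI[of _ "n - r * q"]) auto
    qed
    then obtain e where e: "e < r" "n = r * q + e" "s r = q \<and> e = 0 \<or> s r = q + 1 \<and> 0 < e"
      by blast
    show "t 1 = s 1"
      using e s(1) by (simp add: t_def)
    have "(r * q + r - 1) div r = q"
      using r by (intro div_nat_eqI) (simp_all add: algebra_simps)
    moreover have "(r * q + e + r - 1) div r = q + 1" if "0 < e"
      using r e(1) that by (intro div_nat_eqI) (simp_all add: algebra_simps)
    ultimately show "t r = s r"
      using e(2,3) unfolding t_def by auto
  qed
  have "q \<le> t i \<and> t i \<le> q + 1" if "i \<in> M" for i
  proof -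
    have "t 1 \<le> t i" "t i \<le> t r"
      unfolding t_def using that by (auto simp: M_def intro!: div_le_mono)
    then show ?thesis
      using t1 tr s by simp
  qed
  moreover have "q \<le> s i \<and> s i \<le> q + 1" if "i \<in> M" for i
    using s(3)[of i] s(2) that by (auto simp: M_def)
  moreover have "sum s M = sum t M"
    using split[of s] split[of t] ssum tsum t1 tr by simp
  moreover have "finite M"
    by (simp add: M_def)
  ultimately obtain \<pi> where \<pi>: "bij_betw \<pi> M M" "\<And>i. i \<in> M \<Longrightarrow> t (\<pi> i) = s i"
    using balanced_permutation[of M q s t] by metis
  define \<rho> where "\<rho> i = (if i \<in> M then \<pi> i else i)" for i
  have \<rho>M: "\<rho> i \<in> M \<longleftrightarrow> i \<in> M" for i
    using bij_betw_apply[OF \<pi>(1)] by (auto simp: \<rho>_def)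
  have \<rho>inj: "\<rho> i = \<rho> j \<longleftrightarrow> i = j" for i j
    using \<rho>M[of i] \<rho>M[of j] \<pi>(1) by (auto simp: \<rho>_def bij_betw_def inj_on_def split: if_splits)
  have \<rho>1: "\<rho> 1 = 1" "\<rho> r = r"
    using r by (auto simp: \<rho>_def M_def)
  have \<rho>t: "t (\<rho> i) = s i" if "i \<in> {1..r}" for i
  proof (cases "i \<in> M")
    case False
    then have "i = 1 \<or> i = r"
      using that by (auto simp: M_def)
    then show ?thesis
      using t1 tr \<rho>1 by auto
  qed (simp add: \<rho>_def \<pi>(2))
  have \<rho>rng: "\<rho> i \<in> {1..r}" if "i \<in> {1..r}" for i
    using that \<rho>M[of i] by (cases "i \<in> M") (auto simp: M_def \<rho>_def)
  have \<rho>surj: "\<exists>j\<in>{1..r}. \<rho> j = i" if "i \<in> {1..r}" for i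
  proof -
    have "inj_on \<rho> {1..r}" "\<rho> ` {1..r} \<subseteq> {1..r}"
      using \<rho>inj \<rho>rng by (auto simp: inj_on_def)
    then have "\<rho> ` {1..r} = {1..r}"
      by (intro endo_inj_surj) auto
    then show ?thesis
      using that by (metis imageE)
  qed
  define W where "W = pverts (Y_graph r n)"
  have W: "W = (\<Union>i\<in>{1..r}. turan_part r n i)"
    by (simp add: W_def Y_graph_def Let_def turan_graph_def)
  have finW: "finite W"
    unfolding W by (simp add: turan_part_def)
  have mem: "(r, 1) \<in> W" "(r, 2) \<in> W" "(1, 1) \<in> W"
    using Y_graph_vertices_exist[OF r uwv(6)] r unfolding W by auto
  have cardW: "card {a \<in> W. fst a = i} = (if i \<in> {1..r} then t i else 0)" for i
  proof (cases "i \<in> {1..r}")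
    case True
    then have "{a \<in> W. fst a = i} = turan_part r n i"
      by (auto simp: W turan_part_def)
    then show ?thesis
      using True by (simp add: turan_part_def t_def)
  next
    case False
    then have *: "{a \<in> W. fst a = i} = {}"
      by (auto simp: W turan_part_def)
    show ?thesis
      unfolding * by (simp only: card.empty False if_False)
  qed
  define \<sigma> where "\<sigma> a = \<rho> (\<tau> a)" for a
  have cardV: "card {a \<in> V. \<sigma> a = i} = (if i \<in> {1..r} then t i else 0)" for i
  proof (cases "i \<in> {1..r}")
    case True
    obtain j where j: "j \<in> {1..r}" "\<rho> j = i"
      by (rule bexE[OF \<rho>surj[OF True]])
    have "{a \<in> V. \<sigma> a = i} = {a \<in> V. \<tau> a = j}"
      unfolding \<sigma>_def j(2)[symmetric] \<rho>inj ..
    then show ?thesis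
      using \<rho>t[OF j(1)] j(2) True by (simp add: s_def)
  next
    case False
    have "\<sigma> a \<noteq> i" if "a \<in> V" for a
      using False \<rho>rng[of "\<tau> a"] \<tau> that unfolding \<sigma>_def by blast
    then have *: "{a \<in> V. \<sigma> a = i} = {}"
      by blast
    show ?thesis
      unfolding * by (simp only: card.empty False if_False)
  qed
  have \<sigma>: "\<sigma> u = r" "\<sigma> w = r" "\<sigma> v = 1"
    using uwv \<rho>1 by (simp_all add: \<sigma>_def)
  have vne: "v \<noteq> u" "v \<noteq> w"
    using uwv r by auto
  \<comment> \<open>The three distinguished vertices are set aside, so that the fibrewise bijection
    of the rest can be extended by prescribed images.\<close>
  define V0 where "V0 = V - {u, w, v}"
  define W0 where "W0 = W - {(r, 1), (r, 2), (1, 1)}"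
  have "card {a \<in> V0. \<sigma> a = i} = card {a \<in> W0. fst a = i}" for i
  proof -
    have "{a \<in> V0. \<sigma> a = i} = {a \<in> V. \<sigma> a = i} - (if i = r then {u, w} else if i = 1 then {v} else {})"
      using \<sigma> r by (auto simp: V0_def)
    moreover have "{a \<in> W0. fst a = i} = {a \<in> W. fst a = i} - (if i = r then {(r, 1), (r, 2)} else if i = 1 then {(1, 1)} else {})"
      using r by (auto simp: W0_def)
    moreover have "card ({a \<in> V. \<sigma> a = i} - (if i = r then {u, w} else if i = 1 then {v} else {})) =
        card {a \<in> V. \<sigma> a = i} - (if i = r then 2 else if i = 1 then 1 else 0)"
      using uwv \<sigma> r V(1) by (auto simp: card_Diff_subset)
    moreover have "card ({a \<in> W. fst a = i} - (if i = r then {(r, 1), (r, 2)} else if i = 1 then {(1, 1)} else {})) =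
        card {a \<in> W. fst a = i} - (if i = r then 2 else if i = 1 then 1 else 0)"
      using mem r finW by (auto simp: card_Diff_subset)
    ultimately show ?thesis
      by (simp only: cardV cardW)
  qed
  then obtain \<psi> where \<psi>: "bij_betw \<psi> V0 W0" "\<And>a. a \<in> V0 \<Longrightarrow> fst (\<psi> a) = \<sigma> a"
    using fiberwise_bij_betw[of V0 W0 \<sigma> fst] V(1) finW by (auto simp: V0_def W0_def)
  define \<phi> where "\<phi> = \<psi>(u := (r, 1), w := (r, 2), v := (1, 1))"
  have \<phi>s: "\<phi> u = (r, 1)" "\<phi> w = (r, 2)" "\<phi> v = (1, 1)"
    using uwv(2) vne by (simp_all add: \<phi>_def)
  have \<phi>0: "\<phi> a = \<psi> a" if "a \<in> V0" for a
    using that by (simp add: \<phi>_def V0_def)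
  have "bij_betw \<phi> (V0 \<union> {u, w, v}) (W0 \<union> {(r, 1), (r, 2), (1, 1)})"
  proof (rule bij_betw_combine)
    show "bij_betw \<phi> V0 W0"
      using \<psi>(1) \<phi>0 by (simp cong: bij_betw_cong)
    show "bij_betw \<phi> {u, w, v} {(r, 1), (r, 2), (1, 1)}"
      using \<phi>s uwv(2) vne r by (auto simp: bij_betw_def inj_on_def)
    show "W0 \<inter> {(r, 1), (r, 2), (1, 1)} = {}"
      by (auto simp: W0_def)
  qed
  moreover have "V0 \<union> {u, w, v} = V" "W0 \<union> {(r, 1), (r, 2), (1, 1)} = W"
    using uwv(1) mem by (auto simp: V0_def W0_def)
  ultimately have bij: "bij_betw \<phi> V W"
    by simp
  have \<phi>\<sigma>: "fst (\<phi> a) = \<sigma> a" if "a \<in> V" for a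
    using that \<phi>s \<phi>0[of a] \<psi>(2)[of a] \<sigma> by (cases "a \<in> V0") (auto simp: V0_def)
  have "Y_model V \<tau> u w v = Y_model V \<sigma> u w v"
  proof -
    have "\<tau> a = \<tau> b \<longleftrightarrow> \<sigma> a = \<sigma> b" "\<tau> a = 1 \<longleftrightarrow> \<sigma> a = 1" for a b
      using \<rho>inj[of "\<tau> a" "\<tau> b"] \<rho>inj[of "\<tau> a" 1] \<rho>1 by (simp_all add: \<sigma>_def)
    then show ?thesis
      by (simp add: Y_model_def)
  qed
  moreover have "map_prod \<phi> \<phi> ` Y_model V \<sigma> u w v = parcs (Y_graph r n)"
    using Y_model_transport[where \<tau>' = fst and \<tau> = \<sigma>, OF bij \<phi>\<sigma> uwv(1)] Y_graph_eq_Y_model[OF r uwv(6)] \<phi>s by (simp add: W_def)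
  ultimately show ?thesis
    using bij by (auto simp: W_def)
qed

section \<open>Embeddings, isomorphisms and the spectral radius\<close>

lemma quad_le_of_embedding:
  assumes H: "pair_graph H" and \<phi>: "bij_betw \<phi> V (pverts H)" and E: "E \<subseteq> V \<times> V"
    and sub: "map_prod \<phi> \<phi> ` E \<subseteq> parcs H" and V: "V \<noteq> {}" and x: "\<And>a. a \<in> V \<Longrightarrow> 0 \<le> x a"
  shows "quad E x \<le> graph_spectral_radius H * (\<Sum>a\<in>V. (x a)\<^sup>2)"
proof -
  interpret H: pair_graph H by fact
  have ne: "pverts H \<noteq> {}"
    using V bij_betw_imp_surj_on[OF \<phi>] by auto
  define y where "y b = x (the_inv_into V \<phi> b)" for b
  have y: "y (\<phi> a) = x a" if "a \<in> V" for a
    using that \<phi> by (simp add: y_def bij_betw_def the_inv_into_f_f)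
  have "quad E x = quad E (y \<circ> \<phi>)"
    unfolding quad_def using E y by (intro sum.cong) auto
  also have "\<dots> = quad (map_prod \<phi> \<phi> ` E) y"
    using quad_bij[OF bij_betw_imp_inj_on[OF \<phi>] E] by simp
  also have "\<dots> \<le> quad (parcs H) y"
  proof (rule quad_mono)
    show "finite (parcs H)" by (rule H.pair_finite_arcs)
    fix b c assume "(b, c) \<in> parcs H"
    then have "b \<in> \<phi> ` V" "c \<in> \<phi> ` V"
      using H.in_arcsD1 H.in_arcsD2 bij_betw_imp_surj_on[OF \<phi>] by auto
    then show "0 \<le> y b \<and> 0 \<le> y c"
      using x y by auto
  qed (rule sub)
  also have "\<dots> \<le> graph_spectral_radius H * (\<Sum>b\<in>pverts H. (y b)\<^sup>2)"
    using graph_spectral_radius_rayleigh[OF H ne] by metis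
  also have "(\<Sum>b\<in>pverts H. (y b)\<^sup>2) = (\<Sum>a\<in>V. (x a)\<^sup>2)"
    using sum.reindex_bij_betw[OF \<phi>, of "\<lambda>b. (y b)\<^sup>2"] y by simp
  finally show ?thesis .
qed

lemma spectral_radius_le_of_embedding:
  assumes G: "pair_graph G" "pverts G \<noteq> {}" and H: "pair_graph H"
    and \<phi>: "bij_betw \<phi> (pverts G) (pverts H)" "map_prod \<phi> \<phi> ` parcs G \<subseteq> parcs H"
  shows "graph_spectral_radius G \<le> graph_spectral_radius H"
proof -
  interpret G: pair_graph G by fact
  obtain x where x: "\<And>u. 0 \<le> x u" "(\<Sum>u\<in>pverts G. (x u)\<^sup>2) = 1"
    "quad (parcs G) x = graph_spectral_radius G"
    using graph_spectral_radius_rayleigh[OF G] by metis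
  have "parcs G \<subseteq> pverts G \<times> pverts G"
    using G.in_arcsD1 G.in_arcsD2 by auto
  then have "quad (parcs G) x \<le> graph_spectral_radius H * (\<Sum>u\<in>pverts G. (x u)\<^sup>2)"
    by (rule quad_le_of_embedding[OF H \<phi>(1) _ \<phi>(2) G(2) x(1)])
  then show ?thesis
    using x by simp
qed

lemma spectral_radius_eq_of_iso:
  assumes G: "pair_graph G" "pverts G \<noteq> {}" and H: "pair_graph H"
    and \<phi>: "bij_betw \<phi> (pverts G) (pverts H)" "map_prod \<phi> \<phi> ` parcs G = parcs H"
  shows "graph_spectral_radius G = graph_spectral_radius H"
proof (rule antisym)
  interpret G: pair_graph G by fact
  show "graph_spectral_radius G \<le> graph_spectral_radius H"
    using spectral_radius_le_of_embedding[OF G H \<phi>(1)] \<phi>(2) by simp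
  define \<psi> where "\<psi> = the_inv_into (pverts G) \<phi>"
  have inv: "\<psi> (\<phi> a) = a" if "a \<in> pverts G" for a
    using that \<phi>(1) by (simp add: \<psi>_def bij_betw_def the_inv_into_f_f)
  have "map_prod \<psi> \<psi> ` parcs H \<subseteq> parcs G"
    unfolding \<phi>(2)[symmetric] using inv G.in_arcsD1 G.in_arcsD2 by (auto simp: image_iff)
  moreover have "bij_betw \<psi> (pverts H) (pverts G)"
    unfolding \<psi>_def by (rule bij_betw_the_inv_into[OF \<phi>(1)])
  moreover have "pverts H \<noteq> {}"
    using G(2) bij_betw_imp_surj_on[OF \<phi>(1)] by auto
  ultimately show "graph_spectral_radius H \<le> graph_spectral_radius G"
    using spectral_radius_le_of_embedding[OF H _ G(1)] by blast
qed

text \<open>Tail and head are the projections on both sides, so the arc map of an isomorphism is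
  forced to be \<open>map_prod \<phi> \<phi>\<close>.\<close>

lemma digraph_iso_with_proj_iff:
  assumes G: "pair_graph G"
  shows "digraph_iso (with_proj G) (with_proj H) \<longleftrightarrow>
    (\<exists>\<phi>. bij_betw \<phi> (pverts G) (pverts H) \<and> map_prod \<phi> \<phi> ` parcs G = parcs H)"
proof
  interpret G: pair_graph G by fact
  {
    assume "digraph_iso (with_proj G) (with_proj H)"
    then obtain f where f: "pre_digraph.digraph_isomorphism (with_proj G) f" "with_proj H = app_iso f (with_proj G)"
      unfolding digraph_iso_def by blast
    define \<phi> where "\<phi> = iso_verts f"
    have eqs: "pverts H = \<phi> ` pverts G" "parcs H = iso_arcs f ` parcs G" "fst = iso_tail f" "snd = iso_head f"
      using f(2) unfolding with_proj_def app_iso_def \<phi>_def by auto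
    have iso: "inj_on \<phi> (pverts G)" "\<And>a. a \<in> parcs G \<Longrightarrow> \<phi> (fst a) = fst (iso_arcs f a) \<and> \<phi> (snd a) = snd (iso_arcs f a)"
      using f(1) unfolding pre_digraph.digraph_isomorphism_def \<phi>_def eqs(3)[symmetric] eqs(4)[symmetric]
      by auto
    have "iso_arcs f a = map_prod \<phi> \<phi> a" if "a \<in> parcs G" for a
      using iso(2)[OF that] by (simp add: prod_eq_iff)
    then have "map_prod \<phi> \<phi> ` parcs G = parcs H"
      unfolding eqs(2) by (intro image_cong) auto
    then show "\<exists>\<phi>. bij_betw \<phi> (pverts G) (pverts H) \<and> map_prod \<phi> \<phi> ` parcs G = parcs H"
      using iso(1) eqs(1) by (auto simp: bij_betw_def)
  }
  {
    assume "\<exists>\<phi>. bij_betw \<phi> (pverts G) (pverts H) \<and> map_prod \<phi> \<phi> ` parcs G = parcs H"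
    then obtain \<phi> where \<phi>: "inj_on \<phi> (pverts G)" "\<phi> ` pverts G = pverts H" "map_prod \<phi> \<phi> ` parcs G = parcs H"
      by (auto simp: bij_betw_def)
    define f where "f = \<lparr>iso_verts = \<phi>, iso_arcs = map_prod \<phi> \<phi>, iso_head = snd, iso_tail = fst\<rparr>"
    have "parcs G \<subseteq> pverts G \<times> pverts G"
      using G.in_arcsD1 G.in_arcsD2 by auto
    then have "inj_on (map_prod \<phi> \<phi>) (parcs G)"
      using inj_on_subset[OF map_prod_inj_on[OF \<phi>(1) \<phi>(1)]] by blast
    moreover have "wf_digraph (with_proj G)"
      by (rule G.wf_digraph)
    ultimately have "pre_digraph.digraph_isomorphism (with_proj G) f"
      unfolding pre_digraph.digraph_isomorphism_def using \<phi>(1) by (auto simp: f_def)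
    moreover have "with_proj H = app_iso f (with_proj G)"
      using \<phi> by (simp add: with_proj_def app_iso_def f_def)
    ultimately show "digraph_iso (with_proj G) (with_proj H)"
      unfolding digraph_iso_def by blast
  }
qed

subsection \<open>Comparison with \<open>Y\<^sub>r(n)\<close>\<close>

lemma card_label_preimage:
  assumes "finite V" "\<kappa> ` V \<subseteq> {..<k}" "{l. l < k \<and> g l = i} = L"
  shows "card {a \<in> V. (g \<circ> \<kappa>) a = i} = (\<Sum>l\<in>L. label_count V \<kappa> l)"
proof -
  have finL: "finite L"
    unfolding assms(3)[symmetric] by simp
  have "{a \<in> V. (g \<circ> \<kappa>) a = i} = (\<Union>l\<in>L. {a \<in> V. \<kappa> a = l})"
    unfolding assms(3)[symmetric] using assms(2) by auto
  also have "card \<dots> = (\<Sum>l\<in>L. card {a \<in> V. \<kappa> a = l})"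
    using finL assms(1) by (intro card_UN_disjoint) auto
  finally show ?thesis
    by (simp add: label_count_def)
qed

definition part_of_label :: "nat \<Rightarrow> nat \<Rightarrow> nat" where
  "part_of_label r l = (if l = 1 \<or> l = 2 then 1 else if l = 0 \<or> l = 3 \<or> l = 4 then r else l - 3)"

lemma part_of_label_preimage:
  assumes "2 \<le> r"
  shows "{l. l < r + 3 \<and> part_of_label r l = 1} = {1, 2}"
    "{l. l < r + 3 \<and> part_of_label r l = r} = {0, 3, 4}"
    "2 \<le> i \<Longrightarrow> i < r \<Longrightarrow> {l. l < r + 3 \<and> part_of_label r l = i} = {i + 3}"
  using assms by (auto simp: part_of_label_def split: if_splits)

lemma part_of_label_range: "2 \<le> r \<Longrightarrow> l < r + 3 \<Longrightarrow> part_of_label r l \<in> {1..r}"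
  by (auto simp: part_of_label_def)

lemma lab_graph_eq_Y_model:
  assumes r: "2 \<le> r" and \<kappa>: "\<kappa> ` V \<subseteq> {..<r + 3}"
    and single: "\<And>a. a \<in> V \<Longrightarrow> \<kappa> a = 3 \<longleftrightarrow> a = u" "\<And>a. a \<in> V \<Longrightarrow> \<kappa> a = 4 \<longleftrightarrow> a = w"
      "\<And>a. a \<in> V \<Longrightarrow> \<kappa> a = 2 \<longleftrightarrow> a = v"
  shows "lab_graph V \<kappa> = Y_model V (part_of_label r \<circ> \<kappa>) u w v"
proof -
  have "(a, b) \<in> lab_graph V \<kappa> \<longleftrightarrow> (a, b) \<in> Y_model V (part_of_label r \<circ> \<kappa>) u w v"
    if ab: "a \<in> V" "b \<in> V" for a b
  proof -
    define i where "i = \<kappa> a"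
    define j where "j = \<kappa> b"
    have lt: "i < r + 3" "j < r + 3"
      using \<kappa> ab by (auto simp: i_def j_def)
    have sa: "a = u \<longleftrightarrow> i = 3" "a = w \<longleftrightarrow> i = 4" "a = v \<longleftrightarrow> i = 2"
      and sb: "b = u \<longleftrightarrow> j = 3" "b = w \<longleftrightarrow> j = 4" "b = v \<longleftrightarrow> j = 2"
      using single[OF ab(1)] single[OF ab(2)] by (simp_all add: i_def j_def)
    have "(a, b) \<in> Y_model V (part_of_label r \<circ> \<kappa>) u w v \<longleftrightarrow>
       (part_of_label r i \<noteq> part_of_label r j \<and> \<not> (part_of_label r i = 1 \<and> (j = 3 \<or> j = 4)) \<and>
          \<not> (part_of_label r j = 1 \<and> (i = 3 \<or> i = 4)) \<or>
        i = 3 \<and> j = 4 \<or> i = 4 \<and> j = 3 \<or> i = 3 \<and> j = 2 \<or> i = 2 \<and> j = 3 \<or>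
        i = 4 \<and> part_of_label r j = 1 \<and> j \<noteq> 2 \<or> j = 4 \<and> part_of_label r i = 1 \<and> i \<noteq> 2)"
      using ab by (simp add: Y_model_def i_def[symmetric] j_def[symmetric] sa sb)
    also have "\<dots> \<longleftrightarrow> lab_adj i j"
    proof -
      have "i = 0 \<or> i = 1 \<or> i = 2 \<or> i = 3 \<or> i = 4 \<or> 5 \<le> i" "j = 0 \<or> j = 1 \<or> j = 2 \<or> j = 3 \<or> j = 4 \<or> 5 \<le> j"
        by arith+
      then show ?thesis
        using r lt by (elim disjE) (auto simp: part_of_label_def lab_adj_def)
    qed
    also have "lab_adj i j \<longleftrightarrow> (a, b) \<in> lab_graph V \<kappa>"
      using ab by (simp add: lab_graph_def i_def j_def)
    finally show ?thesis by simp
  qed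
  note eq = this
  show ?thesis
  proof (intro subset_antisym subrelI)
    fix a b assume ab: "(a, b) \<in> lab_graph V \<kappa>"
    then have "a \<in> V" "b \<in> V"
      by (simp_all only: lab_graph_def mem_Collect_eq prod.case)
    then show "(a, b) \<in> Y_model V (part_of_label r \<circ> \<kappa>) u w v"
      using ab by (simp only: eq)
  next
    fix a b assume ab: "(a, b) \<in> Y_model V (part_of_label r \<circ> \<kappa>) u w v"
    then have "a \<in> V" "b \<in> V"
      by (simp_all only: Y_model_def mem_Collect_eq prod.case)
    then show "(a, b) \<in> lab_graph V \<kappa>"
      using ab by (simp only: eq)
  qed
qed

text \<open>For small \<open>n\<close>, when label 0 is empty and part \<open>j\<close> is a single
  vertex. Then label 1 alone is the first part, and the vertices labelled \<open>j\<close> and 3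
  form the last part, their edge being the added edge \<open>uw\<close>; the nonadjacent vertices
  labelled 2 and 4 share a part. The nonadjacency of labels 1 and 3 is the deleted edge.\<close>

definition alt_part :: "nat \<Rightarrow> nat \<Rightarrow> nat \<Rightarrow> nat" where
  "alt_part r j l = (if l = 1 then 1 else if l = 3 \<or> l = j then r
     else if l = 2 \<or> l = 4 then j - 3 else l - 3)"

context
  fixes r j :: nat
  assumes r2: "2 \<le> r" and j: "5 \<le> j" "j < r + 3"
begin

lemma label_cases:
  assumes "i \<noteq> 0"
  obtains "i = 1" | "i = 2" | "i = 3" | "i = 4" | "i = j" | "5 \<le> i" "i \<noteq> j"
  using assms by linarith

lemma alt_part_eq_1_iff:
  assumes "i \<noteq> 0"
  shows "alt_part r j i = 1 \<longleftrightarrow> i = 1"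
  using assms by (cases rule: label_cases) (use r2 j in \<open>simp_all add: alt_part_def\<close>)

lemma alt_part_range:
  assumes "i \<noteq> 0" "i < r + 3"
  shows "alt_part r j i \<in> {1..r}"
  using assms(1) by (cases rule: label_cases) (use r2 j assms(2) in \<open>auto simp: alt_part_def\<close>)

lemma alt_part_preimage:
  shows "{l. l < r + 3 \<and> alt_part r j l = 1} = {1}"
    and "{l. l < r + 3 \<and> alt_part r j l = r} = {3, j}"
    and "{l. l < r + 3 \<and> alt_part r j l = j - 3} = {2, 4}"
    and "2 \<le> i \<Longrightarrow> i < r \<Longrightarrow> i \<noteq> j - 3 \<Longrightarrow> {l. l < r + 3 \<and> alt_part r j l = i} = {i + 3}"
  using r2 j by (auto simp: alt_part_def split: if_splits)

lemma alt_part_lab_adj: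
  assumes k: "k \<noteq> 0" "k < r + 3" and l: "l \<noteq> 0" "l < r + 3" and kl: "lab_adj k l"
  shows "alt_part r j k \<noteq> alt_part r j l \<and> (k, l) \<noteq> (1, 3) \<and> (k, l) \<noteq> (3, 1) \<or> (k, l) = (3, j) \<or> (k, l) = (j, 3)"
  using k(1)
proof (cases rule: label_cases)
  case 1
  from l(1) show ?thesis
    by (cases rule: label_cases) (use 1 kl r2 j l(2) in \<open>auto simp: alt_part_def lab_adj_def\<close>)
next
  case 2
  from l(1) show ?thesis
    by (cases rule: label_cases) (use 2 kl r2 j l(2) in \<open>auto simp: alt_part_def lab_adj_def\<close>)
next
  case 3
  from l(1) show ?thesis
    by (cases rule: label_cases) (use 3 kl r2 j l(2) in \<open>auto simp: alt_part_def lab_adj_def\<close>)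
next
  case 4
  from l(1) show ?thesis
    by (cases rule: label_cases) (use 4 kl r2 j l(2) in \<open>auto simp: alt_part_def lab_adj_def\<close>)
next
  case 5
  from l(1) show ?thesis
    by (cases rule: label_cases) (use 5 kl r2 j l(2) in \<open>auto simp: alt_part_def lab_adj_def\<close>)
next
  case 6
  from l(1) show ?thesis
    by (cases rule: label_cases) (use 6 kl r2 j k(2) l(2) in \<open>auto simp: alt_part_def lab_adj_def\<close>)
qed

end

lemma single_label:
  assumes "label_count V \<kappa> i = 1"
  shows "\<exists>a. a \<in> V \<and> (\<forall>b\<in>V. \<kappa> b = i \<longleftrightarrow> b = a)"
proof -
  obtain a where "{w \<in> V. \<kappa> w = i} = {a}"
    using assms unfolding label_count_def by (auto simp: card_1_singleton_iff)
  then show ?thesis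
    by (intro exI[of _ a]) auto
qed

lemma lab_graph_iso_Y_graph:
  assumes r: "2 \<le> r" and V: "finite V" "r + 1 \<le> card V" and \<kappa>: "\<kappa> ` V \<subseteq> {..<r + 3}"
    and N: "label_count V \<kappa> 2 = 1" "label_count V \<kappa> 3 = 1" "label_count V \<kappa> 4 = 1"
    and le: "label_count V \<kappa> 0 \<le> label_count V \<kappa> 1" "label_count V \<kappa> 1 \<le> label_count V \<kappa> 0 + 1"
    and sizes: "\<And>j. 5 \<le> j \<Longrightarrow> j < r + 3 \<Longrightarrow>
      label_count V \<kappa> 1 + 1 \<le> label_count V \<kappa> j \<and> label_count V \<kappa> j \<le> label_count V \<kappa> 0 + 2"
  shows "\<exists>\<phi>. bij_betw \<phi> V (pverts (Y_graph r (card V))) \<and>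
    map_prod \<phi> \<phi> ` lab_graph V \<kappa> = parcs (Y_graph r (card V))"
proof -
  obtain v where v': "v \<in> V" "\<forall>a\<in>V. \<kappa> a = 2 \<longleftrightarrow> a = v"
    using single_label[OF N(1)] by (elim exE conjE)
  note v = v'(1) v'(2)[rule_format]
  obtain u where u': "u \<in> V" "\<forall>a\<in>V. \<kappa> a = 3 \<longleftrightarrow> a = u"
    using single_label[OF N(2)] by (elim exE conjE)
  note u = u'(1) u'(2)[rule_format]
  obtain w where w': "w \<in> V" "\<forall>a\<in>V. \<kappa> a = 4 \<longleftrightarrow> a = w"
    using single_label[OF N(3)] by (elim exE conjE)
  note w = w'(1) w'(2)[rule_format]
  define \<tau> where "\<tau> = part_of_label r \<circ> \<kappa>"
  have s1: "card {a \<in> V. \<tau> a = 1} = label_count V \<kappa> 1 + 1"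
    unfolding \<tau>_def card_label_preimage[OF V(1) \<kappa> part_of_label_preimage(1)[OF r]] using N by simp
  have sr: "card {a \<in> V. \<tau> a = r} = label_count V \<kappa> 0 + 2"
    unfolding \<tau>_def card_label_preimage[OF V(1) \<kappa> part_of_label_preimage(2)[OF r]] using N by simp
  have si: "card {a \<in> V. \<tau> a = i} = label_count V \<kappa> (i + 3)" if "2 \<le> i" "i < r" for i
    unfolding \<tau>_def card_label_preimage[OF V(1) \<kappa> part_of_label_preimage(3)[OF r that]] by simp
  have bounds: "label_count V \<kappa> 1 + 1 \<le> card {a \<in> V. \<tau> a = i} \<and>
      card {a \<in> V. \<tau> a = i} \<le> card {a \<in> V. \<tau> a = r}" if i: "i \<in> {1..r}" for i
  proof -
    consider "i = 1" | "i = r" | "2 \<le> i" "i < r"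
      using i by fastforce
    then show ?thesis
    proof cases
      case 3
      then show ?thesis
        using sizes[of "i + 3"] si[OF 3] sr by simp
    qed (use s1 sr le in auto)
  qed
  have rng: "\<tau> ` V \<subseteq> {1..r}"
    using \<kappa> part_of_label_range[OF r] by (auto simp: \<tau>_def simp del: atLeastAtMost_iff)
  have "\<kappa> v = 2" "\<kappa> u = 3" "\<kappa> w = 4"
    using v u w by simp_all
  then have tl: "u \<noteq> w" "\<tau> u = r" "\<tau> w = r" "\<tau> v = 1"
    by (auto simp: \<tau>_def part_of_label_def)
  have sr': "card {a \<in> V. \<tau> a = r} \<le> label_count V \<kappa> 1 + 1 + 1"
    using sr le by simp
  have mem: "{u, w, v} \<subseteq> V"
    using u(1) w(1) v(1) by simp
  have eq: "lab_graph V \<kappa> = Y_model V \<tau> u w v"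
    unfolding \<tau>_def by (rule lab_graph_eq_Y_model[OF r \<kappa> u(2) w(2) v(2)])
  show ?thesis
    unfolding eq by (rule Y_model_iso[OF r V(1) refl rng mem tl V(2) s1 sr']) (rule bounds)
qed

context pentagon_extremal
begin

lemma card_V_ge: "r + 3 \<le> card V"
  using card_image_le[OF finV, of \<kappa>] img by simp

lemma less_spectral_radius_of_subset:
  assumes sub: "F \<subseteq> M" and M: "M \<subseteq> V \<times> V" and gt: "quad E x < quad F x"
    and \<phi>: "bij_betw \<phi> V (pverts H)" "map_prod \<phi> \<phi> ` M = parcs H" and H: "pair_graph H"
  shows "lam < graph_spectral_radius H"
proof -
  obtain v where v: "v \<in> V"
    using label_rep[OF core_lt(1)] by blast
  have pos: "0 < (\<Sum>a\<in>V. (x a)\<^sup>2)"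
  proof (rule sum_pos)
    fix a assume "a \<in> V"
    then show "0 < (x a)\<^sup>2"
      using x_pos[of a] by simp
  qed (use v finV in auto)
  have "finite M"
    using M finV finite_subset by blast
  then have "quad F x \<le> quad M x"
    using sub M x_pos by (intro quad_mono) (auto intro: less_imp_le)
  also have "\<dots> \<le> graph_spectral_radius H * (\<Sum>a\<in>V. (x a)\<^sup>2)"
    by (rule quad_le_of_embedding[OF H \<phi>(1) M]) (use \<phi>(2) v x_pos in \<open>auto intro: less_imp_le\<close>)
  finally have "lam * (\<Sum>a\<in>V. (x a)\<^sup>2) < graph_spectral_radius H * (\<Sum>a\<in>V. (x a)\<^sup>2)"
    using gt quad_E by linarith
  then show ?thesis
    using pos by (simp add: mult_less_cancel_right)
qed

lemma iso_or_less_aux: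
  assumes le: "N 0 \<le> N 1"
  defines "H \<equiv> Y_graph r (card V)"
  shows "(\<exists>\<phi>. bij_betw \<phi> V (pverts H) \<and> map_prod \<phi> \<phi> ` E = parcs H) \<or> lam < graph_spectral_radius H"
proof -
  have n: "r + 1 \<le> card V"
    using card_V_ge by simp
  have H: "pair_graph H"
    unfolding H_def by (rule pair_graph_Y_graph[OF r2 n])
  from sizes[OF le] show ?thesis
  proof
    assume A: "N 1 \<le> N 0 + 1 \<and> (\<forall>j. 5 \<le> j \<longrightarrow> j < r + 3 \<longrightarrow> N 1 + 1 \<le> N j \<and> N j \<le> N 0 + 2)"
    have "\<exists>\<phi>. bij_betw \<phi> V (pverts H) \<and> map_prod \<phi> \<phi> ` E = parcs H"
      unfolding H_def E_lab by (rule lab_graph_iso_Y_graph[OF r2 finV n img_sub N2 N3 N4 le]) (use A in simp_all)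
    then show ?thesis ..
  next
    assume B: "N 0 = 1 \<and> N 1 = 1 \<and> (\<exists>j. 5 \<le> j \<and> j < r + 3 \<and> N j = 1) \<and>
      (\<forall>j. 5 \<le> j \<longrightarrow> j < r + 3 \<longrightarrow> N j \<le> 2)"
    then have "\<exists>j. 5 \<le> j \<and> j < r + 3 \<and> N j = 1"
      by (elim conjE)
    then obtain j where j: "5 \<le> j" "j < r + 3" "N j = 1"
      by (elim exE conjE)
    have N01: "N 0 = 1" "N 1 = 1"
      using B by simp_all
    obtain t where t0': "t \<in> V" "\<forall>a\<in>V. \<kappa> a = 0 \<longleftrightarrow> a = t"
      using single_label[OF N01(1)] by (elim exE conjE)
    note t = t0'(1) t0'(2)[rule_format]
    have t0: "\<kappa> t = 0" using t by auto
    define \<kappa>' where "\<kappa>' = \<kappa>(t := j)"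
    define F where "F = lab_graph V \<kappa>'"
    have sub': "\<kappa>' ` V \<subseteq> {..<r + 3}"
      using img_sub j by (auto simp: \<kappa>'_def)
    have \<kappa>'0: "\<kappa>' a \<noteq> 0" if "a \<in> V" for a
      using t(2)[OF that] j by (auto simp: \<kappa>'_def)
    have \<kappa>'l: "\<kappa>' a = l \<longleftrightarrow> \<kappa> a = l" if "a \<in> V" "l \<noteq> 0" "l \<noteq> j" for a l
      using t(2)[OF that(1)] that t0 by (auto simp: \<kappa>'_def)
    have tj: "\<kappa> t \<noteq> j"
      using t0 j(1) by simp
    note upd = label_count_fun_upd[where \<kappa>=\<kappa> and t=t and i=j, OF finV t(1) tj, folded \<kappa>'_def, unfolded t0]
    have cnt: "label_count V \<kappa>' 0 = 0" "label_count V \<kappa>' j = 2"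
      using upd(1,2) j(3) N01(1) by simp_all
    have cnt_other: "label_count V \<kappa>' l = N l" if "l \<noteq> 0" "l \<noteq> j" for l
      using upd(3)[OF that(2,1)] .
    \<comment> \<open>The move empties class 0, so the new graph leaves the nonpartite class and
      extremality of \<open>E\<close> does not contradict this gain. It is used against
      \<open>Y_graph\<close> directly.\<close>
    have gt: "quad E x < quad F x"
    proof -
      have "0 < 2 * x t * (lam * \<xi> j - (lam + 1) * \<xi> 0)"
        using part_weight[OF j(1,2)] j(3) B x_pos[OF t(1)] by simp
      then show ?thesis
        using quad_move(1)[OF t(1) j(2)] j(1) t0 by (simp add: F_def \<kappa>'_def lab_adj_part)
    qed
    show ?thesis
    proof (cases "\<exists>j'. 5 \<le> j' \<and> j' < r + 3 \<and> j' \<noteq> j \<and> N j' = 1")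
      \<comment> \<open>Here \<open>n = 2 * r\<close>: after the move all full parts have size 2,
        and \<open>F\<close> is a copy of \<open>Y_graph\<close>.\<close>
      case False
      have cnt2: "label_count V \<kappa>' l = 2" if "5 \<le> l" "l < r + 3" for l
      proof (cases "l = j")
        case l: False
        have "N l \<noteq> 1" "1 \<le> N l" "N l \<le> 2"
          using False B N_pos[of l] that l by auto
        then show ?thesis
          using cnt_other[of l] that l by simp
      qed (simp add: cnt)
      have cntc: "label_count V \<kappa>' 1 = 1" "label_count V \<kappa>' 2 = 1" "label_count V \<kappa>' 3 = 1" "label_count V \<kappa>' 4 = 1"
        using cnt_other N01 N2 N3 N4 j(1) by simp_all
      have "\<exists>\<phi>. bij_betw \<phi> V (pverts H) \<and> map_prod \<phi> \<phi> ` F = parcs H"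
        unfolding H_def F_def by (rule lab_graph_iso_Y_graph[OF r2 finV n sub' cntc(2-4)]) (simp_all only: cnt cntc cnt2; simp)+
      then obtain \<phi> where "bij_betw \<phi> V (pverts H)" "map_prod \<phi> \<phi> ` F = parcs H"
        by (elim exE conjE)
      moreover have "F \<subseteq> V \<times> V"
        by (auto simp: F_def lab_graph_def)
      ultimately show ?thesis
        using less_spectral_radius_of_subset[OF subset_refl _ gt _ _ H] by blast
    next
      \<comment> \<open>Here \<open>n < 2 * r\<close>: a second single part \<open>j'\<close>
        supplies, together with the vertex labelled 3, the edge inside the last part.\<close>
      case True
      then obtain j' where j': "5 \<le> j'" "j' < r + 3" "j' \<noteq> j" "N j' = 1"
        by (elim exE conjE)
      obtain t' where t'0: "t' \<in> V" "\<forall>a\<in>V. \<kappa> a = j' \<longleftrightarrow> a = t'"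
        using single_label[OF j'(4)] by (elim exE conjE)
      note t' = t'0(1) t'0(2)[rule_format]
      obtain p where p0': "p \<in> V" "\<forall>a\<in>V. \<kappa> a = 1 \<longleftrightarrow> a = p"
        using single_label[OF N01(2)] by (elim exE conjE)
      note p = p0'(1) p0'(2)[rule_format]
      obtain u where u': "u \<in> V" "\<forall>a\<in>V. \<kappa> a = 3 \<longleftrightarrow> a = u"
        using single_label[OF N3] by (elim exE conjE)
      note u = u'(1) u'(2)[rule_format]
      define \<tau> where "\<tau> = alt_part r j' \<circ> \<kappa>'"
      have cntc: "label_count V \<kappa>' 1 = 1" "label_count V \<kappa>' 2 = 1" "label_count V \<kappa>' 3 = 1" "label_count V \<kappa>' 4 = 1"
        "label_count V \<kappa>' j' = 1"
        using cnt_other B N2 N3 N4 j(1) j' by simp_all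
      note pre = alt_part_preimage[OF r2 j'(1,2)]
      have s1: "card {a \<in> V. \<tau> a = 1} = 1"
        unfolding \<tau>_def card_label_preimage[OF finV sub' pre(1)] using cntc by simp
      have sr: "card {a \<in> V. \<tau> a = r} = 2"
        unfolding \<tau>_def card_label_preimage[OF finV sub' pre(2)] using cntc j'(1) by simp
      have sj: "card {a \<in> V. \<tau> a = j' - 3} = 2"
        unfolding \<tau>_def card_label_preimage[OF finV sub' pre(3)] using cntc by simp
      have bounds: "1 \<le> card {a \<in> V. \<tau> a = i} \<and> card {a \<in> V. \<tau> a = i} \<le> card {a \<in> V. \<tau> a = r}" if i: "i \<in> {1..r}" for i
      proof -
        consider "i = 1" | "i = r" | "i = j' - 3" | "2 \<le> i" "i < r" "i \<noteq> j' - 3"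
          using i by fastforce
        then show ?thesis
        proof cases
          case 4
          have "card {a \<in> V. \<tau> a = i} = label_count V \<kappa>' (i + 3)"
            unfolding \<tau>_def card_label_preimage[OF finV sub' pre(4)[OF 4]] by simp
          moreover have "1 \<le> label_count V \<kappa>' (i + 3) \<and> label_count V \<kappa>' (i + 3) \<le> 2"
            using cnt(2) cnt_other[of "i + 3"] B N_pos[of "i + 3"] 4 by (cases "i + 3 = j") auto
          ultimately show ?thesis
            using sr by simp
        qed (use s1 sr sj in auto)
      qed
      have \<kappa>'_lt: "\<kappa>' a < r + 3" if "a \<in> V" for a
        using sub' that by auto
      have rng: "\<tau> ` V \<subseteq> {1..r}"
        using alt_part_range[OF r2 j'(1,2) \<kappa>'0 \<kappa>'_lt] by (simp add: \<tau>_def image_subset_iff del: atLeastAtMost_iff)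
      have lab': "\<kappa>' p = 1" "\<kappa>' u = 3" "\<kappa>' t' = j'"
        using p u t' \<kappa>'l[OF p(1), of 1] \<kappa>'l[OF u(1), of 3] \<kappa>'l[OF t'(1), of j'] j(1) j' by auto
      then have tl: "t' \<noteq> u" "\<tau> t' = r" "\<tau> u = r" "\<tau> p = 1"
        using j'(1) by (auto simp: \<tau>_def alt_part_def)
      have sr': "card {a \<in> V. \<tau> a = r} \<le> 1 + 1"
        unfolding sr by simp
      have mem: "{t', u, p} \<subseteq> V"
        using t'(1) u(1) p(1) by simp
      have "\<exists>\<phi>. bij_betw \<phi> V (pverts H) \<and> map_prod \<phi> \<phi> ` Y_model V \<tau> t' u p = parcs H"
        unfolding H_def by (rule Y_model_iso[OF r2 finV refl rng mem tl n s1 sr']) (rule bounds)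
      then obtain \<phi> where \<phi>: "bij_betw \<phi> V (pverts H)" "map_prod \<phi> \<phi> ` Y_model V \<tau> t' u p = parcs H"
        by (elim exE conjE)
      have "F \<subseteq> Y_model V \<tau> t' u p"
      proof safe
        fix a b assume "(a, b) \<in> F"
        then have ab: "a \<in> V" "b \<in> V" "lab_adj (\<kappa>' a) (\<kappa>' b)"
          by (simp_all add: F_def lab_graph_def)
        have single: "c = p \<longleftrightarrow> \<kappa>' c = 1" "c = u \<longleftrightarrow> \<kappa>' c = 3" "c = t' \<longleftrightarrow> \<kappa>' c = j'" if "c \<in> V" for c
          using p(2)[OF that] u(2)[OF that] t'(2)[OF that] \<kappa>'l[OF that] j(1) j' by auto
        have "\<tau> a \<noteq> \<tau> b \<and> (\<kappa>' a, \<kappa>' b) \<noteq> (1, 3) \<and> (\<kappa>' a, \<kappa>' b) \<noteq> (3, 1) \<or>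
            (\<kappa>' a, \<kappa>' b) = (3, j') \<or> (\<kappa>' a, \<kappa>' b) = (j', 3)"
          unfolding \<tau>_def o_apply by (rule alt_part_lab_adj[OF r2 j'(1,2)]) (use ab \<kappa>'0 \<kappa>'_lt in auto)
        moreover have "\<tau> c = 1 \<longleftrightarrow> c = p" if "c \<in> V" for c
          unfolding \<tau>_def o_apply single(1)[OF that] by (rule alt_part_eq_1_iff[OF r2 j'(1,2) \<kappa>'0[OF that]])
        moreover have "t' \<noteq> u" "p \<noteq> u" "p \<noteq> t'"
          using tl r2 by auto
        ultimately show "(a, b) \<in> Y_model V \<tau> t' u p"
          using ab(1,2) unfolding Y_model_def prod.inject single(1-3)[OF ab(1), symmetric] single(1-3)[OF ab(2), symmetric]
          by auto
      qed
      moreover have "Y_model V \<tau> t' u p \<subseteq> V \<times> V"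
        by (auto simp: Y_model_def)
      ultimately show ?thesis
        using less_spectral_radius_of_subset[OF _ _ gt \<phi> H] by blast
    qed
  qed
qed

lemma iso_or_less:
  defines "H \<equiv> Y_graph r (card V)"
  shows "(\<exists>\<phi>. bij_betw \<phi> V (pverts H) \<and> map_prod \<phi> \<phi> ` E = parcs H) \<or> lam < graph_spectral_radius H"
proof (cases "N 0 \<le> N 1")
  case True
  then show ?thesis
    unfolding H_def by (rule iso_or_less_aux)
next
  case False
  interpret M: pentagon_extremal V E x lam r "reflect_y \<circ> \<kappa>"
    by (rule reflected_y)
  show ?thesis
    unfolding H_def by (rule M.iso_or_less_aux) (use False in \<open>simp only: reflected_counts; simp\<close>)
qed

end

theorem (in extremal) iso_Y_graph_or_less:
  defines "H \<equiv> Y_graph r (card V)"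
  shows "(\<exists>\<phi>. bij_betw \<phi> V (pverts H) \<and> map_prod \<phi> \<phi> ` E = parcs H) \<or> lam < graph_spectral_radius H"
proof -
  obtain \<kappa> where \<kappa>: "\<kappa> ` V = {..<r + 3}" "card {w \<in> V. \<kappa> w = 3} = 1" "card {w \<in> V. \<kappa> w = 4} = 1"
    "E = lab_graph V \<kappa>"
    by (rule lab_graph_structure)
  interpret L: lab_extremal V E x lam r \<kappa>
    by unfold_locales (fact \<kappa>)+
  have c: "label_count V \<kappa> 3 = 1" "label_count V \<kappa> 4 = 1"
    using \<kappa> by (simp_all add: label_count_def)
  show ?thesis
  proof (cases "label_count V \<kappa> 2 = 1")
    case True
    interpret P: pentagon_extremal V E x lam r \<kappa>
      by unfold_locales (fact True c)+
    show ?thesis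
      unfolding H_def by (rule P.iso_or_less)
  next
    case False
    then have c1: "label_count V \<kappa> 1 = 1"
      using L.one_side_single by simp
    interpret M: lab_extremal V E x lam r "reflect_B \<circ> \<kappa>"
    proof (rule L.reflected)
      show "reflect_B (reflect_B i) = i" for i
        by simp
      show "lab_adj (reflect_B i) (reflect_B j) = lab_adj i j" for i j
        by (rule reflect_adj)
      show "i < r + 3 \<Longrightarrow> reflect_B i < r + 3" for i
        using r2 by (auto simp: reflect_B_def)
    qed
    interpret P: pentagon_extremal V E x lam r "reflect_B \<circ> \<kappa>"
    proof
      show "label_count V (reflect_B \<circ> \<kappa>) 2 = 1" "label_count V (reflect_B \<circ> \<kappa>) 3 = 1"
        "label_count V (reflect_B \<circ> \<kappa>) 4 = 1"
        using c c1 by (simp_all add: label_count_involution reflect_B_def)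
    qed
    show ?thesis
      unfolding H_def by (rule P.iso_or_less)
  qed
qed

section \<open>Positivity of the Perron vector of a maximizer\<close>

lemma pair_graph_of_simple_graph:
  assumes "simple_graph V F"
  shows "pair_graph \<lparr>pverts = V, parcs = F\<rparr>"
  by (rule pair_graphI) (use assms in \<open>simp_all add: simple_graph_def\<close>)

text \<open>Connectivity is not given, so positivity uses maximality. A zero of \<open>x\<close>
  spreads to all neighbours. If \<open>x\<close> vanishes at \<open>u\<close> but not at
  \<open>c\<close>, add the edge \<open>uc\<close>: a clique on \<open>r + 1 \<ge> 3\<close>
  vertices using it contains a common neighbour of \<open>u\<close> and \<open>c\<close>, through
  which the zero would reach \<open>c\<close>. The form does not drop, so \<open>x\<close> is an
  eigenvector of the new graph, and row \<open>u\<close> contradicts \<open>0 < x c\<close>.\<close>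

lemma extremal_of_maximizer:
  fixes V :: "'a set"
  assumes r: "2 \<le> r" and F: "nonpartite_class r V F"
    and m: "m = graph_spectral_radius \<lparr>pverts = V, parcs = F\<rparr>"
    and max: "\<And>F'. nonpartite_class r V F' \<Longrightarrow> graph_spectral_radius \<lparr>pverts = V, parcs = F'\<rparr> \<le> m"
  shows "\<exists>x. extremal V F x m r"
proof -
  have Fs: "simple_graph V F" and Fc: "clique_free (r + 1) V F" and Fn: "\<not> colorable r V F"
    using F by (simp_all add: nonpartite_class_def)
  note V = simple_graphD[OF Fs]
  have ne: "V \<noteq> {}"
    using Fn by (auto simp: colorable_def)
  have bound: "quad F' y \<le> m * (\<Sum>u\<in>V. (y u)\<^sup>2)" if F': "nonpartite_class r V F'" for F' y
  proof -
    have "pair_graph \<lparr>pverts = V, parcs = F'\<rparr>"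
      using F' by (intro pair_graph_of_simple_graph) (simp add: nonpartite_class_def)
    then have "quad F' y \<le> graph_spectral_radius \<lparr>pverts = V, parcs = F'\<rparr> * (\<Sum>u\<in>V. (y u)\<^sup>2)"
      using graph_spectral_radius_rayleigh[of "\<lparr>pverts = V, parcs = F'\<rparr>"] ne
      by (metis pair_pre_digraph.select_convs)
    also have "\<dots> \<le> m * (\<Sum>u\<in>V. (y u)\<^sup>2)"
      using max[OF F'] by (intro mult_right_mono) (auto intro: sum_nonneg)
    finally show ?thesis .
  qed
  obtain x where x: "\<And>u. 0 \<le> x u" "(\<Sum>u\<in>V. (x u)\<^sup>2) = 1" "quad F x = m"
    using graph_spectral_radius_rayleigh[OF pair_graph_of_simple_graph[OF Fs]] ne m
    by (metis pair_pre_digraph.select_convs)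
  have eig: "sum x (F' `` {u}) = m * x u" if F': "nonpartite_class r V F'" "m \<le> quad F' x" "u \<in> V" for F' u
  proof -
    have "simple_graph V F'"
      using F' by (simp add: nonpartite_class_def)
    note V' = simple_graphD[OF this]
    have "quad F' x = m * (\<Sum>u\<in>V. (x u)\<^sup>2)"
      using bound[OF F'(1), of x] F'(2) x(2) by simp
    then show ?thesis
      using quad_max_imp_eigenvector[OF V'(1-3) bound[OF F'(1)]] F'(3) by blast
  qed
  have eigF: "sum x (F `` {u}) = m * x u" if "u \<in> V" for u
    using eig[OF F _ that] x(3) by simp
  have finN: "finite (F `` {u})" for u
    using V(1,2) finite_subset[of "F `` {u}" V] by blast
  have pos: "0 < x u" if u: "u \<in> V" for u
  proof (rule ccontr)
    assume "\<not> 0 < x u"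
    then have xu: "x u = 0" using x(1)[of u] by simp
    obtain c where c: "c \<in> V" "x c \<noteq> 0"
      using x(2) by (metis (no_types, lifting) power2_eq_square mult_zero_left sum.neutral zero_neq_one)
    have zero_nbr: "x b = 0" if "a \<in> V" "x a = 0" "(a, b) \<in> F" for a b
    proof -
      have "sum x (F `` {a}) = 0"
        using eigF[OF that(1)] that(2) by simp
      then show ?thesis
        using finN x(1) that(3) by (simp add: sum_nonneg_eq_0_iff)
    qed
    have uc: "(u, c) \<notin> F" "u \<noteq> c"
      using zero_nbr[OF u xu] c(2) xu by auto
    define F' where "F' = F \<union> {(u, c), (c, u)}"
    have F's: "simple_graph V F'"
      using Fs u c uc unfolding simple_graph_def F'_def sym_def irrefl_def by auto
    have "clique_free (r + 1) V F'"
    proof (rule clique_freeI)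
      fix C assume C: "C \<subseteq> V" "clique F' C" "card C = r + 1"
      show False
      proof (cases "u \<in> C \<and> c \<in> C")
        case True
        have "card (C - {u, c}) = r - 1"
          using True uc C(3) by (simp add: card_Diff_subset)
        then have "C - {u, c} \<noteq> {}"
          using r by (metis Suc_1 Suc_le_lessD card.empty less_not_refl zero_less_diff)
        then obtain d where d: "d \<in> C" "d \<noteq> u" "d \<noteq> c"
          by blast
        then have "(u, d) \<in> F" "(d, c) \<in> F"
          using True C(2) by (auto simp: clique_def F'_def)
        then show False
          using zero_nbr[OF u xu] zero_nbr[of d c] c(2) d(1) C(1) by blast
      next
        case False
        then have "clique F C"
          using C(2) unfolding clique_def F'_def by blast
        then show False
          using clique_free_card_le[OF Fc V(1) C(1)] C(3) by simp
      qed
    qed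
    moreover have "\<not> colorable r V F'"
      using Fn colorable_mono[of r V F' V F] by (auto simp: F'_def)
    ultimately have F'c: "nonpartite_class r V F'"
      using F's by (simp add: nonpartite_class_def)
    have "quad F x \<le> quad F' x"
      using simple_graphD(5)[OF F's] x(1) by (intro quad_mono) (auto simp: F'_def)
    then have "sum x (F' `` {u}) = 0"
      using eig[OF F'c _ u] x(3) xu by simp
    moreover have "F' `` {u} = insert c (F `` {u})"
      using uc by (auto simp: F'_def)
    ultimately have "x c + sum x (F `` {u}) = 0"
      using finN[of u] uc by simp
    moreover have "0 \<le> sum x (F `` {u})"
      using x(1) by (intro sum_nonneg)
    ultimately show False
      using c x(1)[of c] by linarith
  qed
  have "extremal V F x m r"
    by unfold_locales (fact r F pos eigF bound)+
  then show ?thesis by blast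
qed

section \<open>Translation to the graph notions of the theorem\<close>

lemma clique_free_of_not_contains_complete:
  assumes G: "pair_graph G" and nc: "\<not> contains_complete k G"
  shows "clique_free k (pverts G) (parcs G)"
  unfolding clique_free_def
proof
  interpret G: pair_graph G by fact
  assume "\<exists>C\<subseteq>pverts G. card C = k \<and> clique (parcs G) C"
  then obtain C where C: "C \<subseteq> pverts G" "card C = k" "clique (parcs G) C"
    by blast
  define H where "H = \<lparr>pverts = C, parcs = {(u, v). (u, v) \<in> C \<times> C \<and> u \<noteq> v}\<rparr>"
  have "finite C"
    using C(1) G.pair_finite_verts finite_subset by blast
  then have Hc: "complete_digraph k (with_proj H)"
    unfolding complete_digraph_pair_def by (simp add: H_def C(2))
  then have "wf_digraph (with_proj H)"
    unfolding complete_digraph_def by (simp add: graph_def digraph_def fin_digraph_def)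
  moreover have "parcs H \<subseteq> parcs G"
    using C(3) by (auto simp: H_def clique_def)
  ultimately have "subgraph (with_proj H) (with_proj G)"
    using C(1) G.wf_digraph by (simp add: subgraph_def compatible_def H_def)
  then show False
    using Hc nc unfolding contains_complete_def by blast
qed

lemma not_colorable_of_not_r_partite:
  assumes G: "pair_graph G" and np: "\<not> r_partite r G"
  shows "\<not> colorable r (pverts G) (parcs G)"
proof
  interpret G: pair_graph G by fact
  assume "colorable r (pverts G) (parcs G)"
  then obtain f :: "'a \<Rightarrow> nat" where f: "\<forall>v\<in>pverts G. f v < r"
    "\<forall>u\<in>pverts G. \<forall>v\<in>pverts G. (u, v) \<in> parcs G \<longrightarrow> f u \<noteq> f v"
    unfolding colorable_def by blast
  have "r_partite r G"
    unfolding r_partite_def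
  proof (intro exI[of _ "\<lambda>i. {v \<in> pverts G. f v = i}"] conjI allI impI)
    show "(\<Union>i<r. {v \<in> pverts G. f v = i}) = pverts G"
      using f(1) by auto
    show "disjoint_family_on (\<lambda>i. {v \<in> pverts G. f v = i}) {..<r}"
      by (auto simp: disjoint_family_on_def)
    fix i
    show "independent_set G {v \<in> pverts G. f v = i}"
      unfolding independent_set_def
    proof (intro conjI ballI)
      fix u v assume "u \<in> {v \<in> pverts G. f v = i}" "v \<in> {v \<in> pverts G. f v = i}"
      then show "(u, v) \<notin> parcs G"
        using f(2)[rule_format, of u v] by auto
    qed auto
  qed
  then show False
    using np by simp
qed

lemma simple_graph_of_pair_graph:
  assumes "pair_graph G"
  shows "simple_graph (pverts G) (parcs G)"
proof -
  interpret pair_graph G by fact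
  have "irrefl (parcs G)"
    unfolding irrefl_def using no_loops'[of a a for a] by blast
  then show ?thesis
    unfolding simple_graph_def
    using pair_finite_verts in_arcsD1 in_arcsD2 arcs_symmetric by (auto simp: sym_def)
qed

theorem theorem4p3:
  fixes G :: "'a pair_pre_digraph" and r n :: nat
  assumes "2 \<le> r"
    and "pair_graph G"
    and "card (pverts G) = n"
    and "\<not> contains_complete (r + 1) G"
    and "\<not> r_partite r G"
  shows "graph_spectral_radius G \<le> graph_spectral_radius (Y_graph r n) \<and>
    (graph_spectral_radius G = graph_spectral_radius (Y_graph r n) \<longleftrightarrow>
       digraph_iso (with_proj G) (with_proj (Y_graph r n)))"
proof -
  define V where "V = pverts G"
  define \<rho> where "\<rho> F = graph_spectral_radius \<lparr>pverts = V, parcs = F\<rparr>" for F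
  define Y where "Y = Y_graph r n"
  have Gs: "simple_graph V (parcs G)"
    unfolding V_def by (rule simple_graph_of_pair_graph[OF assms(2)])
  have GV: "G = \<lparr>pverts = V, parcs = parcs G\<rparr>"
    by (simp add: V_def)
  have cG: "nonpartite_class r V (parcs G)"
    using Gs clique_free_of_not_contains_complete[OF assms(2,4)] not_colorable_of_not_r_partite[OF assms(2,5)]
    by (simp add: nonpartite_class_def V_def)
  define \<F> where "\<F> = {F. nonpartite_class r V F}"
  have "\<F> \<subseteq> Pow (V \<times> V)"
    by (auto simp: \<F>_def nonpartite_class_def simple_graph_def)
  then have fin: "finite \<F>"
    using simple_graphD(1)[OF Gs] finite_subset by blast
  define m where "m = Max (\<rho> ` \<F>)"
  have max: "\<rho> F \<le> m" if "F \<in> \<F>" for F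
    using fin that by (simp add: m_def)
  have "parcs G \<in> \<F>"
    using cG by (simp add: \<F>_def)
  have ne: "V \<noteq> {}"
    using cG by (auto simp: nonpartite_class_def colorable_def)
  \<comment> \<open>The second alternative is no contradiction: for small \<open>n\<close> the graph
    \<open>Y\<close> is \<open>r\<close>-partite and lies outside the class, and then equality never
    occurs.\<close>
  have main: "(\<exists>\<phi>. bij_betw \<phi> V (pverts Y) \<and> map_prod \<phi> \<phi> ` F = parcs Y) \<or> m < graph_spectral_radius Y"
    and r_n: "r + 1 \<le> n" if F: "F \<in> \<F>" "\<rho> F = m" for F
  proof -
    obtain x where "extremal V F x m r"
      using extremal_of_maximizer[OF assms(1), of V F m] F max by (auto simp: \<F>_def \<rho>_def)
    then interpret extremal V F x m r .
    show "(\<exists>\<phi>. bij_betw \<phi> V (pverts Y) \<and> map_prod \<phi> \<phi> ` F = parcs Y) \<or> m < graph_spectral_radius Y"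
      using iso_Y_graph_or_less assms(3) by (simp add: Y_def V_def)
    obtain \<kappa> :: "'a \<Rightarrow> nat" where "\<kappa> ` V = {..<r + 3}"
      using lab_graph_structure by metis
    then have "r + 3 \<le> card V"
      using card_image_le[OF finV, of \<kappa>] by simp
    then show "r + 1 \<le> n"
      using assms(3) by (simp add: V_def)
  qed
  have "m \<in> \<rho> ` \<F>"
    unfolding m_def using fin \<open>parcs G \<in> \<F>\<close> by (intro Max_in) auto
  then obtain F0 where F0: "F0 \<in> \<F>" "\<rho> F0 = m"
    by auto
  have pY: "pair_graph Y"
    unfolding Y_def by (rule pair_graph_Y_graph[OF assms(1) r_n[OF F0]])
  have iso_eq: "\<rho> F = graph_spectral_radius Y"
    if "F \<in> \<F>" "bij_betw \<phi> V (pverts Y)" "map_prod \<phi> \<phi> ` F = parcs Y" for F \<phi>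
  proof -
    have "pair_graph \<lparr>pverts = V, parcs = F\<rparr>"
      using that(1) by (intro pair_graph_of_simple_graph) (simp add: \<F>_def nonpartite_class_def)
    then show ?thesis
      unfolding \<rho>_def using spectral_radius_eq_of_iso[OF _ _ pY, of _ \<phi>] that ne by simp
  qed
  have mY: "m \<le> graph_spectral_radius Y"
    using main[OF F0] iso_eq[OF F0(1)] F0(2) by auto
  have \<rho>G: "\<rho> (parcs G) = graph_spectral_radius G"
    unfolding \<rho>_def using GV by simp
  have le: "graph_spectral_radius G \<le> m"
    using max[OF \<open>parcs G \<in> \<F>\<close>] \<rho>G by simp
  have "graph_spectral_radius G = graph_spectral_radius Y \<longleftrightarrow>
      (\<exists>\<phi>. bij_betw \<phi> V (pverts Y) \<and> map_prod \<phi> \<phi> ` parcs G = parcs Y)"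
  proof
    assume "graph_spectral_radius G = graph_spectral_radius Y"
    then have "m = graph_spectral_radius Y" "\<rho> (parcs G) = m"
      using le mY \<rho>G by linarith+
    then show "\<exists>\<phi>. bij_betw \<phi> V (pverts Y) \<and> map_prod \<phi> \<phi> ` parcs G = parcs Y"
      using main[OF \<open>parcs G \<in> \<F>\<close>] by simp
  next
    assume "\<exists>\<phi>. bij_betw \<phi> V (pverts Y) \<and> map_prod \<phi> \<phi> ` parcs G = parcs Y"
    then show "graph_spectral_radius G = graph_spectral_radius Y"
      using iso_eq[OF \<open>parcs G \<in> \<F>\<close>] \<rho>G by auto
  qed
  then show ?thesis
    using le mY digraph_iso_with_proj_iff[OF assms(2), of Y] by (simp add: Y_def V_def)
qed

end
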